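(* Let $H$ be the $7$-dimensional Heisenberg group with Lie algebra $\mathfrak h$ as in the context, let $A>0$, and let $\varphi_1=e^{127}+e^{347}+e^{567}+e^{135}-e^{146}-e^{236}-e^{245}$. The solution of the modified Laplacian coflow with constant $A$ and initial coclosed $\mathrm{G}_2$ form $\varphi_1$ is $\psi(t)=\star_t\varphi(t)$ with $$\varphi(t)=\frac1{y(t)}\big(e^{127}+e^{347}+e^{567}\big)+y(t)^3\big(e^{135}-e^{146}-e^{236}-e^{245}\big),$$ where $y$ satisfies $$y'(t)=\frac{2A\sqrt6\,y(t)^5-1}{12\,y(t)^9},\qquad y(0)=1.$$ Moreover: (i) if $0<A<\frac1{2\sqrt6}$, then the maximal interval of existence is $(-\infty,T)$ with $T=-\frac1{10A^2}\Big(2\sqrt6A+\log\big(1-2\sqrt6A\big)\Big)>0$, so the solution is ancient; (ii) if $A\ge\frac1{2\sqrt6}$, then the solution is defined for all $t\in(-\infty,+\infty)$.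
   Context: The Heisenberg Lie algebra $\mathfrak h$ has a dual basis $\{e^1,\dots,e^7\}$ with $de^i=0$ ($1\le i\le6$) and $de^7=\frac{\sqrt6}{6}(e^{12}+e^{34}+e^{56})$, where $e^{ij\cdots}=e^i\wedge e^j\wedge\cdots$; $H$ is the simply connected Lie group with Lie algebra $\mathfrak h$ and left invariant forms are identified with $\Lambda^*\mathfrak h^*$. A left invariant $\mathrm{G}_2$ form is $\varphi\in\Lambda^3\mathfrak h^*$ equal to $x^{127}+x^{347}+x^{567}+x^{135}-x^{146}-x^{236}-x^{245}$ in some basis $\{x^i\}$ of $\mathfrak h^*$; it determines the metric $g_\varphi$ and orientation for which $\{x^i\}$ is oriented orthonormal, the Hodge star $\star_\varphi$, and $\psi=\star_\varphi\varphi$; it is coclosed if $d\psi=0$. For coclosed $\varphi$ one has uniquely $d\varphi=\tau_0\psi+\star_\varphi\tau_3$ with $\tau_0\in\mathbb R$ and $\tau_3\in\Lambda^3\mathfrak h^*$ satisfying $\tau_3\wedge\varphi=0=\tau_3\wedge\psi$. The modified Laplacian coflow with constant $A>0$ is $$\frac{d}{dt}\psi(t)=\Delta_t\psi(t)+2d\Big(\big(A-\mathrm{Tr}_t(\tau(t))\big)\varphi(t)\Big),\quad d\psi(t)=0,\quad\psi(0)=\star_{\varphi_1}\varphi_1,$$ where $\psi(t)=\star_t\varphi(t)$, $\star_t$ and $\Delta_t=dd^*+d^*d$ are with respect to $g_t=g_{\varphi(t)}$, and $\mathrm{Tr}_t(\tau(t))$ is the trace of the full torsion tensor of $\varphi(t)$,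 which for coclosed structures equals $\frac74\tau_0(t)$. A solution is ancient if its maximal interval of existence is $(-\infty,T)$ with $0<T<+\infty$. *)

theory Defs
  imports "HOL-Analysis.Analysis"
begin

text \<open>Left invariant forms on the 7-dimensional Heisenberg group, identified with
  the exterior algebra of the dual Lie algebra.  A form is a coefficient function
  on index sets: the coefficient of e^I (I increasing) is alpha I,
  for I a subset of {1..7}.\<close>

type_synonym form = "nat set \<Rightarrow> real"

definition U7 :: "nat set" where "U7 = {1..7}"

definition zeroform :: form where "zeroform = (\<lambda>_. 0)"

definition kform :: "nat \<Rightarrow> form \<Rightarrow> bool" where
  "kform k \<alpha> \<longleftrightarrow> (\<forall>I. \<alpha> I \<noteq> 0 \<longrightarrow> I \<subseteq> U7 \<and> card I = k)"

definition emon :: "nat set \<Rightarrow> form" where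
  "emon I = (\<lambda>J. if J = I then 1 else 0)"

text \<open>sign with e^I wedge e^J = wsign I J e^(I union J) for disjoint I, J\<close>
definition wsign :: "nat set \<Rightarrow> nat set \<Rightarrow> real" where
  "wsign I J = (-1) ^ card {(i, j). i \<in> I \<and> j \<in> J \<and> j < i}"

definition wedge :: "form \<Rightarrow> form \<Rightarrow> form" where
  "wedge \<alpha> \<beta> = (\<lambda>K. if K \<subseteq> U7 then (\<Sum>I\<in>Pow K. wsign I (K - I) * \<alpha> I * \<beta> (K - I)) else 0)"

definition oneform :: "(nat \<Rightarrow> real) \<Rightarrow> form" where
  "oneform v = (\<lambda>J. if (\<exists>j\<in>U7. J = {j}) then v (the_elem J) else 0)"

text \<open>A basis x^1..x^7 of the dual of h, x^i = sum_j P i j e^j; xmon P I = x^I.\<close>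
definition xmon :: "(nat \<Rightarrow> nat \<Rightarrow> real) \<Rightarrow> nat set \<Rightarrow> form" where
  "xmon P I = foldr wedge (map (\<lambda>i. oneform (P i)) (sorted_list_of_set I)) (emon {})"

definition expand :: "(nat \<Rightarrow> nat \<Rightarrow> real) \<Rightarrow> form \<Rightarrow> form" where
  "expand P c = (\<lambda>J. \<Sum>I\<in>Pow U7. c I * xmon P I J)"

definition xcoords :: "(nat \<Rightarrow> nat \<Rightarrow> real) \<Rightarrow> form \<Rightarrow> form" where
  "xcoords P \<alpha> = (SOME c. (\<forall>I. \<not> I \<subseteq> U7 \<longrightarrow> c I = 0) \<and> expand P c = \<alpha>)"

definition is_basis :: "(nat \<Rightarrow> nat \<Rightarrow> real) \<Rightarrow> bool" where
  "is_basis P \<longleftrightarrow> xmon P U7 U7 \<noteq> 0"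

text \<open>Hodge star of the standard oriented orthonormal coordinates:
  alpha wedge star beta = g(alpha,beta) vol\<close>
definition star0 :: "form \<Rightarrow> form" where
  "star0 c = (\<lambda>K. if K \<subseteq> U7 then wsign (U7 - K) K * c (U7 - K) else 0)"

text \<open>Hodge star for the metric and orientation making x oriented orthonormal\<close>
definition hodge :: "(nat \<Rightarrow> nat \<Rightarrow> real) \<Rightarrow> form \<Rightarrow> form" where
  "hodge P \<alpha> = expand P (star0 (xcoords P \<alpha>))"

definition phi0 :: form where
  "phi0 = (\<lambda>I. emon {1,2,7} I + emon {3,4,7} I + emon {5,6,7} I + emon {1,3,5} I
              - emon {1,4,6} I - emon {2,3,6} I - emon {2,4,5} I)"

definition G2frame :: "form \<Rightarrow> (nat \<Rightarrow> nat \<Rightarrow> real) \<Rightarrow> bool" where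
  "G2frame \<phi> P \<longleftrightarrow> is_basis P \<and> \<phi> = expand P phi0"

definition is_G2 :: "form \<Rightarrow> bool" where
  "is_G2 \<phi> \<longleftrightarrow> (\<exists>P. G2frame \<phi> P)"

text \<open>G2 form inducing the fixed orientation e^1234567 of h\<close>
definition pos_G2 :: "form \<Rightarrow> bool" where
  "pos_G2 \<phi> \<longleftrightarrow> (\<exists>P. G2frame \<phi> P \<and> xmon P U7 U7 > 0)"

definition frame :: "form \<Rightarrow> (nat \<Rightarrow> nat \<Rightarrow> real)" where
  "frame \<phi> = (SOME P. G2frame \<phi> P)"

text \<open>Hodge star of g_phi (independent of the chosen adapted basis)\<close>
definition starphi :: "form \<Rightarrow> form \<Rightarrow> form" where
  "starphi \<phi> = hodge (frame \<phi>)"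

definition de :: "nat \<Rightarrow> form" where
  "de i = (if i = 7 then (\<lambda>I. sqrt 6 / 6 * (emon {1,2} I + emon {3,4} I + emon {5,6} I))
           else zeroform)"

definition dmon :: "nat set \<Rightarrow> form" where
  "dmon I = (\<lambda>K. \<Sum>i\<in>I. (-1) ^ card {j\<in>I. j < i} * wedge (de i) (emon (I - {i})) K)"

definition dform :: "form \<Rightarrow> form" where
  "dform \<alpha> = (\<lambda>K. \<Sum>I\<in>Pow U7. \<alpha> I * dmon I K)"

text \<open>codifferential: on k-forms in dimension 7, d^* = (-1)^k star d star\<close>
definition codiff :: "form \<Rightarrow> form \<Rightarrow> form" where
  "codiff \<phi> \<alpha> = (\<lambda>K. (-1) ^ (card K + 1) * starphi \<phi> (dform (starphi \<phi> \<alpha>)) K)"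

definition laplacian :: "form \<Rightarrow> form \<Rightarrow> form" where
  "laplacian \<phi> \<alpha> = (\<lambda>K. dform (codiff \<phi> \<alpha>) K + codiff \<phi> (dform \<alpha>) K)"

definition tau0 :: "form \<Rightarrow> real" where
  "tau0 \<phi> = (THE r. \<exists>\<tau>3. kform 3 \<tau>3 \<and>
       dform \<phi> = (\<lambda>K. r * starphi \<phi> \<phi> K + starphi \<phi> \<tau>3 K) \<and>
       wedge \<tau>3 \<phi> = zeroform \<and> wedge \<tau>3 (starphi \<phi> \<phi>) = zeroform)"

definition trace_torsion :: "form \<Rightarrow> real" where
  "trace_torsion \<phi> = 7 / 4 * tau0 \<phi>"

definition coflow_rhs :: "real \<Rightarrow> form \<Rightarrow> form" where
  "coflow_rhs A \<phi> = (\<lambda>K. laplacian \<phi> (starphi \<phi> \<phi>) K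
      + 2 * dform (\<lambda>I. (A - trace_torsion \<phi>) * \<phi> I) K)"

definition phi1 :: form where "phi1 = phi0"

definition coflow_solution :: "real \<Rightarrow> real set \<Rightarrow> (real \<Rightarrow> form) \<Rightarrow> bool" where
  "coflow_solution A J \<phi> \<longleftrightarrow> is_interval J \<and> open J \<and> 0 \<in> J \<and>
     (\<forall>t\<in>J. pos_G2 (\<phi> t) \<and> dform (starphi (\<phi> t) (\<phi> t)) = zeroform \<and>
        (\<forall>K. ((\<lambda>s. starphi (\<phi> s) (\<phi> s) K) has_real_derivative coflow_rhs A (\<phi> t) K) (at t))) \<and>
     starphi (\<phi> 0) (\<phi> 0) = starphi phi1 phi1"

definition phi_y :: "real \<Rightarrow> form" where
  "phi_y y = (\<lambda>I. (1 / y) * (emon {1,2,7} I + emon {3,4,7} I + emon {5,6,7} I)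
       + y ^ 3 * (emon {1,3,5} I - emon {1,4,6} I - emon {2,3,6} I - emon {2,4,5} I))"

definition maximal_coflow_solution :: "real \<Rightarrow> real set \<Rightarrow> (real \<Rightarrow> form) \<Rightarrow> bool" where
  "maximal_coflow_solution A J \<phi> \<longleftrightarrow> coflow_solution A J \<phi> \<and>
     (\<forall>J' \<phi>'. coflow_solution A J' \<phi>' \<longrightarrow>
        J' \<subseteq> J \<and> (\<forall>t\<in>J'. starphi (\<phi>' t) (\<phi>' t) = starphi (\<phi> t) (\<phi> t)))"

end

theory Submission
  imports Defs
begin

text \<open>If \<open>\<phi>\<close> is the standard three-form in the coframe \<open>x\<close> given by the
    matrix \<open>P\<close>, then contracting
  \<open>\<phi>\<close> with \<open>e_i\<close> and with \<open>e_j\<close> and wedging both with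
      \<open>\<phi>\<close> gives \<open>6 * det P * g i j\<close> times the volume form
  \<open>e^1234567\<close>, where \<open>g = P^T P\<close>; hence \<open>\<phi>\<close> determines
      \<open>g\<close> and \<open>det P\<close>. The same computation for the dual
  three-vector of \<open>\<psi>\<close> gives \<open>6 * (det P)^2\<close> times the inverse metric, so that
      \<open>det P\<close>, \<open>\<phi>\<close>, the Hodge star
  and \<open>\<tau>0\<close> are explicit expressions in the coefficients of \<open>\<psi>\<close>, built from
      polynomials, a twelfth root
  and division by a positive quantity. Along two solutions on a compact interval the right-hand sides
  therefore differ by at most a multiple of the distance of the solutions, and Gronwall's inequality
  gives uniqueness. In the diagonal ansatz the flow reduces to the scalar equation, which is solved by
  inverting the elementary expression for time as a function of \<open>y\<close>. At a finite endpoint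
      \<open>T\<close> the
  volume factor \<open>det P = y^3\<close> tends to 0, whereas it would have a positive limit if a solution
      reached \<open>T\<close>.\<close>

subsection \<open>Exterior multiplication and contraction\<close>

text \<open>The Hodge star is defined through arbitrary choices: \<open>frame\<close> selects an
  adapted basis and \<open>xcoords\<close> selects coefficients in it. Nothing can be computed
  before the star is known to depend on the basis only through \<open>P^T P\<close> and
  \<open>det P\<close>; this is why those two are recovered from the form. A matrix acts on forms by
  \<open>expand P\<close>, the algebra homomorphism it induces, and its determinant, adjoint and
  inverse are read off from that action. Maximality compares the ansatz with every solution, not
  only with diagonal ones, so the flow has to be an ordinary differential equation for all
  coefficients of \<psi>, and \<psi> has to determine \<phi>. It does so only up to sign, since
  \<phi> and -\<phi> have the same four-form; the fixed orientation removes this ambiguity.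
  Identities special to the standard form are stated in an adapted basis, where all coefficients are
  integers and a finite computation decides them.\<close>

definition supported :: "form \<Rightarrow> bool" where
  "supported \<alpha> \<longleftrightarrow> (\<forall>I. \<not> I \<subseteq> U7 \<longrightarrow> \<alpha> I = 0)"

text \<open>\<open>e^i\<close> wedge \<open>e^K\<close> is \<open>isg i K\<close> times \<open>e^(insert i
    K)\<close> for \<open>i \<notin> K\<close>.\<close>

definition isg :: "nat \<Rightarrow> nat set \<Rightarrow> real" where
  "isg i K = (-1) ^ card {j\<in>K. j < i}"

text \<open>Multiplication by one basis covector involves the sign of a single index. Inductions
  over it avoid the double-index sign \<open>wsign\<close>, and \<open>contract\<close> is its
  adjoint for the inner product in which the \<open>emon I\<close> are orthonormal.\<close>

definition lwedge :: "nat \<Rightarrow> form \<Rightarrow> form" where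
  "lwedge i \<alpha> = (\<lambda>K. if K \<subseteq> U7 \<and> i \<in> K then isg i K * \<alpha> (K - {i}) else 0)"

definition contract :: "nat \<Rightarrow> form \<Rightarrow> form" where
  "contract i \<alpha> = (\<lambda>K. if insert i K \<subseteq> U7 \<and> i \<notin> K then isg i K * \<alpha>
      (insert i K) else 0)"

lemma finite_U7 [simp]: "finite U7"
  by (simp add: U7_def)

lemma fin7: "K \<subseteq> U7 \<Longrightarrow> finite K"
  using finite_U7 finite_subset by blast

lemma isg_sq [simp]: "isg i K * isg i K = 1"
  by (simp add: isg_def flip: power_add power2_eq_square power_mult)

lemma isg_sq' [simp]: "isg i K * (isg i K * x) = x"
  by (simp flip: mult.assoc)

lemma isg_insert: "finite K \<Longrightarrow> m \<notin> K \<Longrightarrow> isg i (insert m K) = (if m < i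
    then - isg i K else isg i K)"
proof -
  assume a: "finite K" "m \<notin> K"
  have "{j \<in> insert m K. j < i} = (if m < i then insert m {j\<in>K. j < i} else {j\<in>K. j < i})" by auto
  then show ?thesis using a by (simp add: isg_def)
qed

lemma isg_remove: "finite K \<Longrightarrow> m \<in> K \<Longrightarrow> isg i (K - {m}) = (if m < i then -
    isg i K else isg i K)"
  using isg_insert[of "K - {m}" m i] by (auto simp: insert_absorb)

lemma supported_lin: "supported \<alpha> \<Longrightarrow> supported \<beta> \<Longrightarrow> supported
    (\<lambda>K. a * \<alpha> K + b * \<beta> K)" by (simp add: supported_def)
lemma supported_sum: "(\<And>i. i \<in> S \<Longrightarrow> supported (\<alpha> i)) \<Longrightarrow> supported
    (\<lambda>K. \<Sum>i\<in>S. \<alpha> i K)" by (simp add: supported_def)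
lemma supported_scale: "supported \<alpha> \<Longrightarrow> supported (\<lambda>K. a * \<alpha> K)" by (simp
    add: supported_def)
lemma supported_emon: "I \<subseteq> U7 \<Longrightarrow> supported (emon I)" by (auto simp: supported_def emon_def)
lemma supported_lwedge: "supported (lwedge i \<alpha>)" by (auto simp: supported_def lwedge_def)
lemma supported_contract: "supported (contract i \<alpha>)" by (auto simp: supported_def contract_def)
lemma supported_wedge: "supported (wedge \<alpha> \<beta>)" by (auto simp: supported_def wedge_def)
lemma supported_star0: "supported (star0 \<alpha>)" by (auto simp: supported_def star0_def)

lemma lwedge_lin: "lwedge i (\<lambda>K. a * \<alpha> K + b * \<beta> K) = (\<lambda>K. a * lwedge i \<alpha> K
    + b * lwedge i \<beta> K)"
  by (auto simp: lwedge_def algebra_simps)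
lemma lwedge_scale: "lwedge i (\<lambda>K. a * \<alpha> K) = (\<lambda>K. a * lwedge i \<alpha> K)"
  by (auto simp: lwedge_def algebra_simps)
lemma lwedge_sum: "lwedge i (\<lambda>K. \<Sum>j\<in>S. \<alpha> j K) = (\<lambda>K. \<Sum>j\<in>S. lwedge i
    (\<alpha> j) K)"
proof
  fix K
  show "lwedge i (\<lambda>K. \<Sum>j\<in>S. \<alpha> j K) K = (\<Sum>j\<in>S. lwedge i (\<alpha> j) K)"
  proof (cases "K \<subseteq> U7 \<and> i \<in> K")
    case True
    then show ?thesis by (simp add: lwedge_def sum_distrib_left)
  next
    case False
    then have "lwedge i \<beta> K = 0" for \<beta> by (auto simp: lwedge_def)
    then show ?thesis by simp
  qed
qed
lemma contract_lin: "contract i (\<lambda>K. a * \<alpha> K + b * \<beta> K) = (\<lambda>K. a * contract i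
    \<alpha> K + b * contract i \<beta> K)"
  by (auto simp: contract_def algebra_simps)
lemma contract_scale: "contract i (\<lambda>K. a * \<alpha> K) = (\<lambda>K. a * contract i \<alpha> K)"
  by (auto simp: contract_def algebra_simps)
lemma contract_sum: "contract i (\<lambda>K. \<Sum>j\<in>S. \<alpha> j K) = (\<lambda>K. \<Sum>j\<in>S.
    contract i (\<alpha> j) K)"
proof
  fix K
  show "contract i (\<lambda>K. \<Sum>j\<in>S. \<alpha> j K) K = (\<Sum>j\<in>S. contract i (\<alpha> j) K)"
  proof (cases "insert i K \<subseteq> U7 \<and> i \<notin> K")
    case True
    then show ?thesis by (simp add: contract_def sum_distrib_left)
  next
    case False
    then have "contract i \<beta> K = 0" for \<beta> by (auto simp: contract_def)
    then show ?thesis by simp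
  qed
qed
lemma star0_scale: "star0 (\<lambda>K. a * \<alpha> K) = (\<lambda>K. a * star0 \<alpha> K)"
  by (auto simp: star0_def algebra_simps)
lemma wedge_lin_left: "wedge (\<lambda>K. a * \<alpha> K + b * \<beta> K) \<gamma> = (\<lambda>K. a * wedge
    \<alpha> \<gamma> K + b * wedge \<beta> \<gamma> K)"
  by (auto simp: wedge_def algebra_simps sum.distrib sum_distrib_left)
lemma wedge_lin_right: "wedge \<gamma> (\<lambda>K. a * \<alpha> K + b * \<beta> K) = (\<lambda>K. a * wedge
    \<gamma> \<alpha> K + b * wedge \<gamma> \<beta> K)"
  by (auto simp: wedge_def algebra_simps sum.distrib sum_distrib_left)
lemma wedge_scale_left: "wedge (\<lambda>K. a * \<alpha> K) \<gamma> = (\<lambda>K. a * wedge \<alpha> \<gamma> K)"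
  by (auto simp: wedge_def algebra_simps sum_distrib_left)
lemma wedge_scale_right: "wedge \<gamma> (\<lambda>K. a * \<alpha> K) = (\<lambda>K. a * wedge \<gamma> \<alpha> K)"
  by (auto simp: wedge_def algebra_simps sum_distrib_left)
lemma wedge_sum_left: "finite S \<Longrightarrow> wedge (\<lambda>K. \<Sum>j\<in>S. \<alpha> j K) \<gamma> =
    (\<lambda>K. \<Sum>j\<in>S. wedge (\<alpha> j) \<gamma> K)"
  by (auto simp: wedge_def sum_distrib_left sum_distrib_right intro!: ext sum.swap)
lemma wedge_sum_right: "finite S \<Longrightarrow> wedge \<gamma> (\<lambda>K. \<Sum>j\<in>S. \<alpha> j K) =
    (\<lambda>K. \<Sum>j\<in>S. wedge \<gamma> (\<alpha> j) K)"
  by (auto simp: wedge_def sum_distrib_left sum_distrib_right intro!: ext sum.swap)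

lemma supported_expansion: "supported \<alpha> \<Longrightarrow> \<alpha> = (\<lambda>K. \<Sum>I\<in>Pow U7.
    \<alpha> I * emon I K)"
proof
  fix K assume "supported \<alpha>"
  have "(\<Sum>I\<in>Pow U7. \<alpha> I * emon I K) = (\<Sum>I\<in>Pow U7. if K = I then \<alpha> K else 0)"
    by (rule sum.cong) (auto simp: emon_def)
  also have "\<dots> = \<alpha> K" using \<open>supported \<alpha>\<close> by (auto simp: supported_def sum.delta)
  finally show "\<alpha> K = (\<Sum>I\<in>Pow U7. \<alpha> I * emon I K)" by simp
qed

lemma lwedge_emon: "i \<in> U7 \<Longrightarrow> I \<subseteq> U7 \<Longrightarrow> i \<notin> I
    \<Longrightarrow> lwedge i (emon I) = (\<lambda>K. isg i I * emon (insert i I) K)"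
proof
  fix K assume a: "i \<in> U7" "I \<subseteq> U7" "i \<notin> I"
  show "lwedge i (emon I) K = isg i I * emon (insert i I) K"
    using a isg_insert[of I i i] fin7[of I] by (auto simp: lwedge_def emon_def insert_absorb)
qed

text \<open>The unit generates the exterior algebra under left multiplications and linear
  combinations, because each \<open>emon I\<close> is, up to sign, an iterated product of basis
  covectors. Most identities for \<open>expand\<close> are proved with this rule.\<close>

lemma form_induct [consumes 1, case_names unit lwedge lin]:
  assumes "supported \<alpha>" and u: "R (emon {})"
    and l: "\<And>i \<beta>. i \<in> U7 \<Longrightarrow> supported \<beta> \<Longrightarrow> R \<beta>
        \<Longrightarrow> R (lwedge i \<beta>)"
    and n: "\<And>a b \<beta> \<gamma>. R \<beta> \<Longrightarrow> R \<gamma> \<Longrightarrow> R (\<lambda>K.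
        a * \<beta> K + b * \<gamma> K)"
  shows "R \<alpha>"
proof -
  have s: "R (\<lambda>K. c * \<beta> K)" if "R \<beta>" for c \<beta> using n[OF that that, of c 0] by simp
  have m: "R (emon I)" if "I \<subseteq> U7" for I
    using fin7[OF that] that
  proof (induction I)
    case (insert i I)
    have "R (\<lambda>K. isg i I * lwedge i (emon I) K)" using insert by (intro s l supported_emon) auto
    moreover have "(\<lambda>K. isg i I * lwedge i (emon I) K) = emon (insert i I)"
      using insert by (simp add: lwedge_emon)
    ultimately show ?case by simp
  qed (use u in simp)
  have "R (\<lambda>K. \<Sum>I\<in>S. \<alpha> I * emon I K)" if "S \<subseteq> Pow U7" for S
    using finite_subset[OF that finite_Pow_iff[THEN iffD2, OF finite_U7]] that
  proof (induction S)
    case empty show ?case using s[OF u, of 0] by simp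
  next
    case (insert I S)
    have "R (\<lambda>K. \<alpha> I * emon I K + 1 * (\<Sum>I\<in>S. \<alpha> I * emon I K))"
      using insert by (intro n m) auto
    then show ?case using insert by simp
  qed
  from this[of "Pow U7"] show ?thesis using supported_expansion[OF assms(1)] by simp
qed

text \<open>The anticommutation relation of creation and annihilation operators. For distinct
  indices exactly one of \<open>m < i\<close> and \<open>i < m\<close> holds, so exactly one of the
  two operators changes the sign seen by the other.\<close>

lemma contract_lwedge:
  assumes "i \<in> U7" "m \<in> U7" "supported \<beta>"
  shows "contract i (lwedge m \<beta>) = (\<lambda>K. (if i = m then 1 else 0) * \<beta> K - lwedge m (contract
      i \<beta>) K)"
proof
  fix K
  show "contract i (lwedge m \<beta>) K = (if i = m then 1 else 0) * \<beta> K - lwedge m (contract i \<beta>) K"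
  proof (cases "K \<subseteq> U7")
    case False
    then show ?thesis using assms by (auto simp: contract_def lwedge_def supported_def)
  next
    case True
    note f = fin7[OF True]
    show ?thesis
    proof (cases "i = m")
      case True
      then show ?thesis using \<open>K \<subseteq> U7\<close> f assms isg_insert[of K i i] isg_remove[of K i i]
        by (auto simp: contract_def lwedge_def insert_absorb)
    next
      case False
      have "insert i (K - {m}) = insert i K - {m}" using False by auto
      then show ?thesis using False \<open>K \<subseteq> U7\<close> f assms isg_insert[of K i m] isg_remove[of K m i]
        by (auto simp: contract_def lwedge_def)
    qed
  qed
qed

lemma lwedge_lwedge: "lwedge i (lwedge m \<beta>) = (\<lambda>K. - lwedge m (lwedge i \<beta>) K)"
proof
  fix K
  have e: "K - {i} - {m} = K - {m} - {i}" by auto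
  show "lwedge i (lwedge m \<beta>) K = - lwedge m (lwedge i \<beta>) K"
  proof (cases "K \<subseteq> U7 \<and> i \<in> K \<and> m \<in> K \<and> i \<noteq> m")
    case True
    then show ?thesis using fin7[of K] isg_remove[of K i m] isg_remove[of K m i] e
      by (auto simp: lwedge_def)
  qed (auto simp: lwedge_def)
qed

lemma wsign_insert: "finite I \<Longrightarrow> finite J \<Longrightarrow> i \<notin> I \<Longrightarrow> wsign
    (insert i I) J = isg i J * wsign I J"
proof -
  assume a: "finite I" "finite J" "i \<notin> I"
  have e: "{(k, j). k \<in> insert i I \<and> j \<in> J \<and> j < k} = {i} \<times> {j\<in>J. j < i} \<union>
      {(k, j). k \<in> I \<and> j \<in> J \<and> j < k}"
    by auto
  have "finite {(k, j). k \<in> I \<and> j \<in> J \<and> j < k}"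
    by (rule finite_subset[of _ "I \<times> J"]) (use a in auto)
  then have "card {(k, j). k \<in> insert i I \<and> j \<in> J \<and> j < k} = card {j\<in>J. j < i} + card
      {(k, j). k \<in> I \<and> j \<in> J \<and> j < k}"
    unfolding e using a by (subst card_Un_disjoint) (auto simp: card_cartesian_product)
  then show ?thesis by (simp add: wsign_def isg_def power_add)
qed

lemma wsign_empty [simp]: "wsign {} J = 1" by (simp add: wsign_def)

lemma isg_Un: "finite I \<Longrightarrow> finite J \<Longrightarrow> I \<inter> J = {} \<Longrightarrow> isg i
    (I \<union> J) = isg i I * isg i J"
proof -
  assume "finite I" "finite J" "I \<inter> J = {}"
  moreover have "{j \<in> I \<union> J. j < i} = {j\<in>I. j < i} \<union> {j\<in>J. j < i}" by auto
  moreover have "{j\<in>I. j < i} \<inter> {j\<in>J. j < i} = {}" using \<open>I \<inter> J = {}\<close> by auto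
  ultimately show ?thesis by (simp add: isg_def card_Un_disjoint power_add)
qed

text \<open>The instance of associativity with a basis covector on the left. It replaces the general
  law, since \<open>form_induct\<close> builds every form from such multiplications.\<close>

lemma wedge_lwedge: "i \<in> U7 \<Longrightarrow> wedge (lwedge i \<alpha>) \<beta> = lwedge i (wedge \<alpha>
    \<beta>)"
proof
  fix K assume i: "i \<in> U7"
  show "wedge (lwedge i \<alpha>) \<beta> K = lwedge i (wedge \<alpha> \<beta>) K"
  proof (cases "K \<subseteq> U7 \<and> i \<in> K")
    case False
    then show ?thesis by (auto simp: wedge_def lwedge_def intro!: sum.neutral)
  next
    case True
    then have K: "K \<subseteq> U7" "i \<in> K" by auto
    note f = fin7[OF K(1)]
    have "wedge (lwedge i \<alpha>) \<beta> K = (\<Sum>I\<in>Pow K. wsign I (K - I) * lwedge i \<alpha> I *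
        \<beta> (K - I))"
      using K by (simp add: wedge_def)
    also have "\<dots> = (\<Sum>I\<in>insert i ` Pow (K - {i}). wsign I (K - I) * lwedge i \<alpha> I * \<beta>
        (K - I))"
    proof (rule sum.mono_neutral_right)
      show "\<forall>I\<in>Pow K - insert i ` Pow (K - {i}). wsign I (K - I) * lwedge i \<alpha> I * \<beta> (K
          - I) = 0"
      proof
        fix I assume "I \<in> Pow K - insert i ` Pow (K - {i})"
        then have "i \<notin> I" using insert_Diff[of i I] by (metis Diff_iff Diff_mono Pow_iff equalityE image_eqI)
        then show "wsign I (K - I) * lwedge i \<alpha> I * \<beta> (K - I) = 0" by (simp add: lwedge_def)
      qed
    qed (use f K in auto)
    also have "\<dots> = (\<Sum>I\<in>Pow (K - {i}). wsign (insert i I) (K - insert i I) * lwedge i \<alpha>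
        (insert i I) * \<beta> (K - insert i I))"
      by (subst sum.reindex) (auto simp: inj_on_def o_def dest: insert_ident)
    also have "\<dots> = (\<Sum>I\<in>Pow (K - {i}). isg i K * (wsign I (K - {i} - I) * \<alpha> I * \<beta> (K
        - {i} - I)))"
    proof (rule sum.cong)
      fix I assume I: "I \<in> Pow (K - {i})"
      then have fI: "finite I" "i \<notin> I" "insert i I \<subseteq> U7" "insert i I - {i} = I" "K - {i} - I =
          K - insert i I"
        using f K finite_subset[of I K] by auto
      have "K = insert i (I \<union> (K - insert i I))" using I K by auto
      then have "isg i K = isg i (insert i (I \<union> (K - insert i I)))" by simp
      also have "\<dots> = isg i I * isg i (K - insert i I)"
        using f fI by (subst isg_insert) (auto intro: isg_Un)
      finally have s: "isg i K = isg i I * isg i (K - insert i I)" .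
      show "wsign (insert i I) (K - insert i I) * lwedge i \<alpha> (insert i I) * \<beta> (K - insert i I) =
         isg i K * (wsign I (K - {i} - I) * \<alpha> I * \<beta> (K - {i} - I))"
        using f fI by (simp add: s lwedge_def wsign_insert isg_insert)
    qed auto
    also have "\<dots> = lwedge i (wedge \<alpha> \<beta>) K"
      using K by (auto simp: lwedge_def wedge_def sum_distrib_left)
    finally show ?thesis .
  qed
qed

lemma wedge_unit: "supported \<beta> \<Longrightarrow> wedge (emon {}) \<beta> = \<beta>"
proof
  fix K assume "supported \<beta>"
  have "(\<Sum>I\<in>Pow K. wsign I (K - I) * emon {} I * \<beta> (K - I)) = (\<Sum>I\<in>Pow K. if I = {} then
      \<beta> K else 0)"
    by (rule sum.cong) (auto simp: emon_def)
  then show "wedge (emon {}) \<beta> K = \<beta> K" using \<open>supported \<beta>\<close> fin7[of K]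
    by (auto simp: wedge_def supported_def)
qed

lemma oneform_sum: "oneform v = (\<lambda>K. \<Sum>j\<in>U7. v j * lwedge j (emon {}) K)"
proof
  fix K
  show "oneform v K = (\<Sum>j\<in>U7. v j * lwedge j (emon {}) K)"
  proof (cases "\<exists>m\<in>U7. K = {m}")
    case True
    then obtain m where m: "m \<in> U7" "K = {m}" by auto
    have "(\<Sum>j\<in>U7. v j * lwedge j (emon {}) K) = (\<Sum>j\<in>U7. if j = m then v m else 0)"
      by (rule sum.cong) (use m in \<open>auto simp: lwedge_emon isg_def\<close>, auto simp: emon_def)
    then show ?thesis using m by (auto simp: oneform_def)
  next
    case False
    then show ?thesis by (auto simp: oneform_def lwedge_emon, auto simp: emon_def)
  qed
qed

lemma wedge_oneform: "supported \<alpha> \<Longrightarrow> wedge (oneform v) \<alpha> = (\<lambda>K.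
    \<Sum>j\<in>U7. v j * lwedge j \<alpha> K)"
  by (simp add: oneform_sum wedge_sum_left wedge_scale_left wedge_lwedge wedge_unit cong: sum.cong)

lemma wedge_oneform_anticomm:
  assumes "supported \<alpha>"
  shows "wedge (oneform v) (wedge (oneform w) \<alpha>) = (\<lambda>K. - wedge (oneform w) (wedge (oneform v)
      \<alpha>) K)"
proof
  fix K
  have *: "wedge (oneform v) (wedge (oneform w) \<alpha>) K = (\<Sum>j\<in>U7. \<Sum>k\<in>U7. v j * w k *
      lwedge j (lwedge k \<alpha>) K)" for v w
    using assms by (simp add: wedge_oneform supported_wedge supported_sum supported_scale supported_lwedge
        lwedge_sum lwedge_scale sum_distrib_left mult.assoc)
  have "(\<Sum>j\<in>U7. \<Sum>k\<in>U7. v j * w k * lwedge j (lwedge k \<alpha>) K) = (\<Sum>k\<in>U7.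
      \<Sum>j\<in>U7. v j * w k * lwedge j (lwedge k \<alpha>) K)"
    by (rule sum.swap)
  also have "\<dots> = (\<Sum>k\<in>U7. \<Sum>j\<in>U7. - (w k * v j * lwedge k (lwedge j \<alpha>) K))"
    by (subst lwedge_lwedge) (simp add: mult_ac)
  finally show "wedge (oneform v) (wedge (oneform w) \<alpha>) K = - wedge (oneform w) (wedge (oneform v) \<alpha>) K"
    by (simp add: * sum_negf)
qed

lemma contract_wedge_oneform:
  assumes "supported \<beta>" "i \<in> U7"
  shows "contract i (wedge (oneform w) \<beta>) = (\<lambda>K. w i * \<beta> K - wedge (oneform w) (contract i
      \<beta>) K)"
proof
  fix K
  have "contract i (wedge (oneform w) \<beta>) K = (\<Sum>j\<in>U7. w j * ((if i = j then 1 else 0) * \<beta> K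
      - lwedge j (contract i \<beta>) K))"
    using assms by (simp add: wedge_oneform contract_sum contract_scale contract_lwedge cong: sum.cong)
  also have "\<dots> = (\<Sum>j\<in>U7. (if i = j then w i * \<beta> K else 0) - w j * lwedge j (contract i
      \<beta>) K)"
    by (rule sum.cong) (auto simp: algebra_simps)
  also have "\<dots> = w i * \<beta> K - wedge (oneform w) (contract i \<beta>) K"
    using assms by (simp add: wedge_oneform supported_contract sum_subtractf)
  finally show "contract i (wedge (oneform w) \<beta>) K = w i * \<beta> K - wedge (oneform w) (contract i
      \<beta>) K" .
qed

subsection \<open>Change of basis\<close>

lemma supported_xmon: "finite I \<Longrightarrow> supported (xmon P I)"
proof -
  have "supported (foldr wedge xs (emon {}))" for xs
    by (induction xs) (auto intro: supported_wedge supported_emon)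
  then show "supported (xmon P I)" by (simp add: xmon_def)
qed

lemma xmon_empty [simp]: "xmon P {} = emon {}"
  by (simp add: xmon_def)

lemma xmon_insert_min:
  assumes "finite A" "\<forall>a\<in>A. b < a"
  shows "xmon P (insert b A) = wedge (oneform (P b)) (xmon P A)"
proof -
  have "Min (insert b A) = b" using assms by (intro Min_eqI) (auto intro: less_imp_le)
  moreover have "insert b A - {b} = A" using assms by auto
  ultimately have "sorted_list_of_set (insert b A) = b # sorted_list_of_set A"
    using sorted_list_of_set_nonempty[of "insert b A"] assms by simp
  then show ?thesis by (simp add: xmon_def)
qed

lemma wedge_oneform_self: "supported \<alpha> \<Longrightarrow> wedge (oneform v) (wedge (oneform v) \<alpha>)
    = (\<lambda>K. 0)"
proof
  fix K assume "supported \<alpha>"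
  from fun_cong[OF wedge_oneform_anticomm[OF this, of v v], of K]
  show "wedge (oneform v) (wedge (oneform v) \<alpha>) K = 0" by simp
qed

text \<open>Monomials in the coframe x obey the sign rule of those in e. As \<open>xmon\<close>
  multiplies in increasing order, the induction adds a new smallest index; if that index lies below
  \<open>i\<close>, anticommutation moves the covector of \<open>i\<close> past it.\<close>

lemma wedge_oneform_xmon:
  assumes "finite I"
  shows "wedge (oneform (P i)) (xmon P I) = (\<lambda>K. if i \<in> I then 0 else isg i I * xmon P (insert i I) K)"
  using assms
proof (induction I rule: finite_linorder_min_induct)
  case empty
  show ?case using xmon_insert_min[of "{}" i P] by (simp add: isg_def)
next
  case (insert b A)
  have bA: "b \<notin> A" using insert by auto
  have o: "supported (xmon P A)" using insert by (intro supported_xmon)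
  consider "i < b" | "i = b" | "b < i" by linarith
  then show ?case
  proof cases
    case 1
    then have "i \<notin> insert b A" "\<forall>a\<in>insert b A. i < a" using insert by force+
    moreover have "{j \<in> insert b A. j < i} = {}" using calculation by force
    then have "isg i (insert b A) = 1" by (simp only: isg_def) simp
    ultimately show ?thesis using insert xmon_insert_min[of "insert b A" i P] by simp
  next
    case 2
    then show ?thesis using insert.hyps o by (simp add: xmon_insert_min wedge_oneform_self)
  next
    case 3
    have "wedge (oneform (P i)) (xmon P (insert b A)) = (\<lambda>K. - wedge (oneform (P b)) (wedge (oneform (P
        i)) (xmon P A)) K)"
      using insert o wedge_oneform_anticomm[OF o] by (simp add: xmon_insert_min)
    also have "wedge (oneform (P i)) (xmon P A) = (\<lambda>K. (if i \<in> A then 0 else isg i A) * xmon P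
        (insert i A) K)"
      using insert.IH by auto
    also have "(\<lambda>K. - wedge (oneform (P b)) \<dots> K) = (\<lambda>K. if i \<in> A then 0 else - isg i
        A * wedge (oneform (P b)) (xmon P (insert i A)) K)"
      by (auto simp: wedge_scale_right)
    also have "wedge (oneform (P b)) (xmon P (insert i A)) = xmon P (insert b (insert i A))"
      using insert 3 by (subst xmon_insert_min) auto
    finally show ?thesis using 3 insert bA by (auto simp: isg_insert insert_commute)
  qed
qed

lemma sum_Pow_insert:
  assumes "i \<in> U7"
  shows "(\<Sum>I\<in>Pow U7. if i \<in> I then f I else 0) = (\<Sum>I\<in>Pow U7. if i \<in> I then 0 else f
      (insert i I) :: real)"
proof -
  have "(\<Sum>I\<in>Pow U7. if i \<in> I then f I else 0) = (\<Sum>I\<in>{I\<in>Pow U7. i \<in> I}. f I)"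
    by (rule sum.inter_filter[symmetric]) simp
  also have "\<dots> = (\<Sum>I\<in>{I\<in>Pow U7. i \<notin> I}. f (insert i I))"
    by (rule sum.reindex_bij_witness[of _ "insert i" "\<lambda>I. I - {i}"]) (use assms in \<open>auto simp:
        insert_absorb\<close>)
  also have "\<dots> = (\<Sum>I\<in>Pow U7. if i \<notin> I then f (insert i I) else 0)"
    by (rule sum.inter_filter) simp
  also have "\<dots> = (\<Sum>I\<in>Pow U7. if i \<in> I then 0 else f (insert i I))"
    by (rule sum.cong) auto
  finally show ?thesis .
qed

lemma expand_lin: "expand P (\<lambda>K. a * \<alpha> K + b * \<beta> K) = (\<lambda>K. a * expand P \<alpha> K
    + b * expand P \<beta> K)"
  by (auto simp: expand_def algebra_simps sum.distrib sum_distrib_left)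
lemma expand_scale: "expand P (\<lambda>K. a * \<alpha> K) = (\<lambda>K. a * expand P \<alpha> K)"
  by (auto simp: expand_def algebra_simps sum_distrib_left)
lemma expand_sum: "finite S \<Longrightarrow> expand P (\<lambda>K. \<Sum>j\<in>S. \<alpha> j K) = (\<lambda>K.
    \<Sum>j\<in>S. expand P (\<alpha> j) K)"
  by (auto simp: expand_def sum_distrib_left sum_distrib_right intro!: ext sum.swap)
lemma expand_emon: "I \<subseteq> U7 \<Longrightarrow> expand P (emon I) = xmon P I"
proof
  fix K assume "I \<subseteq> U7"
  have "expand P (emon I) K = (\<Sum>J\<in>Pow U7. if J = I then xmon P I K else 0)"
    unfolding expand_def by (rule sum.cong) (auto simp: emon_def)
  then show "expand P (emon I) K = xmon P I K" using \<open>I \<subseteq> U7\<close> by simp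
qed
lemma supported_expand: "supported (expand P \<alpha>)"
  unfolding expand_def by (intro supported_sum supported_scale supported_xmon) (auto intro: fin7)

text \<open>With linearity and the value at the unit, this identifies \<open>expand P\<close> as the
  algebra homomorphism sending e^i to x^i. The inductions below use \<open>expand\<close> only
  through these three facts.\<close>

lemma expand_lwedge:
  assumes "i \<in> U7"
  shows "expand P (lwedge i \<alpha>) = wedge (oneform (P i)) (expand P \<alpha>)"
proof
  fix K
  have "expand P (lwedge i \<alpha>) K = (\<Sum>I\<in>Pow U7. if i \<in> I then isg i I * \<alpha> (I - {i}) *
      xmon P I K else 0)"
    unfolding expand_def by (rule sum.cong) (auto simp: lwedge_def)
  also have "\<dots> = (\<Sum>I\<in>Pow U7. if i \<in> I then 0 else isg i (insert i I) * \<alpha> (insert i I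
      - {i}) * xmon P (insert i I) K)"
    by (rule sum_Pow_insert[OF assms])
  also have "\<dots> = (\<Sum>I\<in>Pow U7. \<alpha> I * wedge (oneform (P i)) (xmon P I) K)"
    by (rule sum.cong) (auto simp: wedge_oneform_xmon fin7 isg_insert)
  also have "\<dots> = wedge (oneform (P i)) (expand P \<alpha>) K"
    unfolding expand_def by (simp add: wedge_sum_right wedge_scale_right)
  finally show "expand P (lwedge i \<alpha>) K = wedge (oneform (P i)) (expand P \<alpha>) K" .
qed

definition mat_mul :: "(nat \<Rightarrow> nat \<Rightarrow> real) \<Rightarrow> (nat \<Rightarrow> nat
    \<Rightarrow> real) \<Rightarrow> nat \<Rightarrow> nat \<Rightarrow> real" where
  "mat_mul Q P = (\<lambda>i j. \<Sum>k\<in>U7. Q i k * P k j)"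

definition mat_transp :: "(nat \<Rightarrow> nat \<Rightarrow> real) \<Rightarrow> nat \<Rightarrow> nat
    \<Rightarrow> real" where
  "mat_transp P = (\<lambda>i j. P j i)"

lemma expand_unit [simp]: "expand P (emon {}) = emon {}"
  by (simp add: expand_emon)

text \<open>The factors appear in reversed order because covectors are the rows: e^i becomes row
  \<open>i\<close> of \<open>Q\<close>, and each basis covector in that row then becomes a row of
  \<open>P\<close>.\<close>

lemma expand_expand:
  assumes "supported \<alpha>"
  shows "expand P (expand Q \<alpha>) = expand (mat_mul Q P) \<alpha>"
  using assms
proof (induction rule: form_induct)
  case (lwedge i \<beta>)
  have "expand P (expand Q (lwedge i \<beta>)) = expand P (\<lambda>K. \<Sum>k\<in>U7. Q i k * lwedge k (expand
      Q \<beta>) K)"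
    using lwedge by (simp add: expand_lwedge wedge_oneform supported_expand)
  also have "\<dots> = (\<lambda>K. \<Sum>k\<in>U7. Q i k * (\<Sum>j\<in>U7. P k j * lwedge j (expand P (expand
      Q \<beta>)) K))"
    by (simp add: expand_sum expand_scale expand_lwedge wedge_oneform supported_expand cong: sum.cong)
  also have "\<dots> = (\<lambda>K. \<Sum>j\<in>U7. mat_mul Q P i j * lwedge j (expand P (expand Q \<beta>)) K)"
    by (rule ext) (simp add: mat_mul_def sum_distrib_left sum_distrib_right mult.assoc, rule sum.swap)
  also have "\<dots> = expand (mat_mul Q P) (lwedge i \<beta>)"
    using lwedge by (simp add: expand_lwedge wedge_oneform supported_expand)
  finally show ?case .
qed (simp_all add: expand_lin)

lemma expand_wedge:
  assumes "supported \<alpha>"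
  shows "supported \<beta> \<Longrightarrow> expand P (wedge \<alpha> \<beta>) = wedge (expand P \<alpha>)
      (expand P \<beta>)"
  using assms
proof (induction rule: form_induct)
  case unit
  then show ?case by (simp add: wedge_unit supported_expand)
next
  case (lwedge i \<gamma>)
  then show ?case
    by (simp add: wedge_lwedge expand_lwedge wedge_oneform supported_expand supported_wedge wedge_sum_left
        wedge_scale_left cong: sum.cong)
qed (simp add: expand_lin wedge_lin_left)

lemma contract_unit: "contract i (emon {}) = (\<lambda>K. 0)"
  by (auto simp: contract_def emon_def)

lemma lwedge_zero: "lwedge i (\<lambda>K. 0) = (\<lambda>K. 0)" by (auto simp: lwedge_def)
lemma expand_zero: "expand P (\<lambda>K. 0) = (\<lambda>K. 0)" by (auto simp: expand_def)

lemma expand_diff: "expand P (\<lambda>K. \<alpha> K - \<beta> K) = (\<lambda>K. expand P \<alpha> K - expand P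
    \<beta> K)"
  using expand_lin[of P 1 \<alpha> "-1" \<beta>] by simp

text \<open>The vector e_i has x^k-component \<open>P k i\<close>, so contracting with it is the
  corresponding combination of contractions in the coframe x.\<close>

lemma contract_expand:
  assumes "supported \<alpha>" "i \<in> U7"
  shows "contract i (expand P \<alpha>) = (\<lambda>K. \<Sum>k\<in>U7. P k i * expand P (contract k \<alpha>) K)"
  using assms(1)
proof (induction rule: form_induct)
  case unit
  then show ?case by (simp add: contract_unit expand_zero)
next
  case (lwedge m \<beta>)
  have "contract i (expand P (lwedge m \<beta>)) = (\<lambda>K. P m i * expand P \<beta> K - (\<Sum>k\<in>U7. P
      k i * wedge (oneform (P m)) (expand P (contract k \<beta>)) K))"
    using lwedge assms(2) by (simp add: expand_lwedge contract_wedge_oneform supported_expand wedge_sum_right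
        wedge_scale_right)
  moreover have "(\<Sum>k\<in>U7. P k i * expand P (contract k (lwedge m \<beta>)) K) =
     P m i * expand P \<beta> K - (\<Sum>k\<in>U7. P k i * wedge (oneform (P m)) (expand P (contract k
         \<beta>)) K)" for K
  proof -
    have "(\<Sum>k\<in>U7. P k i * expand P (contract k (lwedge m \<beta>)) K) =
      (\<Sum>k\<in>U7. (if k = m then P m i * expand P \<beta> K else 0) - P k i * wedge (oneform (P m))
          (expand P (contract k \<beta>)) K)"
      using lwedge by (intro sum.cong) (auto simp: contract_lwedge expand_diff expand_scale expand_lwedge
          algebra_simps expand_zero)
    then show ?thesis using lwedge by (simp add: sum_subtractf)
  qed
  ultimately show ?case by simp
next
  case (lin a b \<beta> \<gamma>)
  show ?case
    by (rule ext) (simp add: expand_lin contract_lin lin sum.distrib sum_distrib_left algebra_simps)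
qed

section \<open>Inner product, adjoints and the determinant\<close>

definition form_inner :: "form \<Rightarrow> form \<Rightarrow> real" where
  "form_inner \<alpha> \<beta> = (\<Sum>I\<in>Pow U7. \<alpha> I * \<beta> I)"

lemma form_inner_lin_left: "form_inner (\<lambda>K. a * \<alpha> K + b * \<beta> K) \<gamma> = a * form_inner
    \<alpha> \<gamma> + b * form_inner \<beta> \<gamma>"
  by (auto simp: form_inner_def algebra_simps sum.distrib sum_distrib_left)
lemma form_inner_sum_left: "finite S \<Longrightarrow> form_inner (\<lambda>K. \<Sum>j\<in>S. \<alpha> j K)
    \<gamma> = (\<Sum>j\<in>S. form_inner (\<alpha> j) \<gamma>)"
  by (auto simp: form_inner_def sum_distrib_left sum_distrib_right intro!: sum.swap)
lemma form_inner_scale_left: "form_inner (\<lambda>K. a * \<alpha> K) \<gamma> = a * form_inner \<alpha> \<gamma>"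
  by (auto simp: form_inner_def algebra_simps sum_distrib_left)
lemma form_inner_commute: "form_inner \<alpha> \<beta> = form_inner \<beta> \<alpha>"
  by (simp add: form_inner_def mult.commute)
lemma form_inner_sum_right: "finite S \<Longrightarrow> form_inner \<gamma> (\<lambda>K. \<Sum>j\<in>S.
    \<alpha> j K) = (\<Sum>j\<in>S. form_inner \<gamma> (\<alpha> j))"
  by (simp add: form_inner_commute[of \<gamma>] form_inner_sum_left)
lemma form_inner_scale_right: "form_inner \<gamma> (\<lambda>K. a * \<alpha> K) = a * form_inner \<gamma> \<alpha>"
  by (simp add: form_inner_commute[of \<gamma>] form_inner_scale_left)
lemma form_inner_emon: "I \<subseteq> U7 \<Longrightarrow> form_inner (emon I) \<beta> = \<beta> I"
proof -
  assume "I \<subseteq> U7"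
  have "form_inner (emon I) \<beta> = (\<Sum>J\<in>Pow U7. if J = I then \<beta> I else 0)"
    unfolding form_inner_def by (rule sum.cong) (auto simp: emon_def)
  then show ?thesis using \<open>I \<subseteq> U7\<close> by simp
qed

lemma form_inner_lwedge: "i \<in> U7 \<Longrightarrow> form_inner (lwedge i \<alpha>) \<beta> = form_inner
    \<alpha> (contract i \<beta>)"
proof -
  assume i: "i \<in> U7"
  have "form_inner (lwedge i \<alpha>) \<beta> = (\<Sum>I\<in>Pow U7. if i \<in> I then isg i I * \<alpha> (I -
      {i}) * \<beta> I else 0)"
    unfolding form_inner_def by (rule sum.cong) (auto simp: lwedge_def)
  also have "\<dots> = (\<Sum>I\<in>Pow U7. if i \<in> I then 0 else isg i (insert i I) * \<alpha> (insert i I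
      - {i}) * \<beta> (insert i I))"
    by (rule sum_Pow_insert[OF i])
  also have "\<dots> = form_inner \<alpha> (contract i \<beta>)"
    unfolding form_inner_def using i by (intro sum.cong) (auto simp: contract_def isg_insert fin7)
  finally show ?thesis .
qed

text \<open>The determinant, as the factor by which the induced homomorphism scales the top degree.
  Multiplicativity is then functoriality of \<open>expand\<close>, and invariance under
  transposition is its adjoint formula in top degree.\<close>

definition fdet :: "(nat \<Rightarrow> nat \<Rightarrow> real) \<Rightarrow> real" where "fdet P = xmon P U7 U7"

lemma kform_wedge_oneform:
  assumes "kform k \<alpha>" shows "kform (Suc k) (wedge (oneform v) \<alpha>)"
proof -
  have o: "supported \<alpha>" using assms unfolding kform_def supported_def by blast
  have "I \<subseteq> U7 \<and> card I = Suc k" if "wedge (oneform v) \<alpha> I \<noteq> 0" for I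
  proof -
    from that o have "(\<Sum>j\<in>U7. v j * lwedge j \<alpha> I) \<noteq> 0" by (simp add: wedge_oneform)
    then obtain j where j: "lwedge j \<alpha> I \<noteq> 0"
      using sum.neutral[of U7 "\<lambda>j. v j * lwedge j \<alpha> I"] by fastforce
    then have "I \<subseteq> U7" "j \<in> I" "\<alpha> (I - {j}) \<noteq> 0" by (auto simp: lwedge_def split:
        if_splits)
    moreover have "card (I - {j}) = k" using assms calculation by (auto simp: kform_def)
    ultimately show ?thesis using fin7[of I] by (metis card_Suc_Diff1)
  qed
  then show ?thesis by (simp add: kform_def)
qed

lemma kform_xmon: "finite I \<Longrightarrow> kform (card I) (xmon P I)"
proof (induction I rule: finite_linorder_min_induct)
  case empty
  then show ?case by (auto simp: kform_def emon_def)
next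
  case (insert b A)
  then have "b \<notin> A" by auto
  then show ?case using insert by (simp add: xmon_insert_min kform_wedge_oneform)
qed

lemma card_U7 [simp]: "card U7 = 7" by (simp add: U7_def)

lemma expand_U7: "expand P \<alpha> U7 = fdet P * \<alpha> U7"
proof -
  have "xmon P I U7 = 0" if "I \<in> Pow U7" "I \<noteq> U7" for I
  proof -
    have "card I \<noteq> 7" using that by (metis Pow_iff card_U7 card_subset_eq finite_U7)
    then show ?thesis using kform_xmon[of I P] that fin7[of I] by (auto simp: kform_def)
  qed
  then have "expand P \<alpha> U7 = (\<Sum>I\<in>Pow U7. if I = U7 then \<alpha> U7 * fdet P else 0)"
    unfolding expand_def by (intro sum.cong) (auto simp: fdet_def)
  then show ?thesis by simp
qed

lemma kform_expand:
  assumes "kform k \<alpha>" shows "kform k (expand P \<alpha>)"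
proof -
  have "J \<subseteq> U7 \<and> card J = k" if "expand P \<alpha> J \<noteq> 0" for J
  proof -
    from that obtain I where I: "I \<in> Pow U7" "\<alpha> I * xmon P I J \<noteq> 0"
      unfolding expand_def using sum.neutral[of "Pow U7" "\<lambda>I. \<alpha> I * xmon P I J"] by fastforce
    then have "card I = k" using assms by (auto simp: kform_def)
    then show ?thesis using I kform_xmon[of I P] fin7[of I] by (auto simp: kform_def)
  qed
  then show ?thesis by (simp add: kform_def)
qed

text \<open>In coordinates: a minor of \<open>P\<close> is the minor of the transpose with rows and
  columns exchanged. Without minors it follows from \<open>contract\<close> being adjoint to
  \<open>lwedge\<close> together with the transformation rule
  \<open>contract_expand\<close>.\<close>

lemma form_inner_expand:
  assumes "supported \<alpha>" "supported \<beta>"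
  shows "form_inner (expand P \<alpha>) \<beta> = form_inner \<alpha> (expand (mat_transp P) \<beta>)"
proof -
  \<comment> \<open>Each induction step moves a contraction onto the second argument, so \<beta> has
    to vary.\<close>
  have "\<forall>\<beta>. supported \<beta> \<longrightarrow> form_inner (expand P \<alpha>) \<beta> =
      form_inner \<alpha> (expand (mat_transp P) \<beta>)"
    using assms(1)
  proof (induction rule: form_induct)
    case unit
    have "xmon (mat_transp P) I {} = 0" if "I \<noteq> {}" "I \<subseteq> U7" for I
      using kform_xmon[of I "mat_transp P"] that fin7[of I] by (auto simp: kform_def)
    then have "expand (mat_transp P) \<beta> {} = (\<Sum>I\<in>Pow U7. if I = {} then \<beta> {} else 0)" for \<beta>
      unfolding expand_def by (intro sum.cong) (auto simp: emon_def)
    then have "expand (mat_transp P) \<beta> {} = \<beta> {}" for \<beta> by simp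
    then show ?case by (simp add: form_inner_emon)
  next
    case (lwedge m \<gamma>)
    show ?case
    proof (intro allI impI)
      fix \<beta> assume b: "supported \<beta>"
      have "form_inner (expand P (lwedge m \<gamma>)) \<beta> = (\<Sum>j\<in>U7. P m j * form_inner \<gamma>
          (expand (mat_transp P) (contract j \<beta>)))"
        using lwedge by (simp add: expand_lwedge wedge_oneform supported_expand form_inner_sum_left
            form_inner_scale_left form_inner_lwedge supported_contract cong: sum.cong)
      also have "\<dots> = form_inner \<gamma> (contract m (expand (mat_transp P) \<beta>))"
        using lwedge b by (simp add: contract_expand form_inner_sum_right form_inner_scale_right mat_transp_def)
      finally show "form_inner (expand P (lwedge m \<gamma>)) \<beta> = form_inner (lwedge m \<gamma>) (expand
          (mat_transp P) \<beta>)"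
        using lwedge by (simp add: form_inner_lwedge)
    qed
  qed (simp add: expand_lin form_inner_lin_left)
  then show ?thesis using assms(2) by blast
qed

lemma fdet_mat_transp: "fdet (mat_transp P) = fdet P"
  using form_inner_expand[of "emon U7" "emon U7" P] form_inner_emon[of U7] form_inner_commute[of "expand P
      (emon U7)" "emon U7"]
  by (simp add: supported_emon expand_emon fdet_def)

lemma fdet_mat_mul: "fdet (mat_mul Q P) = fdet Q * fdet P"
  using expand_U7[of "mat_mul Q P" "emon U7"] expand_U7[of P "expand Q (emon U7)"] expand_U7[of Q "emon U7"]
    expand_expand[OF supported_emon[of U7], of P Q]
  by (simp add: emon_def)

subsection \<open>Hodge star and metric\<close>

lemma wsign_sym:
  assumes "finite I" "finite J" "I \<inter> J = {}"
  shows "wsign I J * wsign J I = (-1) ^ (card I * card J)"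
proof -
  let ?A = "{(i, j). i \<in> I \<and> j \<in> J \<and> j < i}" and ?B = "{(i, j). i \<in> I \<and> j \<in> J
      \<and> i < j}"
  have "card {(j, i). j \<in> J \<and> i \<in> I \<and> i < j} = card ?B"
    by (rule bij_betw_same_card[of prod.swap]) (auto simp: bij_betw_def inj_on_def image_iff)
  moreover have "?A \<union> ?B = I \<times> J" using assms by (auto simp: neq_iff)
  moreover have "card (?A \<union> ?B) = card ?A + card ?B"
    by (rule card_Un_disjoint) (use assms in \<open>auto intro: finite_subset[of _ "I \<times> J"]\<close>)
  ultimately have "card ?A + card {(j, i). j \<in> J \<and> i \<in> I \<and> i < j} = card I * card J"
    by (simp add: card_cartesian_product)
  then show ?thesis by (simp add: wsign_def flip: power_add)
qed

text \<open>In dimension seven k (7 - k) is even for every k; hence the star squares to plus one in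
  every degree.\<close>

lemma wsign_compl:
  assumes "K \<subseteq> U7" shows "wsign (U7 - K) K * wsign K (U7 - K) = 1"
proof -
  have c: "card (U7 - K) = 7 - card K" using assms fin7 by (simp add: card_Diff_subset)
  have "card K \<le> 7" using card_mono[OF finite_U7 assms] by simp
  then have "card K \<in> {0,1,2,3,4,5,6,7}" by auto
  then have "even (card (U7 - K) * card K)" unfolding c by auto
  then show ?thesis using wsign_sym[of "U7 - K" K] assms fin7[of K] by auto
qed

lemma wsign_sq [simp]: "wsign I J * wsign I J = 1"
  by (simp add: wsign_def flip: power_add power2_eq_square power_mult)

lemma wsign_compl': "K \<subseteq> U7 \<Longrightarrow> wsign (U7 - K) K = wsign K (U7 - K)"
  using wsign_compl[of K] wsign_sq[of K "U7 - K"] by (metis mult_right_cancel mult_zero_left zero_neq_one)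

lemma U7_compl: "K \<subseteq> U7 \<Longrightarrow> U7 - (U7 - K) = K" by auto

lemma star0_star0: "supported \<alpha> \<Longrightarrow> star0 (star0 \<alpha>) = \<alpha>"
proof
  fix K assume "supported \<alpha>"
  then show "star0 (star0 \<alpha>) K = \<alpha> K"
    using wsign_compl[of K] by (auto simp: star0_def supported_def U7_compl simp flip: mult.assoc)
qed

text \<open>Turns top-degree products into inner products. Combined with \<open>expand_U7\<close>
  and \<open>expand_wedge\<close> it shows how \<open>expand P\<close> interacts with the
  star.\<close>

lemma wedge_U7: "wedge \<alpha> \<beta> U7 = form_inner \<alpha> (star0 \<beta>)"
  unfolding wedge_def form_inner_def by (simp add: star0_def, rule sum.cong) (simp_all add: wsign_compl')

lemma form_inner_eqI:
  assumes "supported \<alpha>" "supported \<beta>" "\<And>\<gamma>. supported \<gamma> \<Longrightarrow>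
      form_inner \<gamma> \<alpha> = form_inner \<gamma> \<beta>"
  shows "\<alpha> = \<beta>"
proof
  fix K
  show "\<alpha> K = \<beta> K"
    using assms(1,2) assms(3)[OF supported_emon, of K] by (cases "K \<subseteq> U7") (simp_all add:
        form_inner_emon supported_def)
qed

text \<open>Cramer's rule: up to the factor \<open>fdet P\<close>, conjugating the transpose by the Hodge star inverts
  \<open>expand P\<close>, so no inverse matrix is needed.\<close>

lemma expand_mat_transp_star0_expand:
  assumes "supported \<alpha>"
  shows "expand (mat_transp P) (star0 (expand P \<alpha>)) = (\<lambda>K. fdet P * star0 \<alpha> K)"
proof (rule form_inner_eqI)
  fix \<gamma> assume g: "supported \<gamma>"
  have "form_inner \<gamma> (expand (mat_transp P) (star0 (expand P \<alpha>))) = form_inner (expand P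
      \<gamma>) (star0 (expand P \<alpha>))"
    using g by (simp add: form_inner_expand supported_star0)
  also have "\<dots> = expand P (wedge \<gamma> \<alpha>) U7"
    using g assms by (simp add: expand_wedge wedge_U7)
  also have "\<dots> = form_inner \<gamma> (\<lambda>K. fdet P * star0 \<alpha> K)"
    by (simp add: expand_U7 wedge_U7 form_inner_scale_right)
  finally show "form_inner \<gamma> (expand (mat_transp P) (star0 (expand P \<alpha>))) = form_inner \<gamma>
      (\<lambda>K. fdet P * star0 \<alpha> K)" .
qed (auto intro: supported_expand supported_scale supported_star0)

lemma mat_transp_mat_transp [simp]: "mat_transp (mat_transp P) = P" by (simp add: mat_transp_def)

text \<open>Cramer's rule for the transpose gives a right inverse up to the determinant, hence
  surjectivity; \<open>cofactor_expand\<close> gives the left inverse, hence injectivity.\<close>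

lemma expand_cofactor:
  assumes "supported \<alpha>"
  shows "expand P (star0 (expand (mat_transp P) (star0 \<alpha>))) = (\<lambda>K. fdet P * \<alpha> K)"
  using expand_mat_transp_star0_expand[of "star0 \<alpha>" "mat_transp P"] assms
  by (simp add: supported_star0 fdet_mat_transp star0_star0)

lemma cofactor_expand:
  assumes "supported \<alpha>"
  shows "star0 (expand (mat_transp P) (star0 (expand P \<alpha>))) = (\<lambda>K. fdet P * \<alpha> K)"
  using assms by (simp add: expand_mat_transp_star0_expand star0_scale star0_star0)

lemma expand_inj:
  assumes "supported \<alpha>" "supported \<beta>" "fdet P \<noteq> 0" "expand P \<alpha> = expand P \<beta>"
  shows "\<alpha> = \<beta>"
proof
  fix K
  have "fdet P * \<alpha> K = fdet P * \<beta> K"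
    using cofactor_expand[OF assms(1), of P] cofactor_expand[OF assms(2), of P] assms(4) by metis
  then show "\<alpha> K = \<beta> K" using assms(3) by simp
qed

text \<open>Injectivity leaves only one admissible coefficient function, so the choice operator in
  \<open>xcoords\<close> is harmless on a basis.\<close>

lemma xcoords_expand:
  assumes "supported \<alpha>" "fdet P \<noteq> 0"
  shows "xcoords P (expand P \<alpha>) = \<alpha>"
  unfolding xcoords_def
proof (rule some_equality)
  show "(\<forall>I. \<not> I \<subseteq> U7 \<longrightarrow> \<alpha> I = 0) \<and> expand P \<alpha> =
      expand P \<alpha>" using assms by (simp add: supported_def)
  fix c assume "(\<forall>I. \<not> I \<subseteq> U7 \<longrightarrow> c I = 0) \<and> expand P c = expand P \<alpha>"
  then show "c = \<alpha>" using expand_inj[of c \<alpha> P] assms by (simp add: supported_def)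
qed

lemma expand_surj:
  assumes "supported \<alpha>" "fdet P \<noteq> 0"
  obtains \<gamma> where "supported \<gamma>" "\<alpha> = expand P \<gamma>"
proof
  let ?c = "\<lambda>K. (1 / fdet P) * star0 (expand (mat_transp P) (star0 \<alpha>)) K"
  show "supported ?c" by (intro supported_scale supported_star0)
  show "\<alpha> = expand P ?c" using assms by (subst expand_scale) (simp add: expand_cofactor)
qed

lemma hodge_expand:
  assumes "supported \<alpha>" "fdet P \<noteq> 0"
  shows "hodge P (expand P \<alpha>) = expand P (star0 \<alpha>)"
  using assms by (simp add: hodge_def xcoords_expand)

definition gram :: "(nat \<Rightarrow> nat \<Rightarrow> real) \<Rightarrow> nat \<Rightarrow> nat
    \<Rightarrow> real" where
  "gram P = mat_mul (mat_transp P) P"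

text \<open>The frame enters the star only through \<open>gram P\<close> and \<open>fdet P\<close>.
  Both are determined by the three-form, so this formula makes \<open>starphi\<close> independent of
  the selected frame.\<close>

lemma hodge_gram:
  assumes "supported \<alpha>" "fdet P \<noteq> 0"
  shows "hodge P \<alpha> = (\<lambda>K. expand (gram P) (star0 \<alpha>) K / fdet P)"
proof -
  obtain \<gamma> where g: "supported \<gamma>" "\<alpha> = expand P \<gamma>" using expand_surj assms by metis
  have "expand (gram P) (star0 \<alpha>) = expand P (\<lambda>K. fdet P * star0 \<gamma> K)"
    using g by (simp add: gram_def flip: expand_expand[OF supported_star0] expand_mat_transp_star0_expand)
  then show ?thesis using assms g by (simp add: hodge_expand expand_scale)
qed

lemma oneform_cong: "(\<And>j. j \<in> U7 \<Longrightarrow> v j = w j) \<Longrightarrow> oneform v = oneform w"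
  by (rule ext) (auto simp: oneform_def)

lemma expand_cong:
  assumes "\<And>i j. i \<in> U7 \<Longrightarrow> j \<in> U7 \<Longrightarrow> P i j = Q i j"
  shows "expand P = expand Q"
proof -
  have "xmon P I = xmon Q I" if "I \<subseteq> U7" for I
  proof -
    have "map (\<lambda>i. oneform (P i)) (sorted_list_of_set I) = map (\<lambda>i. oneform (Q i))
        (sorted_list_of_set I)"
      using that fin7[OF that] assms by (intro map_cong) (auto intro!: oneform_cong)
    then show ?thesis by (simp only: xmon_def)
  qed
  then show ?thesis unfolding expand_def by (intro ext sum.cong) auto
qed

lemma fdet_expand: "fdet P = expand P (emon U7) U7"
  by (simp add: expand_emon fdet_def)

lemma fdet_cong: "(\<And>i j. i \<in> U7 \<Longrightarrow> j \<in> U7 \<Longrightarrow> P i j = Q i j)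
    \<Longrightarrow> fdet P = fdet Q"
  unfolding fdet_expand using expand_cong[of P Q] by simp

definition mat_diag :: "(nat \<Rightarrow> real) \<Rightarrow> nat \<Rightarrow> nat \<Rightarrow> real" where
  "mat_diag f = (\<lambda>i j. if i = j then f i else 0)"

lemma xmon_mat_diag:
  assumes "finite I" "I \<subseteq> U7"
  shows "xmon (mat_diag f) I = (\<lambda>K. prod f I * emon I K)"
  using assms
proof (induction I rule: finite_linorder_min_induct)
  case (insert b A)
  have "{j \<in> A. j < b} = {}" using insert by force
  then have 1: "isg b A = 1" by (simp only: isg_def) simp
  have "b \<notin> A" using insert by auto
  have "xmon (mat_diag f) (insert b A) = wedge (oneform (mat_diag f b)) (\<lambda>K. prod f A * emon A K)"
    using insert by (simp add: xmon_insert_min)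
  also have "\<dots> = (\<lambda>K. prod f A * (\<Sum>j\<in>U7. mat_diag f b j * lwedge j (emon A) K))"
    using insert by (simp add: wedge_scale_right wedge_oneform supported_emon)
  also have "\<dots> = (\<lambda>K. prod f A * (\<Sum>j\<in>U7. if b = j then f b * lwedge b (emon A) K else 0))"
    by (intro ext arg_cong[where f="(*) _"] sum.cong) (auto simp: mat_diag_def)
  also have "\<dots> = (\<lambda>K. prod f (insert b A) * emon (insert b A) K)"
    using insert 1 \<open>b \<notin> A\<close> by (auto simp: lwedge_emon mult_ac)
  finally show ?case .
qed simp

lemma expand_mat_diag: "supported \<alpha> \<Longrightarrow> expand (mat_diag f) \<alpha> = (\<lambda>K. prod f
    K * \<alpha> K)"
proof
  fix K assume a: "supported \<alpha>"
  have "expand (mat_diag f) \<alpha> K = (\<Sum>I\<in>Pow U7. if I = K then prod f K * \<alpha> K else 0)"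
    unfolding expand_def by (rule sum.cong) (auto simp: xmon_mat_diag fin7 emon_def)
  also have "\<dots> = prod f K * \<alpha> K" using a by (auto simp: supported_def)
  finally show "expand (mat_diag f) \<alpha> K = prod f K * \<alpha> K" .
qed

lemma fdet_mat_diag: "fdet (mat_diag f) = prod f U7"
  by (simp add: fdet_def xmon_mat_diag emon_def)

lemma fdet_scale: "fdet (\<lambda>i j. c * P i j) = c ^ 7 * fdet P"
proof -
  have "fdet (\<lambda>i j. c * P i j) = fdet (mat_mul (mat_diag (\<lambda>_. c)) P)"
    by (rule fdet_cong) (auto simp: mat_mul_def mat_diag_def if_distrib[of "\<lambda>x. x * _"] cong: if_cong)
  then show ?thesis by (simp add: fdet_mat_mul fdet_mat_diag)
qed

lemma fdet_gram: "fdet (gram P) = (fdet P)\<^sup>2"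
  by (simp add: gram_def fdet_mat_mul fdet_mat_transp power2_eq_square)

lemma is_basis_iff: "is_basis P \<longleftrightarrow> fdet P \<noteq> 0"
  by (simp add: is_basis_def fdet_def)

text \<open>For a three-form this is the bilinear form of Bryant and Hitchin with values in
  top-degree forms, which yields the metric of a G2 structure up to a density.\<close>

definition gram_form :: "form \<Rightarrow> nat \<Rightarrow> nat \<Rightarrow> real" where
  "gram_form \<alpha> i j = wedge (contract i \<alpha>) (wedge (contract j \<alpha>) \<alpha>) U7"

text \<open>Each of the two contracted vectors contributes one factor of \<open>P\<close>; the
  determinant comes from the values being of top degree.\<close>

lemma gram_form_expand:
  assumes "supported \<alpha>" "i \<in> U7" "j \<in> U7"
  shows "gram_form (expand P \<alpha>) i j = fdet P * (\<Sum>k\<in>U7. \<Sum>l\<in>U7. P k i * P l j *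
      gram_form \<alpha> k l)"
proof -
  have "gram_form (expand P \<alpha>) i j = (\<Sum>k\<in>U7. \<Sum>l\<in>U7. P k i * (P l j * wedge (expand P
      (contract k \<alpha>)) (wedge (expand P (contract l \<alpha>)) (expand P \<alpha>)) U7))"
    using assms unfolding gram_form_def
    by (simp add: contract_expand wedge_sum_left wedge_sum_right wedge_scale_left wedge_scale_right sum_distrib_left)
  also have "\<dots> = (\<Sum>k\<in>U7. \<Sum>l\<in>U7. P k i * (P l j * (fdet P * gram_form \<alpha> k l)))"
    using assms by (simp add: gram_form_def expand_U7 supported_contract supported_wedge flip: expand_wedge)
  finally show ?thesis by (simp add: sum_distrib_left mult_ac)
qed

subsection \<open>Integer forms as lists\<close>

text \<open>A list of pairs of an integer and a strictly increasing index list is an executable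
  representation of a form with integer coefficients.\<close>

type_synonym lform = "(int \<times> nat list) list"

definition form_of_list :: "lform \<Rightarrow> form" where
  "form_of_list xs = (\<lambda>K. \<Sum>p\<leftarrow>xs. real_of_int (fst p) * emon (set (snd p)) K)"

definition increasing :: "nat list \<Rightarrow> bool" where
  "increasing l \<longleftrightarrow> sorted l \<and> distinct l \<and> set l \<subseteq> U7"

definition wf_list :: "lform \<Rightarrow> bool" where
  "wf_list xs \<longleftrightarrow> (\<forall>p\<in>set xs. increasing (snd p))"

fun isg_list :: "nat \<Rightarrow> nat list \<Rightarrow> int" where
  "isg_list i [] = 1"
| "isg_list i (j # l) = (if j < i then - isg_list i l else isg_list i l)"

fun lwedge_list :: "nat \<Rightarrow> lform \<Rightarrow> lform" where
  "lwedge_list i [] = []"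
| "lwedge_list i (p # xs) = (if i \<in> set (snd p) then lwedge_list i xs
     else (isg_list i (snd p) * fst p, insort i (snd p)) # lwedge_list i xs)"

fun contract_list :: "nat \<Rightarrow> lform \<Rightarrow> lform" where
  "contract_list i [] = []"
| "contract_list i (p # xs) = (if i \<in> set (snd p) then (isg_list i (snd p) * fst p, remove1 i (snd p)) #
    contract_list i xs
     else contract_list i xs)"

fun wedge_list :: "lform \<Rightarrow> lform \<Rightarrow> lform" where
  "wedge_list [] ys = []"
| "wedge_list (p # xs) ys = map (\<lambda>q. (fst p * fst q, snd q)) (foldr lwedge_list (snd p) ys) @
    wedge_list xs ys"

fun wsign_list :: "nat list \<Rightarrow> nat list \<Rightarrow> int" where
  "wsign_list [] J = 1"
| "wsign_list (i # l) J = isg_list i J * wsign_list l J"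

definition compl_list :: "nat list \<Rightarrow> nat list" where
  "compl_list l = filter (\<lambda>j. j \<notin> set l) [1,2,3,4,5,6,7]"

fun star_list :: "lform \<Rightarrow> lform" where
  "star_list [] = []"
| "star_list (p # xs) = (wsign_list (snd p) (compl_list (snd p)) * fst p, compl_list (snd p)) # star_list xs"

definition coeff_list :: "nat list \<Rightarrow> lform \<Rightarrow> int" where
  "coeff_list l xs = sum_list (map fst (filter (\<lambda>p. snd p = l) xs))"

text \<open>Like terms are never collected, so one index list may occur repeatedly. Vanishing is
  decided by the total coefficient at each list that occurs.\<close>

definition zero_list :: "lform \<Rightarrow> bool" where
  "zero_list xs \<longleftrightarrow> list_all (\<lambda>p. coeff_list (snd p) xs = 0) xs"

lemma U7_set: "U7 = set [1,2,3,4,5,6,7]"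
  by (auto simp: U7_def)

lemma form_of_list_Nil [simp]: "form_of_list [] = (\<lambda>K. 0)" by (simp add: form_of_list_def)
text \<open>The factor 1 keeps the shape \<open>a * \<alpha> K + b * \<beta> K\<close> in which the
  linearity rules are stated.\<close>

lemma form_of_list_Cons: "form_of_list (p # xs) = (\<lambda>K. real_of_int (fst p) * emon (set (snd p)) K + 1 *
    form_of_list xs K)"
  by (simp add: form_of_list_def)
lemma form_of_list_append: "form_of_list (xs @ ys) = (\<lambda>K. form_of_list xs K + form_of_list ys K)"
  by (simp add: form_of_list_def)
lemma wf_list_Nil [simp]: "wf_list []" by (simp add: wf_list_def)
lemma wf_list_Cons [simp]: "wf_list (p # xs) \<longleftrightarrow> increasing (snd p) \<and> wf_list xs" by
    (simp add: wf_list_def)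
lemma wf_list_append [simp]: "wf_list (xs @ ys) \<longleftrightarrow> wf_list xs \<and> wf_list ys" by (auto
    simp: wf_list_def)

lemma supported_form_of_list: "wf_list xs \<Longrightarrow> supported (form_of_list xs)"
  by (induction xs) (auto simp: form_of_list_Cons supported_def emon_def increasing_def)

lemma isg_list: "distinct l \<Longrightarrow> real_of_int (isg_list i l) = isg i (set l)"
  by (induction l) (auto simp: isg_insert, simp add: isg_def)

lemma wsign_list: "distinct l \<Longrightarrow> distinct J \<Longrightarrow> real_of_int (wsign_list l J) =
    wsign (set l) (set J)"
  by (induction l) (auto simp: wsign_insert isg_list)

lemma wf_list_lwedge_list: "i \<in> U7 \<Longrightarrow> wf_list xs \<Longrightarrow> wf_list (lwedge_list i xs)"
  by (induction xs) (auto simp: increasing_def sorted_insort distinct_insort set_insort_key)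

lemma form_of_list_lwedge_list: "i \<in> U7 \<Longrightarrow> wf_list xs \<Longrightarrow> form_of_list
    (lwedge_list i xs) = lwedge i (form_of_list xs)"
proof (induction xs)
  case Nil
  then show ?case by (simp add: lwedge_zero)
next
  case (Cons p xs)
  have "lwedge i (emon (set (snd p))) = (\<lambda>K. if i \<in> set (snd p) then 0 else isg i (set (snd p)) *
      emon (insert i (set (snd p))) K)"
  proof (cases "i \<in> set (snd p)")
    case True
    then have "K - {i} \<noteq> set (snd p)" for K by blast
    then show ?thesis using True by (simp add: lwedge_def emon_def cong: if_cong)
  next
    case False
    then show ?thesis using Cons by (simp add: lwedge_emon increasing_def)
  qed
  then show ?case using Cons
    by (simp add: form_of_list_Cons lwedge_lin[where b=1, simplified] set_insort_key isg_list increasing_def mult_ac)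
qed

lemma form_of_list_foldr:
  assumes "wf_list ys"
  shows "increasing l \<Longrightarrow> wf_list (foldr lwedge_list l ys) \<and> form_of_list (foldr lwedge_list
      l ys) = wedge (emon (set l)) (form_of_list ys)"
proof (induction l)
  case Nil
  then show ?case using assms by (simp add: wedge_unit supported_form_of_list)
next
  case (Cons i l)
  then have w: "increasing l" "i \<in> U7" "i \<notin> set l" "\<forall>j\<in>set l. i \<le> j" by (simp_all
      add: increasing_def)
  \<comment> \<open>The head of a strictly increasing list is its smallest entry, so multiplying by
    it produces no sign.\<close>
  then have "{j \<in> set l. j < i} = {}" by force
  then have "isg i (set l) = 1" by (simp only: isg_def) simp
  then have "emon (set (i # l)) = lwedge i (emon (set l))" using w by (simp add: lwedge_emon increasing_def)
  then show ?case using Cons.IH w by (simp add: wf_list_lwedge_list form_of_list_lwedge_list wedge_lwedge)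
qed

lemma form_of_list_scale: "form_of_list (map (\<lambda>q. (c * fst q, snd q)) xs) = (\<lambda>K. real_of_int c
    * form_of_list xs K)"
  by (induction xs) (auto simp: form_of_list_Cons algebra_simps)

lemma wf_list_wedge_list: "wf_list xs \<Longrightarrow> wf_list ys \<Longrightarrow> wf_list (wedge_list xs ys)"
proof (induction xs)
  case (Cons p xs)
  have "wf_list (map (\<lambda>q. (c * fst q, snd q)) zs)" if "wf_list zs" for c zs
    using that by (simp add: wf_list_def)
  then show ?case using Cons form_of_list_foldr[of ys "snd p"] by simp
qed simp

lemma form_of_list_wedge_list: "wf_list xs \<Longrightarrow> wf_list ys \<Longrightarrow> form_of_list
    (wedge_list xs ys) = wedge (form_of_list xs) (form_of_list ys)"
proof (induction xs)
  case Nil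
  then show ?case by (simp add: wedge_def fun_eq_iff)
next
  case (Cons p xs)
  then show ?case by (simp add: form_of_list_append form_of_list_scale form_of_list_foldr form_of_list_Cons
      wedge_lin_left[where b=1, simplified])
qed

lemma wf_list_contract_list: "wf_list xs \<Longrightarrow> wf_list (contract_list i xs)"
  by (induction xs) (auto simp: increasing_def sorted_remove1 set_remove1_eq)

lemma contract_zero: "contract i (\<lambda>K. 0) = (\<lambda>K. 0)" by (auto simp: contract_def)

lemma contract_emon:
  assumes "i \<in> U7" "I \<subseteq> U7"
  shows "contract i (emon I) = (\<lambda>K. if i \<in> I then isg i I * emon (I - {i}) K else 0)"
proof
  fix K
  show "contract i (emon I) K = (if i \<in> I then isg i I * emon (I - {i}) K else 0)"
  proof (cases "i \<in> K \<or> insert i K \<noteq> I")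
    case True
    then show ?thesis using assms by (simp add: contract_def emon_def) blast
  next
    case False
    then have "I - {i} = K" "i \<in> I" by auto
    moreover have "isg i I = isg i K" using False assms isg_insert[of K i i] fin7[of I] by auto
    moreover have "insert i K \<subseteq> U7" using False assms by blast
    ultimately show ?thesis using False by (simp add: contract_def emon_def)
  qed
qed

lemma form_of_list_contract_list: "i \<in> U7 \<Longrightarrow> wf_list xs \<Longrightarrow> form_of_list
    (contract_list i xs) = contract i (form_of_list xs)"
proof (induction xs)
  case Nil
  then show ?case by (simp add: contract_zero)
next
  case (Cons p xs)
  then show ?case
    by (auto simp: form_of_list_Cons contract_lin[where b=1, simplified] isg_list increasing_def contract_emon
        set_remove1_eq)
qed

lemma set_compl_list: "set (compl_list l) = U7 - set l"
  unfolding compl_list_def U7_set set_filter by blast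

lemma increasing_compl_list: "increasing (compl_list l)"
proof -
  have "sorted [1,2,3,4,5,6,7::nat]" "distinct [1,2,3,4,5,6,7::nat]" by simp_all
  then show ?thesis unfolding increasing_def set_compl_list unfolding compl_list_def by (simp add: sorted_wrt_filter)
qed

lemma wf_list_star_list: "wf_list (star_list xs)"
  by (induction xs) (auto simp: increasing_compl_list)

lemma star0_emon:
  assumes "I \<subseteq> U7" shows "star0 (emon I) = (\<lambda>K. wsign I (U7 - I) * emon (U7 - I) K)"
proof
  fix K
  show "star0 (emon I) K = wsign I (U7 - I) * emon (U7 - I) K"
  proof (cases "K = U7 - I")
    case True
    then show ?thesis using assms by (simp add: star0_def emon_def U7_compl)
  next
    case False
    then have "\<not> (K \<subseteq> U7 \<and> U7 - K = I)" by blast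
    then show ?thesis using False by (auto simp: star0_def emon_def)
  qed
qed

lemma star0_lin: "star0 (\<lambda>K. a * \<alpha> K + b * \<beta> K) = (\<lambda>K. a * star0 \<alpha> K + b *
    star0 \<beta> K)"
  by (auto simp: star0_def algebra_simps)

lemma star0_zero: "star0 (\<lambda>K. 0) = (\<lambda>K. 0)" by (auto simp: star0_def)

lemma form_of_list_star_list: "wf_list xs \<Longrightarrow> form_of_list (star_list xs) = star0 (form_of_list xs)"
proof (induction xs)
  case Nil
  then show ?case by (simp add: star0_zero)
next
  case (Cons p xs)
  have "distinct (compl_list (snd p))" using increasing_compl_list by (simp add: increasing_def)
  moreover have "star0 (form_of_list (p # xs)) = (\<lambda>K. real_of_int (fst p) * star0 (emon (set (snd p)))
      K + 1 * star0 (form_of_list xs) K)"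
    by (simp only: form_of_list_Cons star0_lin)
  ultimately show ?case using Cons
    by (simp add: form_of_list_Cons wsign_list increasing_def star0_emon set_compl_list mult_ac)
qed

lemma form_of_list_coeff: "wf_list xs \<Longrightarrow> increasing l \<Longrightarrow> form_of_list xs (set l)
    = real_of_int (coeff_list l xs)"
proof (induction xs)
  case (Cons p xs)
  then have "set (snd p) = set l \<longleftrightarrow> snd p = l"
    by (metis sorted_distinct_set_unique increasing_def wf_list_Cons)
  then show ?case using Cons by (auto simp: form_of_list_Cons coeff_list_def emon_def)
qed (simp add: coeff_list_def)

lemma form_of_list_zero:
  assumes "wf_list xs" "zero_list xs" shows "form_of_list xs = (\<lambda>K. 0)"
proof
  fix K
  show "form_of_list xs K = 0"
  proof (cases "\<exists>p\<in>set xs. K = set (snd p)")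
    case True
    then obtain p where p: "p \<in> set xs" "K = set (snd p)" by blast
    then have "increasing (snd p)" "coeff_list (snd p) xs = 0" using assms by (auto simp: wf_list_def
        zero_list_def list_all_iff)
    then show ?thesis using form_of_list_coeff[OF assms(1)] p by simp
  next
    case False
    then have "map (\<lambda>p. real_of_int (fst p) * emon (set (snd p)) K) xs = map (\<lambda>p. 0) xs"
      by (intro map_cong) (auto simp: emon_def)
    then show ?thesis by (simp only: form_of_list_def) simp
  qed
qed

section \<open>Integer computations with the standard three-form\<close>

definition phi0_list :: lform where
  "phi0_list = [(1,[1,2,7]),(1,[3,4,7]),(1,[5,6,7]),(1,[1,3,5]),(-1,[1,4,6]),(-1,[2,3,6]),(-1,[2,4,5])]"

lemma wf_list_phi0_list: "wf_list phi0_list"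
  by (auto simp: phi0_list_def increasing_def U7_def)

lemma form_of_list_phi0_list: "form_of_list phi0_list = phi0"
  by (rule ext) (simp add: phi0_list_def form_of_list_def phi0_def)

abbreviation indices :: "nat list" where "indices \<equiv> [1,2,3,4,5,6,7]"

text \<open>Source of the constant 6 in all later formulas: on the standard form the bilinear form
  is six times the standard metric.\<close>

lemma gram_form_check:
  "list_all (\<lambda>i. list_all (\<lambda>j. coeff_list indices (wedge_list (contract_list i phi0_list)
      (wedge_list (contract_list j phi0_list) phi0_list)) = (if i = j then 6 else 0)) indices) indices"
  by code_simp

text \<open>The torsion identity is linear in the two-form, so 21 basis two-forms against 7
  contractions exhaust it. Concatenating two lists adds the forms; a zero sum says that the two
  sides are opposite.\<close>

lemma torsion_check:
  "list_all (\<lambda>p. list_all (\<lambda>k.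
      zero_list (wedge_list (star_list (wedge_list [(1, p)] (contract_list k phi0_list))) phi0_list @
          wedge_list (star_list (wedge_list [(1, p)] (contract_list k (star_list phi0_list)))) (star_list
          phi0_list))) indices)
   [[1,2],[1,3],[1,4],[1,5],[1,6],[1,7],[2,3],[2,4],[2,5],[2,6],[2,7],[3,4],[3,5],[3,6],[3,7],
    [4,5],[4,6],[4,7],[5,6],[5,7],[6,7]]"
  by code_simp

lemma phi_phi_check: "zero_list (wedge_list phi0_list phi0_list)"
  by code_simp

lemma phi_psi_check: "coeff_list indices (wedge_list phi0_list (star_list phi0_list)) = 7"
  by code_simp

lemma increasing_indices: "increasing indices"
  by (simp add: increasing_def U7_def)

lemma form_of_list_U7: "wf_list xs \<Longrightarrow> form_of_list xs U7 = real_of_int (coeff_list indices xs)"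
  using form_of_list_coeff[OF _ increasing_indices, of xs] by (simp only: U7_set)

lemma supported_phi0: "supported phi0"
  using supported_form_of_list[OF wf_list_phi0_list] by (simp add: form_of_list_phi0_list)

lemma gram_form_phi0:
  assumes "i \<in> U7" "j \<in> U7"
  shows "gram_form phi0 i j = (if i = j then 6 else 0)"
proof -
  have "coeff_list indices (wedge_list (contract_list i phi0_list) (wedge_list (contract_list j phi0_list)
      phi0_list)) = (if i = j then 6 else 0)"
    using gram_form_check assms unfolding list_all_iff U7_set by blast
  moreover have "gram_form phi0 i j = coeff_list indices (wedge_list (contract_list i phi0_list) (wedge_list
      (contract_list j phi0_list) phi0_list))"
    using assms form_of_list_U7[of "wedge_list (contract_list i phi0_list) (wedge_list (contract_list j
        phi0_list) phi0_list)"]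
    by (simp add: gram_form_def form_of_list_wedge_list wf_list_wedge_list wf_list_contract_list
        wf_list_phi0_list form_of_list_contract_list form_of_list_phi0_list)
  ultimately show ?thesis by simp
qed

lemma wedge_phi0_phi0: "wedge phi0 phi0 = (\<lambda>K. 0)"
  using form_of_list_zero[OF wf_list_wedge_list[OF wf_list_phi0_list wf_list_phi0_list] phi_phi_check] by (simp
      add: form_of_list_wedge_list wf_list_phi0_list form_of_list_phi0_list)

lemma form_inner_phi0_phi0: "form_inner phi0 phi0 = 7"
proof -
  have "wedge phi0 (star0 phi0) U7 = 7"
    using form_of_list_U7[of "wedge_list phi0_list (star_list phi0_list)"] phi_psi_check
    by (simp add: form_of_list_wedge_list wf_list_wedge_list wf_list_star_list wf_list_phi0_list
        form_of_list_star_list form_of_list_phi0_list)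
  then show ?thesis by (simp add: wedge_U7 star0_star0 supported_phi0)
qed

lemma torsion_emon:
  assumes "i \<in> U7" "j \<in> U7" "i < j" "k \<in> U7"
  shows "wedge (star0 (wedge (emon {i, j}) (contract k phi0))) phi0
     = (\<lambda>K. - wedge (star0 (wedge (emon {i, j}) (contract k (star0 phi0)))) (star0 phi0) K)"
proof -
  let ?p = "[(1, [i, j])]"
  have w: "wf_list ?p" using assms by (simp add: increasing_def)
  have s: "form_of_list ?p = emon {i, j}" by (simp add: form_of_list_def)
  have "[i, j] \<in> set [[1,2],[1,3],[1,4],[1,5],[1,6],[1,7],[2,3],[2,4],[2,5],[2,6],[2,7],[3,4],[3,5],[3,6],[3,7],
    [4,5],[4,6],[4,7],[5,6],[5,7],[6,7::nat]]"
    (is "_ \<in> set ?L")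
  proof -
    have "list_all (\<lambda>i. list_all (\<lambda>j. j \<le> i \<or> [i, j] \<in> set ?L) indices) indices" by
        code_simp
    then have "j \<le> i \<or> [i, j] \<in> set ?L" using assms unfolding list_all_iff U7_set by blast
    then show ?thesis using assms by simp
  qed
  then have z: "zero_list (wedge_list (star_list (wedge_list ?p (contract_list k phi0_list))) phi0_list @
      wedge_list (star_list (wedge_list ?p (contract_list k (star_list phi0_list)))) (star_list phi0_list))"
    using torsion_check assms(4) unfolding list_all_iff U7_set by blast
  have "form_of_list (wedge_list (star_list (wedge_list ?p (contract_list k phi0_list))) phi0_list @ wedge_list
      (star_list (wedge_list ?p (contract_list k (star_list phi0_list)))) (star_list phi0_list)) = (\<lambda>K. 0)"
    by (rule form_of_list_zero[OF _ z]) (simp add: wf_list_wedge_list wf_list_contract_list wf_list_phi0_list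
        wf_list_star_list w)
  then have "wedge (star0 (wedge (emon {i, j}) (contract k phi0))) phi0 K
      + wedge (star0 (wedge (emon {i, j}) (contract k (star0 phi0)))) (star0 phi0) K = 0" for K
    using assms w s by (simp add: form_of_list_append form_of_list_wedge_list wf_list_wedge_list
        wf_list_contract_list wf_list_phi0_list wf_list_star_list form_of_list_star_list
        form_of_list_contract_list form_of_list_phi0_list
        del: wedge_list.simps) (drule fun_cong, simp)
  then show ?thesis by (simp add: fun_eq_iff eq_neg_iff_add_eq_0)
qed

subsection \<open>Torsion of a frame\<close>

definition psi0 :: form where "psi0 = star0 phi0"

lemma supported_psi0: "supported psi0" by (simp add: psi0_def supported_star0)
lemma star0_psi0: "star0 psi0 = phi0" by (simp add: psi0_def star0_star0 supported_phi0)

lemma G2frameD: "G2frame \<phi> P \<Longrightarrow> fdet P \<noteq> 0" "G2frame \<phi> P \<Longrightarrow>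
    \<phi> = expand P phi0"
  by (simp_all add: G2frame_def is_basis_iff)

lemma gram_form_expand_phi0:
  assumes "i \<in> U7" "j \<in> U7"
  shows "gram_form (expand P phi0) i j = 6 * fdet P * gram P i j"
proof -
  have "gram_form (expand P phi0) i j = fdet P * (\<Sum>k\<in>U7. \<Sum>l\<in>U7. if k = l then 6 * (P k i * P
      k j) else 0)"
    using assms by (simp add: gram_form_expand supported_phi0 gram_form_phi0 if_distrib[of "(*) _"] mult_ac
        cong: sum.cong if_cong)
  also have "\<dots> = 6 * fdet P * gram P i j"
    by (simp add: gram_def mat_mul_def mat_transp_def sum_distrib_left mult_ac)
  finally show ?thesis .
qed

text \<open>The determinant of the bilinear form is \<open>6 ^ 7 * fdet R ^ 9\<close> for any
  adapted frame \<open>R\<close>: seven powers come from the scalar \<open>6 * fdet R\<close> in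
  each row, two from the metric. Once the volume factor is known, dividing by it leaves the
  metric.\<close>

lemma frame_unique:
  assumes "G2frame \<phi> P" "G2frame \<phi> Q"
  shows "fdet P = fdet Q" "i \<in> U7 \<Longrightarrow> j \<in> U7 \<Longrightarrow> gram P i j = gram Q i j"
proof -
  have *: "fdet (gram_form \<phi>) = 6 ^ 7 * fdet R ^ 9" if "G2frame \<phi> R" for R
  proof -
    have "fdet (gram_form \<phi>) = fdet (\<lambda>i j. 6 * fdet R * gram R i j)"
      using G2frameD(2)[OF that] by (intro fdet_cong) (simp add: gram_form_expand_phi0)
    also have "\<dots> = 6 ^ 7 * fdet R ^ 9" by (simp add: fdet_scale fdet_gram power_mult_distrib flip: power_add)
    finally show ?thesis .
  qed
  have "fdet P ^ 9 = fdet Q ^ 9" using *[OF assms(1)] *[OF assms(2)] by simp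
  \<comment> \<open>The exponent is odd, so the root recovers the sign as well: the three-form fixes
    its orientation.\<close>
  then have "root 9 (fdet P ^ 9) = root 9 (fdet Q ^ 9)" by simp
  then show d: "fdet P = fdet Q" by (simp add: odd_real_root_power_cancel)
  assume "i \<in> U7" "j \<in> U7"
  then have "6 * fdet P * gram P i j = 6 * fdet Q * gram Q i j"
    using G2frameD(2)[OF assms(1)] G2frameD(2)[OF assms(2)] by (simp flip: gram_form_expand_phi0)
  then show "gram P i j = gram Q i j" using d G2frameD(1)[OF assms(2)] by simp
qed

text \<open>Any adapted frame may replace the one selected by \<open>frame\<close>; afterwards the
  star is always computed in a convenient frame.\<close>

lemma starphi_frame:
  assumes "G2frame \<phi> P" "supported \<alpha>"
  shows "starphi \<phi> \<alpha> = hodge P \<alpha>"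
proof -
  have f: "G2frame \<phi> (frame \<phi>)" unfolding frame_def by (rule someI[of "G2frame \<phi>"]) (rule assms(1))
  have "expand (gram (frame \<phi>)) = expand (gram P)"
    using frame_unique(2)[OF f assms(1)] by (rule expand_cong)
  then show ?thesis
    using f assms frame_unique(1)[OF f assms(1)] by (simp add: starphi_def hodge_gram G2frameD(1))
qed

lemma starphi_expand:
  assumes "G2frame \<phi> P" "supported \<alpha>"
  shows "starphi \<phi> (expand P \<alpha>) = expand P (star0 \<alpha>)"
  using assms by (simp add: starphi_frame supported_expand hodge_expand G2frameD(1))

lemma starphi_phi: "G2frame \<phi> P \<Longrightarrow> starphi \<phi> \<phi> = expand P psi0"
  using starphi_expand[OF _ supported_phi0, of \<phi> P] by (simp add: psi0_def G2frameD(2)[symmetric])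

section \<open>Exterior derivative, degrees and scalar torsion\<close>

lemma supported_de: "supported (de i)"
  by (auto simp: supported_def de_def zeroform_def emon_def U7_def)

lemma kform_de: "kform 2 (de 7)"
  by (auto simp: kform_def de_def emon_def U7_def)

text \<open>Only e^7 fails to be closed, so a single term of the Leibniz sum survives.\<close>

lemma dform_eq: "supported \<alpha> \<Longrightarrow> dform \<alpha> = wedge (de 7) (contract 7 \<alpha>)"
proof -
  assume a: "supported \<alpha>"
  have U: "7 \<in> U7" by (simp add: U7_def)
  have m: "dmon I = wedge (de 7) (contract 7 (emon I))" if I: "I \<subseteq> U7" for I
  proof
    fix K
    have z: "wedge (de i) \<beta> K = 0" if "i \<noteq> 7" for i \<beta>
      using that by (simp add: de_def zeroform_def wedge_def)
    have "dmon I K = (\<Sum>i\<in>I. if i = 7 then isg 7 I * wedge (de 7) (emon (I - {7})) K else 0)"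
      unfolding dmon_def by (rule sum.cong) (auto simp: z isg_def)
    also have "\<dots> = (if 7 \<in> I then isg 7 I * wedge (de 7) (emon (I - {7})) K else 0)"
      using fin7[OF I] by simp
    also have "\<dots> = wedge (de 7) (contract 7 (emon I)) K"
    proof (cases "7 \<in> I")
      case True
      then show ?thesis using U I by (simp add: contract_emon wedge_scale_right)
    next
      case False
      then show ?thesis using U I by (simp add: contract_emon wedge_def)
    qed
    finally show "dmon I K = wedge (de 7) (contract 7 (emon I)) K" .
  qed
  have "wedge (de 7) (contract 7 \<alpha>) = wedge (de 7) (contract 7 (\<lambda>K. \<Sum>I\<in>Pow U7. \<alpha>
      I * emon I K))"
    using supported_expansion[OF a] by simp
  also have "\<dots> = dform \<alpha>"
    by (simp add: contract_sum contract_scale wedge_sum_right wedge_scale_right dform_def m)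
  finally show ?thesis by simp
qed

lemma kform_supported: "kform k \<alpha> \<Longrightarrow> supported \<alpha>"
  unfolding kform_def supported_def by blast

lemma kform_star0:
  assumes "kform k \<alpha>" shows "kform (7 - k) (star0 \<alpha>)"
proof -
  have "card I = 7 - k" if "I \<subseteq> U7" "\<alpha> (U7 - I) \<noteq> 0" for I
  proof -
    have "card (U7 - I) = k" using assms that by (simp add: kform_def)
    then have "7 - card I = k" using that fin7[of I] by (simp add: card_Diff_subset)
    then show ?thesis using card_mono[OF finite_U7 that(1)] by simp
  qed
  then show ?thesis by (auto simp: kform_def star0_def split: if_splits)
qed

lemma kform_wedge:
  assumes "kform k \<alpha>" "kform l \<beta>" shows "kform (k + l) (wedge \<alpha> \<beta>)"
proof -
  have "K \<subseteq> U7 \<and> card K = k + l" if "wedge \<alpha> \<beta> K \<noteq> 0" for K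
  proof -
    have K: "K \<subseteq> U7" and "(\<Sum>I\<in>Pow K. wsign I (K - I) * \<alpha> I * \<beta> (K - I)) \<noteq> 0"
      using that by (auto simp: wedge_def split: if_splits)
    then obtain I where I: "I \<in> Pow K" "wsign I (K - I) * \<alpha> I * \<beta> (K - I) \<noteq> 0"
      using sum.neutral[of "Pow K" "\<lambda>I. wsign I (K - I) * \<alpha> I * \<beta> (K - I)"] by fastforce
    then have "card I = k" "card (K - I) = l" using assms by (auto simp: kform_def)
    moreover have "card K = card I + card (K - I)"
      using I fin7[OF K] by (metis Pow_iff card_Diff_subset card_mono finite_subset le_add_diff_inverse)
    ultimately show ?thesis using K by simp
  qed
  then show ?thesis by (simp add: kform_def)
qed

lemma kform_contract:
  assumes "kform (Suc k) \<alpha>" shows "kform k (contract i \<alpha>)"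
proof -
  have "K \<subseteq> U7 \<and> card K = k" if "contract i \<alpha> K \<noteq> 0" for K
  proof -
    have K: "insert i K \<subseteq> U7" "i \<notin> K" "\<alpha> (insert i K) \<noteq> 0"
      using that by (auto simp: contract_def split: if_splits)
    then show ?thesis using assms fin7[of K] by (auto simp: kform_def)
  qed
  then show ?thesis by (simp add: kform_def)
qed

lemma kform_scale: "kform k \<alpha> \<Longrightarrow> kform k (\<lambda>K. c * \<alpha> K)"
  by (simp add: kform_def)

lemma kform_sum: "(\<And>i. i \<in> S \<Longrightarrow> kform k (\<alpha> i)) \<Longrightarrow> kform k
    (\<lambda>K. \<Sum>i\<in>S. \<alpha> i K)"
  unfolding kform_def by (metis (mono_tags, lifting) sum.neutral)

lemma kform_phi0: "kform 3 phi0"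
  by (auto simp: kform_def phi0_def emon_def U7_def split: if_splits)

lemma star0_sum: "star0 (\<lambda>K. \<Sum>j\<in>S. \<alpha> j K) = (\<lambda>K. \<Sum>j\<in>S. star0 (\<alpha> j) K)"
proof
  fix K show "star0 (\<lambda>K. \<Sum>j\<in>S. \<alpha> j K) K = (\<Sum>j\<in>S. star0 (\<alpha> j) K)"
    by (cases "K \<subseteq> U7") (simp_all add: star0_def sum_distrib_left)
qed

lemma star0_adj: "form_inner (star0 \<alpha>) \<beta> = form_inner \<alpha> (star0 \<beta>)"
proof -
  have "form_inner (star0 \<alpha>) \<beta> = (\<Sum>K\<in>Pow U7. wsign (U7 - K) K * \<alpha> (U7 - K) * \<beta> K)"
    by (simp add: form_inner_def star0_def)
  also have "\<dots> = (\<Sum>K\<in>Pow U7. wsign K (U7 - K) * \<alpha> K * \<beta> (U7 - K))"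
    by (rule sum.reindex_bij_witness[of _ "\<lambda>K. U7 - K" "\<lambda>K. U7 - K"]) (auto simp: U7_compl)
  also have "\<dots> = form_inner \<alpha> (star0 \<beta>)"
    unfolding form_inner_def by (rule sum.cong) (simp_all add: star0_def wsign_compl')
  finally show ?thesis .
qed

lemma wedge_zero_left: "wedge (\<lambda>K. 0) \<beta> = (\<lambda>K. 0)"
  by (rule ext) (simp add: wedge_def)

text \<open>The vector components of \<open>d \<phi>\<close> and \<open>d \<psi>\<close> are the same part of
    the torsion.  This is why \<open>d \<psi> = 0\<close>
  makes \<open>\<tau>3 \<and> \<phi> = 0\<close> solvable, so that the definite description in
      \<open>tau0\<close> is not vacuous.\<close>

lemma torsion_two_form:
  assumes "kform 2 \<omega>" "k \<in> U7"
  shows "wedge (star0 (wedge \<omega> (contract k phi0))) phi0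
     = (\<lambda>K. - wedge (star0 (wedge \<omega> (contract k psi0))) psi0 K)"
proof
  fix K
  have e: "wedge (star0 (wedge \<omega> \<beta>)) \<gamma> K = (\<Sum>I\<in>Pow U7. \<omega> I * wedge (star0
      (wedge (emon I) \<beta>)) \<gamma> K)" for \<beta> \<gamma>
  proof -
    have "wedge (star0 (wedge \<omega> \<beta>)) \<gamma> K = wedge (star0 (wedge (\<lambda>K. \<Sum>I\<in>Pow
        U7. \<omega> I * emon I K) \<beta>)) \<gamma> K"
      using supported_expansion[OF kform_supported[OF assms(1)]] by simp
    then show ?thesis
      by (simp add: wedge_sum_left wedge_scale_left star0_sum star0_scale)
  qed
  have "\<omega> I * wedge (star0 (wedge (emon I) (contract k phi0))) phi0 K = - (\<omega> I * wedge (star0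
      (wedge (emon I) (contract k psi0))) psi0 K)"
    if "I \<in> Pow U7" for I
  proof (cases "\<omega> I = 0")
    case False
    then have "card I = 2" using assms(1) by (simp add: kform_def)
    then obtain a b where "I = {a, b}" "a \<noteq> b" by (meson card_2_iff)
    then obtain i j where "I = {i, j}" "i < j" by (metis insert_commute linorder_neqE_nat)
    then show ?thesis using torsion_emon[of i j k] that assms(2) by (simp add: psi0_def)
  qed simp
  then show "wedge (star0 (wedge \<omega> (contract k phi0))) phi0 K = - wedge (star0 (wedge \<omega> (contract
      k psi0))) psi0 K"
    unfolding e sum_negf[symmetric] by (rule sum.cong[OF refl])
qed

text \<open>In the coframe x, project d\<phi> orthogonally onto \<psi>. The remainder is orthogonal
  to \<psi>, which gives \<open>\<tau>3 \<and> \<psi> = 0\<close>; the torsion identity and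
  closedness give \<open>\<tau>3 \<and> \<phi> = 0\<close>. The scalar is unique because it is the
  coefficient of this projection.\<close>

lemma tau0_frame:
  assumes P: "G2frame \<phi> P" and cl: "dform (starphi \<phi> \<phi>) = zeroform"
  shows "tau0 \<phi> = wedge (dform \<phi>) \<phi> U7 / (7 * fdet P)"
proof -
  note d = G2frameD(1)[OF P] and e = G2frameD(2)[OF P]
  \<comment> \<open>The two-form de^7 in the coordinates of the coframe x, obtained by Cramer's
    rule.\<close>
  define \<omega> where "\<omega> = (\<lambda>K. (1 / fdet P) * star0 (expand (mat_transp P) (star0 (de 7))) K)"
  have "kform (7 - (7 - 2)) (star0 (expand (mat_transp P) (star0 (de 7))))"
    by (intro kform_star0 kform_expand kform_de)
  then have k2: "kform 2 \<omega>" unfolding \<omega>_def by (intro kform_scale) simp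
  note o2 = kform_supported[OF k2]
  have de: "de 7 = expand P \<omega>"
    using d unfolding \<omega>_def by (subst expand_scale) (simp add: expand_cofactor supported_de)
  \<comment> \<open>The exterior derivative transported to the coordinates of x;
    \<open>P k 7\<close> are the x-components of the vector e_7.\<close>
  define D where "D \<alpha> = (\<lambda>K. \<Sum>k\<in>U7. P k 7 * wedge \<omega> (contract k \<alpha>) K)"
      for \<alpha>
  have dE: "dform (expand P \<alpha>) = expand P (D \<alpha>)" if "supported \<alpha>" for \<alpha>
  proof -
    have "dform (expand P \<alpha>) = wedge (expand P \<omega>) (\<lambda>K. \<Sum>k\<in>U7. P k 7 * expand P
        (contract k \<alpha>) K)"
      using that by (subst dform_eq) (simp_all add: supported_expand de contract_expand U7_def)
    then show ?thesis
      by (simp add: D_def wedge_sum_right wedge_scale_right expand_sum expand_scale expand_wedge o2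
          supported_contract)
  qed
  have oD: "supported (D \<alpha>)" for \<alpha> unfolding D_def by (intro supported_sum supported_scale
      supported_wedge)
  have psi: "starphi \<phi> \<phi> = expand P psi0" by (rule starphi_phi[OF P])
  have "expand P (D psi0) = expand P (\<lambda>K. 0)"
    using cl by (simp add: psi dE supported_psi0 zeroform_def expand_zero)
  then have D0: "D psi0 = (\<lambda>K. 0)"
    by (rule expand_inj[OF oD _ d, rotated]) (simp add: supported_def)
  \<comment> \<open>The right-hand side vanishes by closedness of \<psi>; this is the only source of
    the condition on \<open>\<tau>3 \<and> \<phi>\<close>.\<close>
  have "wedge (star0 (D phi0)) phi0 = (\<lambda>K. - wedge (star0 (D psi0)) psi0 K)"
    by (simp add: D_def star0_sum star0_scale wedge_sum_left wedge_scale_left torsion_two_form[OF k2] sum_negf)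
  then have tw: "wedge (star0 (D phi0)) phi0 = (\<lambda>K. 0)"
    by (simp add: D0 star0_zero wedge_zero_left)
  have dphi: "dform \<phi> = expand P (D phi0)" using dE[OF supported_phi0] e by simp
  \<comment> \<open>The component along \<open>psi0\<close>, whose squared norm is 7.\<close>
  define r where "r = form_inner (D phi0) psi0 / 7"
  have ipp: "form_inner psi0 psi0 = 7" using star0_adj[of phi0 psi0] by (simp add: psi0_def star0_star0
      supported_phi0 form_inner_phi0_phi0)
  define t where "t = (\<lambda>K. 1 * star0 (D phi0) K + (- r) * phi0 K)"
  have kD: "kform 4 (D phi0)"
  proof -
    have "kform (2 + 2) (wedge \<omega> (contract k phi0))" for k
      by (intro kform_wedge k2 kform_contract) (use kform_phi0 in \<open>simp add: numeral_3_eq_3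
          numeral_2_eq_2\<close>)
    then show ?thesis unfolding D_def by (intro kform_sum kform_scale) simp
  qed
  have kt: "kform 3 t"
  proof -
    have "kform 3 (star0 (D phi0))" using kform_star0[OF kD] by simp
    then show ?thesis using kform_phi0 unfolding t_def kform_def by (metis add.right_neutral mult_zero_right)
  qed
  have ot: "supported t" by (rule kform_supported[OF kt])
  have st: "star0 t = (\<lambda>K. D phi0 K - r * psi0 K)"
    unfolding t_def by (subst star0_lin) (simp add: star0_star0 oD psi0_def)
  have P1: "dform \<phi> = (\<lambda>K. r * starphi \<phi> \<phi> K + starphi \<phi> (expand P t) K)"
    by (simp add: dphi psi starphi_expand[OF P ot] st expand_diff expand_scale)
  have P2: "wedge (expand P t) \<phi> = zeroform"
  proof -
    have "wedge t phi0 = (\<lambda>K. 0)"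
      unfolding t_def by (subst wedge_lin_left) (simp add: tw wedge_phi0_phi0)
    then show ?thesis by (simp add: e zeroform_def ot supported_phi0 expand_zero flip: expand_wedge)
  qed
  have iz: "form_inner t phi0 = 0"
    unfolding t_def by (subst form_inner_lin_left) (simp add: star0_adj psi0_def[symmetric]
        form_inner_phi0_phi0 r_def)
  have P3: "wedge (expand P t) (starphi \<phi> \<phi>) = zeroform"
  proof -
    \<comment> \<open>A product of degree seven has only its top coefficient, and that coefficient
      is the inner product of \<open>t\<close> with \<open>phi0\<close>.\<close>
    have k7: "kform (3 + 4) (wedge t psi0)"
      using kform_star0[OF kform_phi0] by (intro kform_wedge kt) (simp add: psi0_def)
    have "wedge t psi0 K = 0" for K
    proof (cases "K = U7")
      case True
      then show ?thesis using iz by (simp add: wedge_U7 star0_psi0)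
    next
      case False
      then have "\<not> (K \<subseteq> U7 \<and> card K = 7)" using card_subset_eq[OF finite_U7, of K] by auto
      then show ?thesis using k7 unfolding kform_def by fastforce
    qed
    then have "wedge t psi0 = (\<lambda>K. 0)" by auto
    then show ?thesis by (simp add: psi zeroform_def ot supported_psi0 expand_zero flip: expand_wedge)
  qed
  have "tau0 \<phi> = r"
    unfolding tau0_def
  proof (rule the_equality)
    show "\<exists>\<tau>3. kform 3 \<tau>3 \<and> dform \<phi> = (\<lambda>K. r * starphi \<phi> \<phi> K +
        starphi \<phi> \<tau>3 K) \<and>
       wedge \<tau>3 \<phi> = zeroform \<and> wedge \<tau>3 (starphi \<phi> \<phi>) = zeroform"
      using P1 P2 P3 kform_expand[OF kt] by blast
  next
    fix s
    assume "\<exists>\<tau>3. kform 3 \<tau>3 \<and> dform \<phi> = (\<lambda>K. s * starphi \<phi> \<phi> K +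
        starphi \<phi> \<tau>3 K) \<and>
       wedge \<tau>3 \<phi> = zeroform \<and> wedge \<tau>3 (starphi \<phi> \<phi>) = zeroform"
    then obtain \<tau> where \<tau>: "kform 3 \<tau>" "dform \<phi> = (\<lambda>K. s * starphi \<phi> \<phi> K
        + starphi \<phi> \<tau> K)"
       "wedge \<tau> (starphi \<phi> \<phi>) = zeroform" by blast
    obtain u where u: "supported u" "\<tau> = expand P u" using expand_surj[OF kform_supported[OF \<tau>(1)] d]
        by metis
    have "expand P (D phi0) = expand P (\<lambda>K. s * psi0 K + 1 * star0 u K)"
      using \<tau>(2) by (simp add: expand_lin[where b=1, simplified] dphi psi u starphi_expand[OF P])
    then have D: "D phi0 = (\<lambda>K. s * psi0 K + 1 * star0 u K)"
      by (rule expand_inj[OF oD _ d, rotated]) (intro supported_lin supported_psi0 supported_star0)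
    \<comment> \<open>A second decomposition also has a remainder orthogonal to \<open>psi0\<close>,
      so pairing with \<open>psi0\<close> isolates its scalar.\<close>
    have "expand P (wedge u psi0) U7 = 0"
      using \<tau>(3) by (simp add: u psi expand_wedge supported_psi0 zeroform_def)
    then have "form_inner u phi0 = 0" using d by (simp add: expand_U7 wedge_U7 star0_psi0)
    then have "form_inner (D phi0) psi0 = 7 * s"
      unfolding D by (subst form_inner_lin_left) (simp add: ipp star0_adj star0_psi0)
    then show "s = r" by (simp add: r_def)
  qed
  moreover have "wedge (dform \<phi>) \<phi> U7 = fdet P * (7 * r)"
  proof -
    have "wedge (dform \<phi>) \<phi> = expand P (wedge (D phi0) phi0)"
      unfolding dphi by (subst e) (simp add: expand_wedge oD supported_phi0)
    then show ?thesis by (simp add: expand_U7 wedge_U7 psi0_def[symmetric] r_def)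
  qed
  ultimately show ?thesis using d by simp
qed

subsection \<open>Recovering the structure from its four-form\<close>

lemma oneform_coeff: "j \<in> U7 \<Longrightarrow> oneform v {j} = v j"
  by (simp add: oneform_def)

lemma kform_1_oneform:
  assumes "kform 1 \<alpha>" shows "\<alpha> = oneform (\<lambda>j. \<alpha> {j})"
proof
  fix K
  show "\<alpha> K = oneform (\<lambda>j. \<alpha> {j}) K"
  proof (cases "\<exists>j\<in>U7. K = {j}")
    case True
    then show ?thesis by (auto simp: oneform_coeff)
  next
    case False
    then have "\<alpha> K = 0" using assms unfolding kform_def by (metis One_nat_def card_1_singletonE insert_subset)
    then show ?thesis using False by (simp add: oneform_def)
  qed
qed

lemma expand_oneform:
  "expand P (oneform v) = oneform (\<lambda>j. \<Sum>k\<in>U7. v k * P k j)"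
proof -
  have "expand P (oneform v) = (\<lambda>K. \<Sum>k\<in>U7. v k * oneform (P k) K)"
    by (simp add: oneform_sum[of v] expand_sum expand_scale expand_lwedge wedge_oneform supported_emon) (simp
        only: oneform_sum)
  also have "\<dots> = oneform (\<lambda>j. \<Sum>k\<in>U7. v k * P k j)"
    by (rule ext) (simp add: oneform_def)
  finally show ?thesis .
qed

lemma expand_id:
  assumes "supported \<alpha>" "\<And>i j. i \<in> U7 \<Longrightarrow> j \<in> U7 \<Longrightarrow> P i j =
      (if i = j then 1 else 0)"
  shows "expand P \<alpha> = \<alpha>"
proof -
  have "expand P = expand (mat_diag (\<lambda>_. 1))" by (rule expand_cong) (simp add: assms(2) mat_diag_def)
  then show ?thesis using assms(1) by (simp add: expand_mat_diag)
qed

lemma fdet_id: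
  assumes "\<And>i j. i \<in> U7 \<Longrightarrow> j \<in> U7 \<Longrightarrow> P i j = (if i = j then 1 else 0)"
  shows "fdet P = 1"
proof -
  have "fdet P = fdet (mat_diag (\<lambda>_. 1))" by (rule fdet_cong) (simp add: assms mat_diag_def)
  then show ?thesis by (simp add: fdet_mat_diag)
qed

text \<open>The inverse transpose \<open>R\<close> of \<open>P\<close> is read off from the action of
    \<open>star0 \<circ> expand P \<circ> star0\<close> on
  one-forms.\<close>

lemma inverse_transpose:
  assumes d: "fdet P \<noteq> 0"
  obtains R where "\<And>i j. i \<in> U7 \<Longrightarrow> j \<in> U7 \<Longrightarrow> mat_mul R (mat_transp
      P) i j = (if i = j then 1 else 0)"
    "fdet R = 1 / fdet P"
    "\<And>\<alpha>. supported \<alpha> \<Longrightarrow> star0 (expand P (star0 \<alpha>)) = (\<lambda>K. fdet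
        P * expand R \<alpha> K)"
proof -
  \<comment> \<open>By Cramer's rule this is the preimage of e^i under
    \<open>expand (mat_transp P)\<close>; row \<open>i\<close> of \<open>R\<close> lists its
    coefficients.\<close>
  define \<gamma> where "\<gamma> i = (\<lambda>K. (1 / fdet P) * star0 (expand P (star0 (emon {i}))) K)" for i
  define R where "R i j = \<gamma> i {j}" for i j
  have k: "kform 1 (\<gamma> i)" if "i \<in> U7" for i
  proof -
    have "kform 1 (emon {i})" using that by (auto simp: kform_def emon_def)
    then have "kform (7 - (7 - 1)) (star0 (expand P (star0 (emon {i}))))"
      by (intro kform_star0 kform_expand)
    then show ?thesis unfolding \<gamma>_def by (intro kform_scale) simp
  qed
  have id: "mat_mul R (mat_transp P) i j = (if i = j then 1 else 0)" if "i \<in> U7" "j \<in> U7" for i j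
  proof -
    have "expand (mat_transp P) (\<gamma> i) = emon {i}"
      using d that unfolding \<gamma>_def
      by (subst expand_scale) (use expand_cofactor[of "emon {i}" "mat_transp P"] in \<open>simp add:
          fdet_mat_transp supported_emon\<close>)
    moreover have "R i = (\<lambda>j. \<gamma> i {j})" by (rule ext) (simp add: R_def)
    then have "\<gamma> i = oneform (R i)" using kform_1_oneform[OF k[OF that(1)]] by metis
    ultimately have "oneform (\<lambda>j. \<Sum>k\<in>U7. R i k * mat_transp P k j) = emon {i}" by (simp add:
        expand_oneform)
    then have "oneform (\<lambda>j. \<Sum>k\<in>U7. R i k * mat_transp P k j) {j} = emon {i} {j}" by simp
    then show ?thesis using that by (simp add: oneform_coeff mat_mul_def emon_def eq_commute)
  qed
  have "fdet R * fdet P = 1" using fdet_id[OF id] by (simp add: fdet_mat_mul fdet_mat_transp)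
  then have dR: "fdet R = 1 / fdet P" using d by (simp add: field_simps)
  have st: "star0 (expand P (star0 \<alpha>)) = (\<lambda>K. fdet P * expand R \<alpha> K)" if "supported
      \<alpha>" for \<alpha>
  proof -
    have "expand (mat_transp P) (expand R \<alpha>) = \<alpha>" using expand_id[OF that id] that by (simp add:
        expand_expand)
    then show ?thesis using cofactor_expand[OF supported_expand, of "mat_transp P" R \<alpha>] by (simp add:
        fdet_mat_transp)
  qed
  show ?thesis by (rule that[OF id dR st])
qed

lemma gram_form_scale: "gram_form (\<lambda>K. c * \<alpha> K) i j = c ^ 3 * gram_form \<alpha> i j"
  by (simp add: gram_form_def contract_scale wedge_scale_left wedge_scale_right power3_eq_cube)

text \<open>The volume factor, the three-form, the metric, the Hodge star and the scalar torsion of a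
  positive \<open>G2\<close> structure as explicit expressions in its four-form.\<close>

definition vol_of :: "form \<Rightarrow> real" where
  "vol_of \<psi> = root 12 (fdet (gram_form (star0 \<psi>)) / 6 ^ 7)"

definition phi_of :: "form \<Rightarrow> form" where
  "phi_of \<psi> = (\<lambda>K. vol_of \<psi> * star0 (expand (\<lambda>i j. gram_form (star0 \<psi>) i j / (6
      * (vol_of \<psi>)\<^sup>2)) \<psi>) K)"

definition hodge_of :: "form \<Rightarrow> form \<Rightarrow> form" where
  "hodge_of \<psi> \<alpha> = (\<lambda>K. expand (\<lambda>i j. gram_form (phi_of \<psi>) i j / (6 * vol_of
      \<psi>)) (star0 \<alpha>) K / vol_of \<psi>)"

definition tau0_of :: "form \<Rightarrow> real" where
  "tau0_of \<psi> = wedge (dform (phi_of \<psi>)) (phi_of \<psi>) U7 / (7 * vol_of \<psi>)"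

definition rhs_of :: "real \<Rightarrow> form \<Rightarrow> form" where
  "rhs_of A \<psi> = (\<lambda>K. dform (hodge_of \<psi> (dform (phi_of \<psi>))) K
     + 2 * dform (\<lambda>I. (A - 7 / 4 * tau0_of \<psi>) * phi_of \<psi> I) K)"

text \<open>The dual trivector \<open>star0 \<psi>\<close> is \<open>fdet P\<close> times the
  standard three-form in the frame \<open>R\<close>, the inverse transpose of \<open>P\<close>. The
  bilinear form is cubic, so it carries \<open>fdet P ^ 3 * fdet R\<close>, that is
  \<open>(fdet P)\<^sup>2\<close>. Seven rows give 14 powers and the inverse metric removes two,
  leaving 12. This exponent is even, so positivity of \<open>fdet P\<close> is what selects \<phi>
  over -\<phi>.\<close>

lemma
  assumes P: "G2frame \<phi> P" "fdet P > 0"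
  defines "\<psi> \<equiv> starphi \<phi> \<phi>"
  shows det_gram_form_frame: "fdet (gram_form (star0 \<psi>)) = 6 ^ 7 * fdet P ^ 12"
    and vol_of_frame: "vol_of \<psi> = fdet P"
    and phi_of_frame: "phi_of \<psi> = \<phi>"
proof -
  have d: "fdet P \<noteq> 0" using P by simp
  have psi: "\<psi> = expand P psi0" unfolding \<psi>_def by (rule starphi_phi[OF P(1)])
  obtain R where R: "\<And>i j. i \<in> U7 \<Longrightarrow> j \<in> U7 \<Longrightarrow> mat_mul R (mat_transp
      P) i j = (if i = j then 1 else 0)"
    "fdet R = 1 / fdet P"
    "\<And>\<alpha>. supported \<alpha> \<Longrightarrow> star0 (expand P (star0 \<alpha>)) = (\<lambda>K. fdet
        P * expand R \<alpha> K)"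
    using inverse_transpose[OF d] by metis
  have s: "star0 \<psi> = (\<lambda>K. fdet P * expand R phi0 K)"
    using R(3)[OF supported_phi0] by (simp add: psi psi0_def)
  have b: "gram_form (star0 \<psi>) i j = 6 * (fdet P)\<^sup>2 * gram R i j" if "i \<in> U7" "j \<in> U7" for i j
    using d that by (simp add: s gram_form_scale gram_form_expand_phi0 R(2) power3_eq_cube power2_eq_square)
  have "fdet (gram_form (star0 \<psi>)) = fdet (\<lambda>i j. 6 * (fdet P)\<^sup>2 * gram R i j)"
    by (rule fdet_cong) (simp add: b)
  also have "\<dots> = 6 ^ 7 * fdet P ^ 12"
    using d by (simp add: fdet_scale fdet_gram R(2) power_mult_distrib power_divide flip: power_mult)
      (simp add: field_simps flip: power_add)
  finally show 1: "fdet (gram_form (star0 \<psi>)) = 6 ^ 7 * fdet P ^ 12" .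
  then show 2: "vol_of \<psi> = fdet P" using P(2) by (simp add: vol_of_def real_root_power_cancel)
  have "expand (\<lambda>i j. gram_form (star0 \<psi>) i j / (6 * (vol_of \<psi>)\<^sup>2)) = expand (gram R)"
    by (rule expand_cong) (use d in \<open>simp add: b 2\<close>)
  \<comment> \<open>Raising indices: \<open>gram R\<close> factors through the transpose of
    \<open>R\<close>, which cancels \<open>P\<close>, and then through \<open>R\<close>.\<close>
  moreover have "expand (gram R) \<psi> = (\<lambda>K. (1 / fdet P) * star0 \<phi> K)"
  proof -
    have "expand (mat_mul P (mat_transp R)) psi0 = psi0"
    proof (rule expand_id[OF supported_psi0])
      fix i j assume "i \<in> U7" "j \<in> U7"
      then show "mat_mul P (mat_transp R) i j = (if i = j then 1 else 0)"
        using R(1)[of j i] by (simp add: mat_mul_def mat_transp_def mult.commute eq_commute)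
    qed
    then have "expand (gram R) \<psi> = expand R psi0"
      using expand_expand[of \<psi> R "mat_transp R"] by (simp add: gram_def psi expand_expand supported_psi0
          supported_expand)
    moreover have "star0 \<phi> = (\<lambda>K. fdet P * expand R psi0 K)"
      using R(3)[OF supported_psi0] by (simp add: star0_psi0 G2frameD(2)[OF P(1)])
    ultimately show ?thesis using d by simp
  qed
  ultimately show "phi_of \<psi> = \<phi>"
    using d supported_expand[of P phi0] star0_scale[of "1 / fdet P" "star0 \<phi>"]
    by (simp add: phi_of_def 2 star0_star0 G2frameD(2)[OF P(1)])
qed

lemma hodge_of_frame:
  assumes P: "G2frame \<phi> P" "fdet P > 0" and "supported \<alpha>"
  shows "hodge_of (starphi \<phi> \<phi>) \<alpha> = starphi \<phi> \<alpha>"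
proof -
  have d: "fdet P \<noteq> 0" using P by simp
  have "expand (\<lambda>i j. gram_form \<phi> i j / (6 * fdet P)) = expand (gram P)"
    by (rule expand_cong) (use d in \<open>simp add: G2frameD(2)[OF P(1)] gram_form_expand_phi0\<close>)
  then show ?thesis
    using assms d by (simp add: hodge_of_def vol_of_frame[OF P] phi_of_frame[OF P] starphi_frame hodge_gram)
qed

lemma starphi_kform:
  assumes "G2frame \<phi> P" "kform k \<alpha>"
  shows "kform (7 - k) (starphi \<phi> \<alpha>)"
proof -
  have "starphi \<phi> \<alpha> = (\<lambda>K. (1 / fdet P) * expand (gram P) (star0 \<alpha>) K)"
    using assms by (simp add: starphi_frame hodge_gram kform_supported G2frameD(1))
  then show ?thesis using assms(2) by (simp only: kform_scale kform_expand kform_star0)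
qed

lemma dform_lin: "dform (\<lambda>K. a * \<alpha> K + b * \<beta> K) = (\<lambda>K. a * dform \<alpha> K + b *
    dform \<beta> K)"
  by (simp add: dform_def algebra_simps sum.distrib sum_distrib_left)

lemma dform_scale: "dform (\<lambda>K. c * \<alpha> K) = (\<lambda>K. c * dform \<alpha> K)"
  by (simp add: dform_def sum_distrib_left mult.assoc)

lemma dform_zero: "dform (\<lambda>K. 0) = (\<lambda>K. 0)" by (simp add: dform_def)

lemma kform_dform:
  assumes "kform (Suc k) \<alpha>" shows "kform (Suc (Suc k)) (dform \<alpha>)"
  using kform_wedge[OF kform_de kform_contract[OF assms]] by (simp add: dform_eq kform_supported[OF assms])

text \<open>Closedness of \<psi> leaves only the term d d^* of the Laplacian, and d^* \<psi> is the
  star of d\<phi>. Everything is thereby a function of \<psi> alone, as uniqueness requires.\<close>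

lemma coflow_rhs_frame:
  assumes P: "G2frame \<phi> P" "fdet P > 0" and cl: "dform (starphi \<phi> \<phi>) = zeroform"
  shows "coflow_rhs A \<phi> = rhs_of A (starphi \<phi> \<phi>)"
proof -
  let ?s = "starphi \<phi>"
  have k3: "kform 3 \<phi>" using kform_expand[OF kform_phi0] G2frameD(2)[OF P(1)] by simp
  then have k4: "kform 4 (?s \<phi>)" using starphi_kform[OF P(1)] by fastforce
  have "?s (?s \<phi>) = \<phi>"
    using starphi_expand[OF P(1) supported_psi0] by (simp add: starphi_phi[OF P(1)] star0_psi0 G2frameD(2)[OF
        P(1), symmetric])
  then have c: "codiff \<phi> (?s \<phi>) K = (-1) ^ (card K + 1) * ?s (dform \<phi>) K" for K
    by (simp add: codiff_def)
  have kd: "kform 4 (dform \<phi>)" using kform_dform[of 2 \<phi>] k3 by (simp add: numeral_eq_Suc)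
  then have k3': "kform 3 (?s (dform \<phi>))" using starphi_kform[OF P(1) kd] by simp
  \<comment> \<open>\<open>codiff\<close> reads its sign off the output index set. All nonzero
    coefficients sit at sets of three elements, where the sign is plus.\<close>
  have c3: "codiff \<phi> (?s \<phi>) = ?s (dform \<phi>)"
  proof
    fix K
    show "codiff \<phi> (?s \<phi>) K = ?s (dform \<phi>) K"
      using k3' by (cases "?s (dform \<phi>) K = 0") (simp_all add: c kform_def)
  qed
  have z: "?s (\<lambda>K. 0) = (\<lambda>K. 0)"
    using starphi_frame[OF P(1), of "\<lambda>K. 0"] G2frameD(1)[OF P(1)]
    by (simp add: supported_def hodge_gram star0_zero expand_zero)
  have "codiff \<phi> (dform (?s \<phi>)) = (\<lambda>K. 0)"
    by (simp add: codiff_def cl zeroform_def z dform_zero)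
  then have "laplacian \<phi> (?s \<phi>) = dform (?s (dform \<phi>))"
    by (simp add: laplacian_def c3)
  moreover have "tau0_of (?s \<phi>) = tau0 \<phi>"
    by (simp add: tau0_of_def phi_of_frame[OF P] vol_of_frame[OF P] tau0_frame[OF P(1) cl])
  ultimately show ?thesis
    by (simp add: coflow_rhs_def rhs_of_def phi_of_frame[OF P] hodge_of_frame[OF P kform_supported[OF kd]]
        trace_torsion_def)
qed

subsection \<open>Uniqueness of the flow\<close>

text \<open>Ancient solutions are compared at negative times too, so the estimate runs in both
  directions from 0, with a decaying weight forward and a growing one backward.\<close>

lemma gronwall_zero:
  fixes S S' :: "real \<Rightarrow> real"
  assumes "a \<le> 0" "0 \<le> b" "0 \<le> L"
    and D: "\<And>t. t \<in> {a..b} \<Longrightarrow> (S has_real_derivative S' t) (at t)"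
    and B: "\<And>t. t \<in> {a..b} \<Longrightarrow> \<bar>S' t\<bar> \<le> L * S t"
    and pos: "\<And>t. t \<in> {a..b} \<Longrightarrow> 0 \<le> S t" and "S 0 = 0" and t: "t \<in> {a..b}"
  shows "S t = 0"
proof (cases "0 \<le> t")
  case True
  have "S t * exp (- L * t) \<le> S 0 * exp (- L * 0)"
  proof (rule DERIV_nonpos_imp_nonincreasing[OF True])
    fix x assume x: "0 \<le> x" "x \<le> t"
    then have i: "x \<in> {a..b}" using assms(1) t by auto
    have "((\<lambda>s. S s * exp (- L * s)) has_real_derivative (S' x - L * S x) * exp (- L * x)) (at x)"
      by (auto intro!: derivative_eq_intros D[OF i] simp: algebra_simps)
    moreover have "(S' x - L * S x) * exp (- L * x) \<le> 0"
      using B[OF i] by (intro mult_nonpos_nonneg) auto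
    ultimately show "\<exists>y. ((\<lambda>s. S s * exp (- L * s)) has_real_derivative y) (at x) \<and> y
        \<le> 0" by blast
  qed
  then show ?thesis using pos[OF t] assms by (simp add: mult_le_0_iff)
next
  case False
  have "S t * exp (L * t) \<le> S 0 * exp (L * 0)"
  proof (rule DERIV_nonneg_imp_nondecreasing[of t 0 "\<lambda>s. S s * exp (L * s)"])
    show "t \<le> 0" using False by simp
    fix x assume x: "t \<le> x" "x \<le> 0"
    then have i: "x \<in> {a..b}" using assms(2) t by auto
    have "((\<lambda>s. S s * exp (L * s)) has_real_derivative (S' x + L * S x) * exp (L * x)) (at x)"
      by (auto intro!: derivative_eq_intros D[OF i] simp: algebra_simps)
    moreover have "(S' x + L * S x) * exp (L * x) \<ge> 0"
      using B[OF i] by (intro mult_nonneg_nonneg) auto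
    ultimately show "\<exists>y. ((\<lambda>s. S s * exp (L * s)) has_real_derivative y) (at x) \<and> 0 \<le>
        y" by blast
  qed
  then show ?thesis using pos[OF t] assms by (simp add: mult_le_0_iff)
qed

text \<open>Every quantity in the flow equation is built from the four-form by operations preserving
  comparability, so no topology on the space of positive forms is needed.\<close>

definition comparable :: "real \<Rightarrow> real \<Rightarrow> (real \<Rightarrow> real) \<Rightarrow> (real
    \<Rightarrow> real) \<Rightarrow> (real \<Rightarrow> real) \<Rightarrow> bool" where
  "comparable a b N f g \<longleftrightarrow> continuous_on {a..b} f \<and> continuous_on {a..b} g \<and>
     (\<exists>C\<ge>0. \<forall>t\<in>{a..b}. \<bar>f t - g t\<bar> \<le> C * N t)"

definition comparable_form :: "real \<Rightarrow> real \<Rightarrow> (real \<Rightarrow> real) \<Rightarrow>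
    (real \<Rightarrow> form) \<Rightarrow> (real \<Rightarrow> form) \<Rightarrow> bool" where
  "comparable_form a b N F G \<longleftrightarrow> (\<forall>K. comparable a b N (\<lambda>t. F t K)
      (\<lambda>t. G t K))"

lemma bounded_on_interval:
  fixes f :: "real \<Rightarrow> real"
  assumes "continuous_on {a..b} f" obtains M where "M \<ge> 0" "\<And>t. t \<in> {a..b} \<Longrightarrow>
      \<bar>f t\<bar> \<le> M"
proof -
  have "bounded (f ` {a..b})" using assms by (intro compact_imp_bounded compact_continuous_image) auto
  then obtain M where "M > 0" "\<forall>x\<in>f ` {a..b}. norm x \<le> M" unfolding bounded_pos by blast
  then show ?thesis using that[of M] by auto
qed

context
  fixes a b :: real and N :: "real \<Rightarrow> real"
  assumes N: "\<And>t. N t \<ge> 0"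
begin

lemma comparable_const: "comparable a b N (\<lambda>_. c) (\<lambda>_. c)"
  using N by (auto simp: comparable_def)

lemma comparable_add:
  assumes "comparable a b N f g" "comparable a b N f' g'"
  shows "comparable a b N (\<lambda>t. f t + f' t) (\<lambda>t. g t + g' t)"
proof -
  obtain C C' where C: "C \<ge> 0" "C' \<ge> 0" "\<And>t. t \<in> {a..b} \<Longrightarrow> \<bar>f t - g
      t\<bar> \<le> C * N t"
    "\<And>t. t \<in> {a..b} \<Longrightarrow> \<bar>f' t - g' t\<bar> \<le> C' * N t"
    using assms unfolding comparable_def by blast
  have "\<bar>f t + f' t - (g t + g' t)\<bar> \<le> (C + C') * N t" if "t \<in> {a..b}" for t
    using C(3,4)[OF that] by (auto simp: algebra_simps)
  then show ?thesis using assms C(1,2) unfolding comparable_def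
    by (auto intro!: continuous_on_add exI[of _ "C + C'"])
qed

text \<open>Write the difference as \<open>(f - g) * f' + g * (f' - g')\<close>; continuity on a
  compact interval bounds the two undifferenced factors. This is why continuity is part of
  \<open>comparable\<close>.\<close>

lemma comparable_mult:
  assumes "comparable a b N f g" "comparable a b N f' g'"
  shows "comparable a b N (\<lambda>t. f t * f' t) (\<lambda>t. g t * g' t)"
proof -
  obtain C C' where C: "C \<ge> 0" "C' \<ge> 0" "\<And>t. t \<in> {a..b} \<Longrightarrow> \<bar>f t - g
      t\<bar> \<le> C * N t"
    "\<And>t. t \<in> {a..b} \<Longrightarrow> \<bar>f' t - g' t\<bar> \<le> C' * N t"
    using assms unfolding comparable_def by blast
  obtain M where M: "M \<ge> 0" "\<And>t. t \<in> {a..b} \<Longrightarrow> \<bar>f' t\<bar> \<le> M"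
    using assms(2) bounded_on_interval unfolding comparable_def by metis
  obtain M' where M': "M' \<ge> 0" "\<And>t. t \<in> {a..b} \<Longrightarrow> \<bar>g t\<bar> \<le> M'"
    using assms(1) bounded_on_interval unfolding comparable_def by metis
  have "\<bar>f t * f' t - g t * g' t\<bar> \<le> (C * M + M' * C') * N t" if t: "t \<in> {a..b}" for t
  proof -
    have "f t * f' t - g t * g' t = (f t - g t) * f' t + g t * (f' t - g' t)" by (simp add: algebra_simps)
    then have "\<bar>f t * f' t - g t * g' t\<bar> \<le> \<bar>f t - g t\<bar> * \<bar>f' t\<bar> + \<bar>g
        t\<bar> * \<bar>f' t - g' t\<bar>"
      by (metis abs_mult abs_triangle_ineq)
    also have "\<dots> \<le> (C * N t) * M + M' * (C' * N t)"
      using C M M' N t by (intro add_mono mult_mono) auto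
    finally show ?thesis by (simp add: algebra_simps)
  qed
  then show ?thesis using assms C(1,2) M(1) M'(1) unfolding comparable_def
    by (auto intro!: continuous_on_mult exI[of _ "C * M + M' * C'"])
qed

lemma comparable_sum:
  assumes "\<And>i. i \<in> S \<Longrightarrow> comparable a b N (f i) (g i)"
  shows "comparable a b N (\<lambda>t. \<Sum>i\<in>S. f i t) (\<lambda>t. \<Sum>i\<in>S. g i t)"
  using assms by (induction S rule: infinite_finite_induct) (auto intro: comparable_const comparable_add)

text \<open>The values of both functions lie in some interval from \<open>m > 0\<close> to
  \<open>M\<close>, on which \<open>h'\<close> is bounded. The mean value theorem is applied on this
  interval, since the union of the two images need not be convex.\<close>

lemma comparable_compose:
  assumes fg: "comparable a b N f g" and p: "\<And>t. t \<in> {a..b} \<Longrightarrow> f t > 0 \<and> g t > 0"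
    and D: "\<And>x::real. x > 0 \<Longrightarrow> (h has_real_derivative h' x) (at x)" and c: "continuous_on
        {0<..} h'"
  shows "comparable a b N (\<lambda>t. h (f t)) (\<lambda>t. h (g t))"
proof (cases "a \<le> b")
  case False
  then show ?thesis using N by (auto simp: comparable_def)
next
  case True
  have cf: "continuous_on {a..b} f" "continuous_on {a..b} g" using fg by (auto simp: comparable_def)
  obtain C where C: "C \<ge> 0" "\<And>t. t \<in> {a..b} \<Longrightarrow> \<bar>f t - g t\<bar> \<le> C * N t"
    using fg unfolding comparable_def by blast
  let ?S = "f ` {a..b} \<union> g ` {a..b}"
  have cS: "compact ?S" "?S \<noteq> {}" using cf True by (auto intro!: compact_Un compact_continuous_image)
  obtain m where m: "m \<in> ?S" "\<forall>x\<in>?S. m \<le> x" using compact_attains_inf[OF cS] by blast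
  obtain M where M: "M \<in> ?S" "\<forall>x\<in>?S. x \<le> M" using compact_attains_sup[OF cS] by blast
  have m0: "m > 0" using m(1) p by auto
  have "continuous_on {m..M} h'" using c m0 by (auto elim: continuous_on_subset)
  then obtain B where B: "B \<ge> 0" "\<And>x. x \<in> {m..M} \<Longrightarrow> \<bar>h' x\<bar> \<le> B" using
      bounded_on_interval by metis
  have L: "\<bar>h y - h x\<bar> \<le> B * \<bar>y - x\<bar>" if "x \<in> ?S" "y \<in> ?S" "x < y" for x y
  proof -
    have xy: "m \<le> x" "y \<le> M" using m(2) M(2) that by blast+
    have "\<exists>z. z > x \<and> z < y \<and> h y - h x = (y - x) * h' z"
      by (rule MVT2[OF that(3)], rule D) (use xy m0 in linarith)
    then obtain z where z: "x < z" "z < y" "h y - h x = (y - x) * h' z" by blast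
    have "\<bar>h' z\<bar> \<le> B" using z xy by (intro B) auto
    then have "\<bar>h' z\<bar> * \<bar>y - x\<bar> \<le> B * \<bar>y - x\<bar>" by (rule mult_right_mono) simp
    then show ?thesis by (simp add: z(3) abs_mult mult.commute)
  qed
  have "\<bar>h (f t) - h (g t)\<bar> \<le> (B * C) * N t" if t: "t \<in> {a..b}" for t
  proof -
    have "f t \<in> ?S" "g t \<in> ?S" using t by auto
    then have "\<bar>h (f t) - h (g t)\<bar> \<le> B * \<bar>f t - g t\<bar>"
      using L[of "f t" "g t"] L[of "g t" "f t"] by (cases "f t" "g t" rule: linorder_cases) (auto simp:
          abs_minus_commute)
    also have "\<dots> \<le> B * (C * N t)" using B C(2)[OF t] by (intro mult_left_mono) auto
    finally show ?thesis by simp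
  qed
  moreover have ch: "continuous_on {0<..} h"
    using D by (intro continuous_at_imp_continuous_on) (auto intro: DERIV_isCont)
  have "continuous_on {a..b} (\<lambda>t. h (f t))" "continuous_on {a..b} (\<lambda>t. h (g t))"
    by (rule continuous_on_compose2[OF ch]; use cf p in force)+
  ultimately show ?thesis using B(1) C(1) unfolding comparable_def by (auto intro!: exI[of _ "B * C"])
qed

lemma comparable_root:
  assumes "comparable a b N f g" "\<And>t. t \<in> {a..b} \<Longrightarrow> f t > 0 \<and> g t > 0" "n > 0"
  shows "comparable a b N (\<lambda>t. root n (f t)) (\<lambda>t. root n (g t))"
proof (rule comparable_compose[OF assms(1,2)])
  fix x :: real assume "x > 0"
  then show "(root n has_real_derivative inverse (real n * root n x ^ (n - Suc 0))) (at x)"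
    using assms(3) by (rule DERIV_real_root[rotated])
next
  show "continuous_on {0<..} (\<lambda>x. inverse (real n * root n x ^ (n - Suc 0)))"
    using assms(3) by (intro continuous_intros) auto
qed

lemma comparable_divide:
  assumes "comparable a b N f g" "comparable a b N f' g'" "\<And>t. t \<in> {a..b} \<Longrightarrow> f' t > 0
      \<and> g' t > 0"
  shows "comparable a b N (\<lambda>t. f t / f' t) (\<lambda>t. g t / g' t)"
proof -
  have "comparable a b N (\<lambda>t. inverse (f' t)) (\<lambda>t. inverse (g' t))"
  proof (rule comparable_compose[OF assms(2,3)])
    fix x :: real assume "x > 0"
    then show "(inverse has_real_derivative - (inverse x ^ Suc (Suc 0))) (at x)"
      by (intro DERIV_inverse) auto
  qed (auto intro!: continuous_intros)
  then show ?thesis using comparable_mult[OF assms(1)] by (simp add: divide_inverse)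
qed

lemma comparable_if: "(P \<Longrightarrow> comparable a b N f g) \<Longrightarrow> (\<not> P \<Longrightarrow>
    comparable a b N f' g') \<Longrightarrow>
   comparable a b N (\<lambda>t. if P then f t else f' t) (\<lambda>t. if P then g t else g' t)"
  by (cases P) auto

lemma comparable_formD: "comparable_form a b N F G \<Longrightarrow> comparable a b N (\<lambda>t. F t K)
    (\<lambda>t. G t K)"
  by (simp add: comparable_form_def)

lemma comparable_form_const: "comparable_form a b N (\<lambda>_. \<alpha>) (\<lambda>_. \<alpha>)"
  by (simp add: comparable_form_def comparable_const)

lemma comparable_form_scale: "comparable a b N f g \<Longrightarrow> comparable_form a b N F G
    \<Longrightarrow> comparable_form a b N (\<lambda>t K. f t * F t K) (\<lambda>t K. g t * G t K)"
  by (simp add: comparable_form_def comparable_mult)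

lemma comparable_form_wedge:
  "comparable_form a b N F G \<Longrightarrow> comparable_form a b N F' G' \<Longrightarrow> comparable_form a
      b N (\<lambda>t. wedge (F t) (F' t)) (\<lambda>t. wedge (G t) (G' t))"
  unfolding comparable_form_def wedge_def by (auto intro!: comparable_if comparable_const comparable_sum
      comparable_mult)

lemma comparable_form_star0: "comparable_form a b N F G \<Longrightarrow> comparable_form a b N (\<lambda>t.
    star0 (F t)) (\<lambda>t. star0 (G t))"
  unfolding comparable_form_def star0_def by (auto intro!: comparable_if comparable_const comparable_mult)

lemma comparable_form_contract: "comparable_form a b N F G \<Longrightarrow> comparable_form a b N (\<lambda>t.
    contract i (F t)) (\<lambda>t. contract i (G t))"
  unfolding comparable_form_def contract_def by (auto intro!: comparable_if comparable_const comparable_mult)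

lemma comparable_form_dform: "comparable_form a b N F G \<Longrightarrow> comparable_form a b N (\<lambda>t.
    dform (F t)) (\<lambda>t. dform (G t))"
  unfolding comparable_form_def dform_def by (auto intro!: comparable_const comparable_sum comparable_mult)

lemma comparable_form_xmon:
  assumes "\<And>i j. comparable a b N (\<lambda>t. P t i j) (\<lambda>t. Q t i j)"
  shows "comparable_form a b N (\<lambda>t. xmon (P t) I) (\<lambda>t. xmon (Q t) I)"
proof -
  have o: "comparable_form a b N (\<lambda>t. oneform (P t i)) (\<lambda>t. oneform (Q t i))" for i
    unfolding comparable_form_def oneform_def using assms by (auto intro!: comparable_if comparable_const)
  have "comparable_form a b N (\<lambda>t. foldr wedge (map (\<lambda>i. oneform (P t i)) xs) (emon {}))
     (\<lambda>t. foldr wedge (map (\<lambda>i. oneform (Q t i)) xs) (emon {}))" for xs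
    by (induction xs) (simp_all add: comparable_form_const comparable_form_wedge o)
  then show ?thesis by (simp add: xmon_def)
qed

lemma comparable_form_expand:
  assumes "\<And>i j. comparable a b N (\<lambda>t. P t i j) (\<lambda>t. Q t i j)" "comparable_form a b N F G"
  shows "comparable_form a b N (\<lambda>t. expand (P t) (F t)) (\<lambda>t. expand (Q t) (G t))"
  unfolding comparable_form_def expand_def
  using assms(2) comparable_formD[OF comparable_form_xmon[OF assms(1)]] by (auto intro!: comparable_sum
      comparable_mult simp: comparable_form_def)

lemma comparable_fdet:
  assumes "\<And>i j. comparable a b N (\<lambda>t. P t i j) (\<lambda>t. Q t i j)"
  shows "comparable a b N (\<lambda>t. fdet (P t)) (\<lambda>t. fdet (Q t))"
  unfolding fdet_def using comparable_form_xmon[OF assms] by (rule comparable_formD)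

lemma comparable_gram_form:
  assumes "comparable_form a b N F G"
  shows "comparable a b N (\<lambda>t. gram_form (F t) i j) (\<lambda>t. gram_form (G t) i j)"
  unfolding gram_form_def using assms by (intro comparable_formD comparable_form_wedge comparable_form_contract)

text \<open>The positive determinant keeps the twelfth root and the divisions away from their
  singularity at 0; all other operations are sums and products.\<close>

lemma comparable_form_rhs_of:
  assumes "comparable_form a b N F G" and p: "\<And>t. t \<in> {a..b} \<Longrightarrow> fdet (gram_form (star0
      (F t))) > 0 \<and> fdet (gram_form (star0 (G t))) > 0"
  shows "comparable_form a b N (\<lambda>t. rhs_of A (F t)) (\<lambda>t. rhs_of A (G t))"
proof -
  note b = comparable_gram_form[OF comparable_form_star0[OF assms(1)]]
  have v: "comparable a b N (\<lambda>t. vol_of (F t)) (\<lambda>t. vol_of (G t))"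
    unfolding vol_of_def using p by (intro comparable_root comparable_divide comparable_fdet b comparable_const) auto
  have vp: "vol_of (F t) > 0 \<and> vol_of (G t) > 0" if "t \<in> {a..b}" for t
    using p[OF that] by (simp add: vol_of_def)
  have c: "comparable a b N (\<lambda>t. c * vol_of (F t)) (\<lambda>t. c * vol_of (G t))" for c
    by (intro comparable_mult comparable_const v)
  have ph: "comparable_form a b N (\<lambda>t. phi_of (F t)) (\<lambda>t. phi_of (G t))"
    unfolding phi_of_def power2_eq_square using vp
    by (intro comparable_form_scale v comparable_form_star0 comparable_form_expand comparable_divide b assms
        comparable_mult comparable_const) auto
  have h: "comparable_form a b N (\<lambda>t. hodge_of (F t) (F' t)) (\<lambda>t. hodge_of (G t) (G' t))" if
      "comparable_form a b N F' G'" for F' G'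
    unfolding hodge_of_def comparable_form_def using vp that
    by (auto intro!: comparable_divide comparable_formD[OF comparable_form_expand] comparable_gram_form ph c v
        comparable_form_star0)
  have t: "comparable a b N (\<lambda>t. tau0_of (F t)) (\<lambda>t. tau0_of (G t))"
    unfolding tau0_of_def using vp
    by (intro comparable_divide comparable_formD comparable_form_wedge comparable_form_dform ph c) auto
  have d: "comparable a b N (\<lambda>t. A - 7 / 4 * tau0_of (F t)) (\<lambda>t. A - 7 / 4 * tau0_of (G t))"
    using comparable_add[OF comparable_const[of A] comparable_mult[OF comparable_const[of "- (7 / 4)"] t]] by simp
  show ?thesis unfolding rhs_of_def comparable_form_def
    by (intro allI comparable_add comparable_mult comparable_const comparable_formD[OF comparable_form_dform] h
        comparable_form_dform ph comparable_form_scale d)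
qed

end

text \<open>From here on a solution is a curve of four-forms obeying an autonomous equation; frames
  and three-forms no longer occur.\<close>

lemma coflow_solutionD:
  assumes "coflow_solution A J \<phi>" "t \<in> J"
  defines "\<psi> \<equiv> \<lambda>s. starphi (\<phi> s) (\<phi> s)"
  shows "supported (\<psi> t)" "fdet (gram_form (star0 (\<psi> t))) > 0"
    "((\<lambda>s. \<psi> s K) has_real_derivative rhs_of A (\<psi> t) K) (at t)"
proof -
  obtain P where P: "G2frame (\<phi> t) P" "fdet P > 0"
    using assms unfolding coflow_solution_def pos_G2_def by (auto simp flip: fdet_def)
  show "supported (\<psi> t)" unfolding \<psi>_def starphi_phi[OF P(1)] by (rule supported_expand)
  show "fdet (gram_form (star0 (\<psi> t))) > 0" using det_gram_form_frame[OF P] P(2) by (simp add: \<psi>_def)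
  have "dform (starphi (\<phi> t) (\<phi> t)) = zeroform" using assms unfolding coflow_solution_def by blast
  then show "((\<lambda>s. \<psi> s K) has_real_derivative rhs_of A (\<psi> t) K) (at t)"
    using assms(1,2) coflow_rhs_frame[OF P, of A] unfolding coflow_solution_def \<psi>_def by metis
qed

lemma coflow_unique:
  assumes s1: "coflow_solution A J1 \<phi>1" and s2: "coflow_solution A J2 \<phi>2" and t: "t \<in> J1" "t \<in> J2"
  shows "starphi (\<phi>1 t) (\<phi>1 t) = starphi (\<phi>2 t) (\<phi>2 t)"
proof -
  define F where "F s = starphi (\<phi>1 s) (\<phi>1 s)" for s
  define G where "G s = starphi (\<phi>2 s) (\<phi>2 s)" for s
  define a where "a = min 0 t"
  define b where "b = max 0 t"
  have ab: "a \<le> 0" "0 \<le> b" "t \<in> {a..b}" "0 \<in> {a..b}" by (auto simp: a_def b_def)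
  have J: "s \<in> J1 \<and> s \<in> J2" if "s \<in> {a..b}" for s
  proof -
    have i: "is_interval J1" "0 \<in> J1" "is_interval J2" "0 \<in> J2" using s1 s2 by (auto simp:
        coflow_solution_def)
    have "0 \<le> s \<and> s \<le> t \<or> t \<le> s \<and> s \<le> 0" using that unfolding a_def b_def by
        (cases "0 \<le> t") auto
    then consider "0 \<le> s" "s \<le> t" | "t \<le> s" "s \<le> 0" by blast
    then show ?thesis
    proof cases
      case 1
      then show ?thesis using i t mem_is_interval_1_I[of J1 0 t s] mem_is_interval_1_I[of J2 0 t s] by blast
    next
      case 2
      then show ?thesis using i t mem_is_interval_1_I[of J1 t 0 s] mem_is_interval_1_I[of J2 t 0 s] by blast
    qed
  qed
  note F = coflow_solutionD[OF s1, folded F_def] and G = coflow_solutionD[OF s2, folded G_def]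
  \<comment> \<open>The sum of absolute values bounds each single coefficient but is not
    differentiable; the sum of squares is, and the Cauchy-Schwarz inequality relates the
    two.\<close>
  define N where "N s = (\<Sum>K\<in>Pow U7. \<bar>F s K - G s K\<bar>)" for s
  define S where "S s = (\<Sum>K\<in>Pow U7. (F s K - G s K)\<^sup>2)" for s
  have N: "N s \<ge> 0" for s by (simp add: N_def sum_nonneg)
  have cont: "continuous_on {a..b} (\<lambda>s. F s K)" "continuous_on {a..b} (\<lambda>s. G s K)" for K
    using J by (auto intro!: continuous_at_imp_continuous_on DERIV_isCont[OF F(3)] DERIV_isCont[OF G(3)])
  have "\<bar>F s K - G s K\<bar> \<le> 1 * N s" if "s \<in> {a..b}" for s K
  proof (cases "K \<subseteq> U7")
    case True
    then show ?thesis unfolding N_def using member_le_sum[of K "Pow U7" "\<lambda>K. \<bar>F s K - G s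
        K\<bar>"] by simp
  next
    case False
    then show ?thesis using F(1) G(1) J[OF that] N[of s] by (simp add: supported_def)
  qed
  then have "comparable_form a b N F G" unfolding comparable_form_def comparable_def using cont by (metis zero_le_one)
  then have "comparable_form a b N (\<lambda>s. rhs_of A (F s)) (\<lambda>s. rhs_of A (G s))"
    using N F(2) G(2) J by (intro comparable_form_rhs_of) auto
  then have "\<forall>K. \<exists>C\<ge>0. \<forall>s\<in>{a..b}. \<bar>rhs_of A (F s) K - rhs_of A (G s)
      K\<bar> \<le> C * N s"
    unfolding comparable_form_def comparable_def by blast
  then obtain C where C: "\<And>K. C K \<ge> 0" "\<And>K s. s \<in> {a..b} \<Longrightarrow> \<bar>rhs_of A (F
      s) K - rhs_of A (G s) K\<bar> \<le> C K * N s"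
    by metis
  define M where "M = (\<Sum>K\<in>Pow U7. C K)"
  have M: "M \<ge> 0" "\<And>K. K \<in> Pow U7 \<Longrightarrow> C K \<le> M"
    unfolding M_def by (auto intro!: sum_nonneg member_le_sum C(1))
  define S' where "S' s = (\<Sum>K\<in>Pow U7. 2 * (F s K - G s K) * (rhs_of A (F s) K - rhs_of A (G s) K))" for s
  \<comment> \<open>In the Gronwall constant, 2 comes from differentiating squares and 128 is the
    number of subsets of \<open>U7\<close>.\<close>
  have "S t = 0"
  proof (rule gronwall_zero[of a b "2 * M * 128" S S' t])
    fix s assume s: "s \<in> {a..b}"
    show "(S has_real_derivative S' s) (at s)"
      unfolding S_def[abs_def] S'_def using J[OF s]
      by (auto intro!: derivative_eq_intros F(3) G(3) simp: algebra_simps)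
    show "0 \<le> S s" by (simp add: S_def sum_nonneg)
    have "\<bar>S' s\<bar> \<le> (\<Sum>K\<in>Pow U7. \<bar>2 * (F s K - G s K) * (rhs_of A (F s) K - rhs_of A
        (G s) K)\<bar>)"
      unfolding S'_def by (rule sum_abs)
    also have "\<dots> \<le> (\<Sum>K\<in>Pow U7. 2 * \<bar>F s K - G s K\<bar> * (M * N s))"
    proof (rule sum_mono)
      fix K assume K: "K \<in> Pow U7"
      have "\<bar>rhs_of A (F s) K - rhs_of A (G s) K\<bar> \<le> M * N s"
        using C(2)[OF s, of K] mult_right_mono[OF M(2)[OF K] N[of s]] by linarith
      then show "\<bar>2 * (F s K - G s K) * (rhs_of A (F s) K - rhs_of A (G s) K)\<bar> \<le> 2 * \<bar>F s K
          - G s K\<bar> * (M * N s)"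
        unfolding abs_mult by (intro mult_mono) auto
    qed
    also have "\<dots> = 2 * M * (N s)\<^sup>2"
      unfolding sum_distrib_right[symmetric] sum_distrib_left[symmetric] N_def[symmetric]
      by (simp add: power2_eq_square)
    also have "\<dots> \<le> 2 * M * (S s * 128)"
    proof (rule mult_left_mono)
      have "(N s)\<^sup>2 \<le> (\<Sum>K\<in>Pow U7. \<bar>F s K - G s K\<bar>\<^sup>2) * card (Pow U7)"
        unfolding N_def by (rule sum_squared_le_sum_of_squares)
      then show "(N s)\<^sup>2 \<le> S s * 128" by (simp add: S_def card_Pow)
    qed (use M in simp)
    finally show "\<bar>S' s\<bar> \<le> 2 * M * 128 * S s" by (simp add: mult_ac)
  next
    have "F 0 = G 0" using s1 s2 unfolding coflow_solution_def F_def G_def by simp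
    then show "S 0 = 0" by (simp add: S_def)
  qed (use ab M in auto)
  then have "\<forall>K\<in>Pow U7. (F t K - G t K)\<^sup>2 = 0"
    unfolding S_def by (subst (asm) sum_nonneg_eq_0_iff) auto
  then have "F t K = G t K" for K
    using F(1)[OF t(1)] G(1)[OF t(2)] by (cases "K \<subseteq> U7") (auto simp: supported_def)
  then show ?thesis by (auto simp: F_def G_def)
qed

subsection \<open>The ansatz\<close>

text \<open>With \<omega> for this two-form, \<open>phi_vert\<close> is \<omega> wedge e^7, and
  \<open>phi_hor\<close> is the real part of the complex volume form (e^1 + i e^2)(e^3 + i e^4)(e^5
  + i e^6).\<close>

definition omega_list :: lform where "omega_list = [(1,[1,2]),(1,[3,4]),(1,[5,6])]"
definition phi_vert :: lform where "phi_vert = [(1,[1,2,7]),(1,[3,4,7]),(1,[5,6,7])]"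
definition phi_hor :: lform where "phi_hor = [(1,[1,3,5]),(-1,[1,4,6]),(-1,[2,3,6]),(-1,[2,4,5])]"

lemma wf_list_lists: "wf_list omega_list" "wf_list phi_vert" "wf_list phi_hor" "wf_list (star_list phi_vert)"
    "wf_list (star_list phi_hor)"
proof -
  show "wf_list omega_list" "wf_list phi_vert" "wf_list phi_hor" by (auto simp: omega_list_def phi_vert_def
      phi_hor_def increasing_def U7_def)
qed (rule wf_list_star_list)+

text \<open>Behind the computation: \<open>phi_hor\<close> and the dual of \<open>phi_vert\<close>
  do not contain e^7; contracting the dual of \<open>phi_hor\<close> gives, up to sign, the
  imaginary part of the complex volume form, whose product with \<omega> vanishes by type; and
  \<omega> wedge \<omega> is twice the dual of \<open>phi_vert\<close>.\<close>

lemma ansatz_checks: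
  "zero_list (wedge_list omega_list (contract_list 7 phi_hor))" "zero_list (wedge_list omega_list
      (contract_list 7 (star_list phi_vert)))" "zero_list (wedge_list omega_list (contract_list 7 (star_list
      phi_hor)))"
  "zero_list (wedge_list omega_list (contract_list 7 phi_vert) @ map (\<lambda>q. (- 2 * fst q, snd q))
      (star_list phi_vert))"
  "coeff_list indices (wedge_list (star_list phi_vert) phi_vert) = 3" "coeff_list indices (wedge_list
      (star_list phi_vert) phi_hor) = 0"
  by code_simp+

lemma de7_form_of_list: "de 7 = (\<lambda>K. sqrt 6 / 6 * form_of_list omega_list K)"
  by (rule ext) (simp add: de_def omega_list_def form_of_list_def)

lemma dform_form_of_list: "wf_list xs \<Longrightarrow> dform (form_of_list xs) = (\<lambda>K. sqrt 6 / 6 *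
    form_of_list (wedge_list omega_list (contract_list 7 xs)) K)"
  using wf_list_lists(1)
  by (simp add: dform_eq supported_form_of_list de7_form_of_list wedge_scale_left form_of_list_wedge_list
      wf_list_contract_list form_of_list_contract_list U7_def
      del: times_divide_eq_left)

lemma dform_ansatz:
  "dform (form_of_list phi_vert) = (\<lambda>K. sqrt 6 / 3 * star0 (form_of_list phi_vert) K)" "dform
      (form_of_list phi_hor) = (\<lambda>K. 0)"
  "dform (star0 (form_of_list phi_vert)) = (\<lambda>K. 0)" "dform (star0 (form_of_list phi_hor)) = (\<lambda>K. 0)"
proof -
  note w = wf_list_wedge_list[OF wf_list_lists(1) wf_list_contract_list]
  have "wf_list (map (\<lambda>q. (- 2 * fst q, snd q)) (star_list phi_vert))" using wf_list_lists(4) by (simp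
      add: wf_list_def)
  then have "form_of_list (wedge_list omega_list (contract_list 7 phi_vert) @ map (\<lambda>q. (- 2 * fst q,
      snd q)) (star_list phi_vert)) = (\<lambda>K. 0)"
    using ansatz_checks(4) w[OF wf_list_lists(2)] by (intro form_of_list_zero) simp_all
  then have "form_of_list (wedge_list omega_list (contract_list 7 phi_vert)) K = 2 * star0 (form_of_list
      phi_vert) K" for K
    unfolding form_of_list_append form_of_list_scale form_of_list_star_list[OF wf_list_lists(2)] by (drule_tac
        fun_cong[of _ _ K]) simp
  then show "dform (form_of_list phi_vert) = (\<lambda>K. sqrt 6 / 3 * star0 (form_of_list phi_vert) K)"
    by (simp add: dform_form_of_list wf_list_lists mult.commute)
  show "dform (form_of_list phi_hor) = (\<lambda>K. 0)"
    using form_of_list_zero[OF w[OF wf_list_lists(3)] ansatz_checks(1)] by (simp add: dform_form_of_list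
        wf_list_lists)
  show "dform (star0 (form_of_list phi_vert)) = (\<lambda>K. 0)"
    using form_of_list_zero[OF w[OF wf_list_lists(4)] ansatz_checks(2)]
    by (simp add: dform_form_of_list wf_list_lists flip: form_of_list_star_list[OF wf_list_lists(2)])
  show "dform (star0 (form_of_list phi_hor)) = (\<lambda>K. 0)"
    using form_of_list_zero[OF w[OF wf_list_lists(5)] ansatz_checks(3)]
    by (simp add: dform_form_of_list wf_list_lists flip: form_of_list_star_list[OF wf_list_lists(3)])
qed

lemma wedge_ansatz: "wedge (star0 (form_of_list phi_vert)) (form_of_list phi_vert) U7 = 3" "wedge (star0
    (form_of_list phi_vert)) (form_of_list phi_hor) U7 = 0"
  using form_of_list_U7[OF wf_list_wedge_list[OF wf_list_lists(4,2)]] form_of_list_U7[OF wf_list_wedge_list[OF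
      wf_list_lists(4,3)]] ansatz_checks(5,6)
  by (simp_all add: form_of_list_wedge_list wf_list_lists form_of_list_star_list)

lemma phi_y_form_of_list: "phi_y y = (\<lambda>K. 1 / y * form_of_list phi_vert K + y ^ 3 * form_of_list phi_hor K)"
  by (rule ext) (simp add: phi_y_def phi_vert_def phi_hor_def form_of_list_def algebra_simps)

lemma phi0_form_of_list: "phi0 = (\<lambda>K. 1 * form_of_list phi_vert K + 1 * form_of_list phi_hor K)"
  by (rule ext) (simp add: phi0_def phi_vert_def phi_hor_def form_of_list_def)

text \<open>With these weights \<open>phi_vert\<close> scales by 1/y and \<open>phi_hor\<close> by
  y^3. The dual of \<open>phi_hor\<close> scales by y^3 * y^-3 = 1, so in \<psi> only the
  coefficient y^4 of the dual of \<open>phi_vert\<close> evolves.\<close>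

definition ansatz_frame :: "real \<Rightarrow> nat \<Rightarrow> real" where
  "ansatz_frame y = (\<lambda>i. if i = 7 then 1 / y ^ 3 else y)"

lemma expand_mat_diag_form_of_list:
  assumes "wf_list xs" "\<And>p. p \<in> set xs \<Longrightarrow> prod f (set (snd p)) = c"
  shows "expand (mat_diag f) (form_of_list xs) = (\<lambda>K. c * form_of_list xs K)"
proof -
  have "prod f K * form_of_list xs K = c * form_of_list xs K" for K
    using assms(2) by (induction xs) (auto simp: form_of_list_Cons emon_def algebra_simps)
  then show ?thesis unfolding expand_mat_diag[OF supported_form_of_list[OF assms(1)]] by blast
qed

lemma star_list_ansatz: "set (star_list phi_vert) \<subseteq> UNIV \<times> {[3,4,5,6],[1,2,5,6],[1,2,3,4]}"
  "set (star_list phi_hor) \<subseteq> UNIV \<times> {[2,4,6,7],[2,3,5,7],[1,4,5,7],[1,3,6,7]}"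
  by (auto simp: phi_vert_def phi_hor_def compl_list_def)

lemma expand_ansatz:
  assumes "y > 0"
  shows "expand (mat_diag (ansatz_frame y)) (form_of_list phi_vert) = (\<lambda>K. 1 / y * form_of_list phi_vert K)"
    "expand (mat_diag (ansatz_frame y)) (form_of_list phi_hor) = (\<lambda>K. y ^ 3 * form_of_list phi_hor K)"
    "expand (mat_diag (ansatz_frame y)) (star0 (form_of_list phi_vert)) = (\<lambda>K. y ^ 4 * star0
        (form_of_list phi_vert) K)"
    "expand (mat_diag (ansatz_frame y)) (star0 (form_of_list phi_hor)) = star0 (form_of_list phi_hor)"
proof -
  show "expand (mat_diag (ansatz_frame y)) (form_of_list phi_vert) = (\<lambda>K. 1 / y * form_of_list phi_vert K)"
    by (rule expand_mat_diag_form_of_list[OF wf_list_lists(2)]) (use assms in \<open>auto simp: phi_vert_def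
        ansatz_frame_def power3_eq_cube field_simps\<close>)
  show "expand (mat_diag (ansatz_frame y)) (form_of_list phi_hor) = (\<lambda>K. y ^ 3 * form_of_list phi_hor K)"
    by (rule expand_mat_diag_form_of_list[OF wf_list_lists(3)]) (auto simp: phi_hor_def ansatz_frame_def
        power3_eq_cube)
  have "expand (mat_diag (ansatz_frame y)) (form_of_list (star_list phi_vert)) = (\<lambda>K. y ^ 4 *
      form_of_list (star_list phi_vert) K)"
    by (rule expand_mat_diag_form_of_list[OF wf_list_lists(4)]) (use star_list_ansatz(1) in \<open>auto simp:
        ansatz_frame_def power4_eq_xxxx\<close>)
  then show "expand (mat_diag (ansatz_frame y)) (star0 (form_of_list phi_vert)) = (\<lambda>K. y ^ 4 * star0
      (form_of_list phi_vert) K)"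
    by (simp add: form_of_list_star_list wf_list_lists)
  have "expand (mat_diag (ansatz_frame y)) (form_of_list (star_list phi_hor)) = (\<lambda>K. 1 * form_of_list
      (star_list phi_hor) K)"
    by (rule expand_mat_diag_form_of_list[OF wf_list_lists(5)]) (use star_list_ansatz(2) assms in \<open>auto
        simp: ansatz_frame_def power3_eq_cube\<close>)
  then show "expand (mat_diag (ansatz_frame y)) (star0 (form_of_list phi_hor)) = star0 (form_of_list phi_hor)"
    by (simp add: form_of_list_star_list wf_list_lists)
qed

context
  fixes y :: real assumes y: "y > 0"
begin

lemma fdet_ansatz_frame: "fdet (mat_diag (ansatz_frame y)) = y ^ 3"
proof -
  have "prod (ansatz_frame y) U7 = y ^ 3"
    unfolding U7_set using y by (simp add: ansatz_frame_def) (simp add: power3_eq_cube)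
  then show ?thesis by (simp add: fdet_mat_diag)
qed

lemma frame_phi_y: "G2frame (phi_y y) (mat_diag (ansatz_frame y))"
  using y unfolding G2frame_def is_basis_iff fdet_ansatz_frame phi0_form_of_list
  by (simp add: phi_y_form_of_list expand_lin[where a=1 and b=1, simplified] expand_ansatz)

lemma starphi_phi_y: "starphi (phi_y y) (phi_y y) = (\<lambda>K. y ^ 4 * star0 (form_of_list phi_vert) K +
    star0 (form_of_list phi_hor) K)"
  using y by (simp add: starphi_phi[OF frame_phi_y] psi0_def phi0_form_of_list star0_lin[where a=1 and b=1,
      simplified]
      expand_lin[where a=1 and b=1, simplified] expand_ansatz)

lemma closed_phi_y: "dform (starphi (phi_y y) (phi_y y)) = zeroform"
  using dform_lin[of "y ^ 4" "star0 (form_of_list phi_vert)" 1 "star0 (form_of_list phi_hor)"]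
  by (simp add: starphi_phi_y dform_ansatz zeroform_def)

lemma dform_phi_y: "dform (phi_y y) = (\<lambda>K. sqrt 6 / (3 * y) * star0 (form_of_list phi_vert) K)"
  unfolding phi_y_form_of_list dform_lin dform_ansatz by (simp add: mult.commute)

lemma tau0_phi_y: "tau0 (phi_y y) = sqrt 6 / (7 * y ^ 5)"
proof -
  have "wedge (dform (phi_y y)) (phi_y y) U7 = sqrt 6 / (3 * y) * (1 / y * 3)"
    unfolding dform_phi_y wedge_scale_left unfolding phi_y_form_of_list wedge_lin_right by (simp add: wedge_ansatz)
  then show ?thesis using y
    by (simp add: tau0_frame[OF frame_phi_y closed_phi_y] fdet_ansatz_frame) (simp add: field_simps eval_nat_numeral)
qed

lemma starphi_dform_phi_y:
  "dform (starphi (phi_y y) (dform (phi_y y))) = (\<lambda>K. 2 / (3 * y ^ 6) * star0 (form_of_list phi_vert) K)"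
proof -
  have e: "dform (phi_y y) = expand (mat_diag (ansatz_frame y)) (\<lambda>K. sqrt 6 / (3 * y ^ 5) * star0
      (form_of_list phi_vert) K)"
    unfolding dform_phi_y expand_scale expand_ansatz(3)[OF y] using y
    by (simp add: field_simps eval_nat_numeral)
  have "starphi (phi_y y) (dform (phi_y y)) = expand (mat_diag (ansatz_frame y)) (star0 (\<lambda>K. sqrt 6 /
      (3 * y ^ 5) * star0 (form_of_list phi_vert) K))"
    unfolding e by (rule starphi_expand[OF frame_phi_y supported_scale[OF supported_star0]])
  also have "\<dots> = (\<lambda>K. sqrt 6 / (3 * y ^ 5) * (1 / y * form_of_list phi_vert K))"
    unfolding star0_scale star0_star0[OF supported_form_of_list[OF wf_list_lists(2)]] expand_scale
        expand_ansatz(1)[OF y] ..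
  finally show ?thesis by (simp only: dform_scale dform_ansatz) (simp add: field_simps eval_nat_numeral)
qed

text \<open>The moving coefficient of \<psi> is y^4, so the factor \<open>4 * y ^ 3\<close> is split
  off as the chain rule produces it; what remains is the scalar equation.\<close>

lemma coflow_rhs_phi_y:
  "coflow_rhs A (phi_y y) K = 4 * y ^ 3 * ((2 * A * sqrt 6 * y ^ 5 - 1) / (12 * y ^ 9)) * star0 (form_of_list
      phi_vert) K"
proof -
  have p: "fdet (mat_diag (ansatz_frame y)) > 0" using y by (simp add: fdet_ansatz_frame)
  note P = frame_phi_y p
  have od: "supported (dform (phi_y y))" unfolding dform_phi_y by (intro supported_scale supported_star0)
  have "tau0_of (starphi (phi_y y) (phi_y y)) = tau0 (phi_y y)"
    by (simp add: tau0_of_def phi_of_frame[OF P] vol_of_frame[OF P] tau0_frame[OF frame_phi_y closed_phi_y])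
  then have "coflow_rhs A (phi_y y) K = 2 / (3 * y ^ 6) * star0 (form_of_list phi_vert) K
      + 2 * ((A - 7 / 4 * (sqrt 6 / (7 * y ^ 5))) * (sqrt 6 / (3 * y) * star0 (form_of_list phi_vert) K))"
    unfolding coflow_rhs_frame[OF P closed_phi_y] rhs_of_def phi_of_frame[OF P] hodge_of_frame[OF P od]
      starphi_dform_phi_y dform_scale
    by (simp add: dform_phi_y tau0_phi_y)
  also have "\<dots> = (2 / (3 * y ^ 6) + 2 * ((A - 7 / 4 * (sqrt 6 / (7 * y ^ 5))) * (sqrt 6 / (3 * y)))) *
      star0 (form_of_list phi_vert) K"
    by (simp add: algebra_simps)
  also have "2 / (3 * y ^ 6) + 2 * ((A - 7 / 4 * (sqrt 6 / (7 * y ^ 5))) * (sqrt 6 / (3 * y)))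
      = 4 * y ^ 3 * ((2 * A * sqrt 6 * y ^ 5 - 1) / (12 * y ^ 9))"
    using y by (simp add: divide_simps) (simp add: algebra_simps eval_nat_numeral)
  finally show ?thesis .
qed

end

lemma phi_y_1: "phi_y 1 = phi1"
  by (simp add: phi1_def phi_y_form_of_list phi0_form_of_list)

section \<open>From the scalar equation to maximal solutions\<close>

lemma ansatz_solution:
  assumes J: "is_interval J" "open J" "0 \<in> J" and y: "\<And>t. t \<in> J \<Longrightarrow> y t > 0" "y 0 = 1"
    and D: "\<And>t. t \<in> J \<Longrightarrow> (y has_real_derivative (2 * A * sqrt 6 * y t ^ 5 - 1) / (12 *
        y t ^ 9)) (at t)"
  shows "coflow_solution A J (\<lambda>t. phi_y (y t))"
  unfolding coflow_solution_def
proof (intro conjI ballI allI)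
  fix t assume t: "t \<in> J"
  have "fdet (mat_diag (ansatz_frame (y t))) > 0" using y(1)[OF t] by (simp add: fdet_ansatz_frame)
  then show "pos_G2 (phi_y (y t))"
    unfolding pos_G2_def fdet_def[symmetric] using frame_phi_y[OF y(1)[OF t]] by blast
  show "dform (starphi (phi_y (y t)) (phi_y (y t))) = zeroform" by (rule closed_phi_y[OF y(1)[OF t]])
  fix K
  have "((\<lambda>s. y s ^ 4 * star0 (form_of_list phi_vert) K + star0 (form_of_list phi_hor) K)
      has_real_derivative coflow_rhs A (phi_y (y t)) K) (at t)"
    unfolding coflow_rhs_phi_y[OF y(1)[OF t]] by (auto intro!: derivative_eq_intros D[OF t])
  \<comment> \<open>The formula for the four-form needs \<open>y s > 0\<close>, which is known only
    on \<open>J\<close>; openness of \<open>J\<close> is what permits the replacement.\<close>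
  then show "((\<lambda>s. starphi (phi_y (y s)) (phi_y (y s)) K) has_real_derivative coflow_rhs A (phi_y (y
      t)) K) (at t)"
    by (rule has_field_derivative_transform_within_open[OF _ J(2) t]) (simp add: starphi_phi_y y(1))
qed (use J y phi_y_1 in auto)

lemma det_phi_y:
  assumes "y > 0"
  shows "fdet (gram_form (star0 (starphi (phi_y y) (phi_y y)))) = 6 ^ 7 * y ^ 36"
  using det_gram_form_frame[OF frame_phi_y[OF assms]] assms by (simp add: fdet_ansatz_frame flip: power_mult)

lemma coflow_no_collapse:
  assumes y: "\<And>t. t \<in> {..<T} \<Longrightarrow> y t > 0" and z: "(y \<longlongrightarrow> 0) (at_left
      T)" and T: "0 < T"
    and s: "coflow_solution A {..<T} (\<lambda>t. phi_y (y t))" and s': "coflow_solution A J \<phi>"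
  shows "J \<subseteq> {..<T}"
proof
  fix s assume "s \<in> J"
  show "s \<in> {..<T}"
  proof (rule ccontr)
    assume "s \<notin> {..<T}"
    moreover have i: "is_interval J" "0 \<in> J" using s' by (auto simp: coflow_solution_def)
    ultimately have J: "t \<in> J" if "t \<in> {0..T}" for t
      using mem_is_interval_1_I[of J 0 s t] \<open>s \<in> J\<close> that by auto
    define F where "F t = starphi (\<phi> t) (\<phi> t)" for t
    define q where "q t = fdet (gram_form (star0 (F t)))" for t
    note F = coflow_solutionD[OF s', folded F_def]
    have "continuous_on {0..T} (\<lambda>t. F t K)" for K
      using J by (auto intro!: continuous_at_imp_continuous_on DERIV_isCont[OF F(3)])
    \<comment> \<open>A solution compared with itself under the zero bound:
      \<open>comparable\<close> reduces to continuity, so its closure rules prove that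
      \<open>q\<close> is continuous.\<close>
    then have "comparable_form 0 T (\<lambda>_. 0) F F" by (auto simp: comparable_form_def comparable_def)
    then have "comparable 0 T (\<lambda>_. 0) q q"
      unfolding q_def by (intro comparable_fdet comparable_gram_form comparable_form_star0) auto
    then have "continuous_on {0..T} q" by (simp add: comparable_def)
    then have "(q \<longlongrightarrow> q T) (at T within {0..T})" using T by (simp add: continuous_on)
    then have 1: "(q \<longlongrightarrow> q T) (at_left T)"
      using T by (simp add: at_within_Icc_at_left)
    have "((\<lambda>t. 6 ^ 7 * y t ^ 36) \<longlongrightarrow> 6 ^ 7 * 0 ^ 36) (at_left T)" by (intro
        tendsto_intros z)
    moreover have "\<forall>\<^sub>F t in at_left T. 6 ^ 7 * y t ^ 36 = q t"
    proof -
      have "6 ^ 7 * y t ^ 36 = q t" if "t \<in> {0<..<T}" for t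
        using det_phi_y[OF y, of t] coflow_unique[OF s s', of t] J[of t] that by (simp add: q_def F_def)
      then show ?thesis using T eventually_at_left_real[of 0 T] by (auto elim!: eventually_mono)
    qed
    ultimately have "(q \<longlongrightarrow> 6 ^ 7 * 0 ^ 36) (at_left T)" by (rule Lim_transform_eventually)
    then have "q T = 0" using tendsto_unique[OF _ 1] by simp
    then show False using F(2)[of T] J[of T] T by (simp add: q_def)
  qed
qed

subsection \<open>The scalar equation\<close>

text \<open>With \<open>u = y^5\<close> and \<open>k = 2 * sqrt 6 * A\<close> the equation becomes \<open>u' =
    5 * (k * u - 1) / (12 * u)\<close>.  Substituting
  \<open>u = (1 + \<sigma> * exp w) / k\<close>, where \<open>\<sigma>\<close> is the sign of \<open>k * u -
      1\<close>, turns it into \<open>w' = 5 * k / (12 * u)\<close>,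
  whose solution is the inverse of \<open>time_of\<close>.\<close>

definition time_of :: "real \<Rightarrow> real \<Rightarrow> real \<Rightarrow> real" where
  "time_of k \<sigma> w = 12 / (5 * k\<^sup>2) * (1 - k + \<sigma> * exp w + w - ln \<bar>1 - k\<bar>)"

lemma time_of_deriv:
  "(time_of k \<sigma> has_real_derivative 12 / (5 * k\<^sup>2) * (1 + \<sigma> * exp w)) (at w)"
proof -
  have "((\<lambda>w. c * (1 - k + \<sigma> * exp w + w - l)) has_real_derivative c * (1 + \<sigma> * exp w))
      (at w)" for c l
    by (auto intro!: derivative_eq_intros simp: algebra_simps)
  then show ?thesis unfolding time_of_def[abs_def] .
qed

text \<open>Positivity is asked only strictly below \<open>v\<close>. This admits the endpoint
  \<open>v = 0\<close> of the shrinking case, where the derivative vanishes.\<close>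

lemma time_of_less:
  assumes "k > 0" "\<And>x. x < v \<Longrightarrow> 1 + \<sigma> * exp x > 0" "w < v"
  shows "time_of k \<sigma> w < time_of k \<sigma> v"
proof (rule DERIV_pos_imp_increasing_open[OF assms(3)])
  show "\<exists>y. (time_of k \<sigma> has_real_derivative y) (at x) \<and> 0 < y" if "w < x" "x < v" for x
    using time_of_deriv[of k \<sigma> x] assms(1) assms(2)[OF that(2)]
    by (intro exI[of _ "12 / (5 * k\<^sup>2) * (1 + \<sigma> * exp x)"]) simp
  show "continuous_on {w..v} (time_of k \<sigma>)"
    by (intro continuous_at_imp_continuous_on ballI DERIV_isCont[OF time_of_deriv])
qed

text \<open>One statement for both signs \<sigma>. The stationary case \<open>k = 1\<close> is
  excluded, since there the initial value of w would be the logarithm of 0.\<close>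

lemma ode_from_inverse:
  fixes W J :: "real set"
  assumes k: "k > 0" and W: "open W" "\<And>x. x \<in> W \<Longrightarrow> 1 + \<sigma> * exp x > 0"
    and im: "time_of k \<sigma> ` W = J" and inj: "inj_on (time_of k \<sigma>) W"
    and w0: "ln \<bar>1 - k\<bar> \<in> W" and k1: "1 + \<sigma> * \<bar>1 - k\<bar> = k" "k \<noteq> 1"
  defines "w \<equiv> inv_into W (time_of k \<sigma>)"
  defines "y \<equiv> \<lambda>t. root 5 ((1 + \<sigma> * exp (w t)) / k)"
  shows "y 0 = 1" "t \<in> J \<Longrightarrow> y t > 0"
    "t \<in> J \<Longrightarrow> (y has_real_derivative (k * y t ^ 5 - 1) / (12 * y t ^ 9)) (at t)"
proof -
  \<comment> \<open>The additive constants of \<open>time_of\<close> are chosen for this: at this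
    point \<open>\<sigma> * exp w\<close> equals \<open>k - 1\<close>.\<close>
  have "time_of k \<sigma> (ln \<bar>1 - k\<bar>) = 0" using k1 by (simp add: time_of_def)
  then have "w 0 = ln \<bar>1 - k\<bar>" unfolding w_def using inv_into_f_f[OF inj w0] by simp
  then show "y 0 = 1" using k1 k by (simp add: y_def)
next
  assume "t \<in> J"
  then obtain x where x: "x \<in> W" "t = time_of k \<sigma> x" using im by auto
  then have wt: "w t = x" unfolding w_def using inv_into_f_f[OF inj] by simp
  show y: "y t > 0" using W(2)[OF x(1)] k by (simp add: y_def wt)
  have dw: "(w has_real_derivative inverse (12 / (5 * k\<^sup>2) * (1 + \<sigma> * exp x))) (at (time_of k
      \<sigma> x))"
  proof -
    let ?D = "12 / (5 * k\<^sup>2) * (1 + \<sigma> * exp x)"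
    have "continuous_on W (time_of k \<sigma>)"
      by (intro continuous_at_imp_continuous_on ballI DERIV_isCont[OF time_of_deriv])
    moreover have "(*) ?D \<circ> (*) (inverse ?D) = id"
    proof -
      have "?D \<noteq> 0" using k W(2)[OF x(1)] by simp
      then show ?thesis by (auto simp: fun_eq_iff simp flip: mult.assoc)
    qed
    ultimately show ?thesis
      unfolding has_field_derivative_def
      using has_derivative_inverse_strong[OF W(1) x(1), of "time_of k \<sigma>" w "(*) ?D" "(*) (inverse ?D)"]
        time_of_deriv[of k \<sigma> x, unfolded has_field_derivative_def]
      by (simp add: w_def inv_into_f_f[OF inj])
  qed
  define u where "u = (1 + \<sigma> * exp x) / k"
  have u: "u > 0" using W(2)[OF x(1)] k by (simp add: u_def)
  have yu: "y t = root 5 u" by (simp add: y_def wt u_def)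
  then have y5: "y t ^ 5 = u" using u by simp
  have sx: "\<sigma> * exp x = k * u - 1" "1 + \<sigma> * exp x = k * u" using k by (simp_all add: u_def)
  have dw': "(w has_real_derivative 5 * k / (12 * u)) (at t)"
    using dw u k unfolding x(2) sx by (simp add: field_simps power2_eq_square)
  have "((\<lambda>s. (1 + \<sigma> * exp (w s)) / k) has_real_derivative \<sigma> * exp x * (5 * k / (12 * u))
      / k) (at t)"
    using k by (auto intro!: derivative_eq_intros dw' simp: wt)
  then have du: "((\<lambda>s. (1 + \<sigma> * exp (w s)) / k) has_real_derivative 5 * (k * u - 1) / (12 * u)) (at t)"
    using k unfolding sx by (simp add: mult.commute)
  have dr: "(root 5 has_real_derivative inverse (real 5 * root 5 u ^ (5 - Suc 0))) (at ((1 + \<sigma> * exp (w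
      t)) / k))"
    using DERIV_real_root[OF _ u, of 5] by (simp add: wt u_def)
  have "(y has_real_derivative inverse (5 * root 5 u ^ 4) * (5 * (k * u - 1) / (12 * u))) (at t)"
    using DERIV_chain2[OF dr du] unfolding y_def by simp
  also have "inverse (5 * root 5 u ^ 4) * (5 * (k * u - 1) / (12 * u)) = (k * y t ^ 5 - 1) / (12 * y t ^ 9)"
  proof -
    have "y t ^ 9 = y t ^ 4 * u" by (simp flip: y5 power_add)
    then show ?thesis using y5 y u by (simp add: yu[symmetric] field_simps)
  qed
  finally show "(y has_real_derivative (k * y t ^ 5 - 1) / (12 * y t ^ 9)) (at t)" .
qed

lemma time_of_isCont: "isCont (time_of k \<sigma>) x"
  by (rule DERIV_isCont[OF time_of_deriv])

text \<open>For \<sigma> = 1 time is an increasing affine function of exp w + w, which runs through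
  all reals; hence its inverse is defined for all times.\<close>

lemma ode_expanding:
  assumes k: "k > 1"
  shows "\<exists>y. y 0 = 1 \<and> (\<forall>t. y t > 0 \<and> (y has_real_derivative (k * y t ^ 5 - 1) / (12
      * y t ^ 9)) (at t))"
proof -
  have m: "time_of k 1 w < time_of k 1 v" if "w < v" for w v
    using that k by (intro time_of_less) (auto intro: add_pos_pos)
  have im: "range (time_of k 1) = UNIV"
  proof -
    have "\<exists>x. time_of k 1 x = t" for t
    proof -
      define c where "c = 12 / (5 * k\<^sup>2)"
      have c: "c > 0" using k by (simp add: c_def)
      define d where "d = t / c - (1 - k - ln \<bar>1 - k\<bar>)"
      have h: "time_of k 1 x - t = c * (exp x + x - d)" for x
        using c by (simp add: time_of_def c_def[symmetric] d_def algebra_simps)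
      \<comment> \<open>At this point the exponential is at most 1 and the linear term at most d -
        1. The bounds by 0, here and in the upper witness, put the two witnesses in order.\<close>
      have "exp (min 0 (d - 1)) \<le> 1" by simp
      then have "exp (min 0 (d - 1)) + min 0 (d - 1) - d \<le> 0" by linarith
      then have "time_of k 1 (min 0 (d - 1)) - t \<le> 0" unfolding h using c by (intro mult_nonneg_nonpos) auto
      then have 1: "time_of k 1 (min 0 (d - 1)) \<le> t" by simp
      have "exp (max 0 d) + max 0 d - d \<ge> 0" using exp_ge_zero[of "max 0 d"] by linarith
      then have 2: "t \<le> time_of k 1 (max 0 d)" using h[of "max 0 d"] c by (metis diff_ge_0_iff_ge
          less_imp_le mult_nonneg_nonneg)
      show ?thesis using IVT[of "time_of k 1", OF 1 2] time_of_isCont by fastforce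
    qed
    then show ?thesis by (metis surj_def)
  qed
  have inj: "inj (time_of k 1)" by (rule injI) (metis m less_irrefl linorder_neqE_linordered_idom)
  define y where "y = (\<lambda>t. root 5 ((1 + 1 * exp (inv (time_of k 1) t)) / k))"
  have "0 < k" "\<And>x::real. 1 + 1 * exp x > 0" using k by (auto intro: add_pos_pos)
  note ode = ode_from_inverse[of k UNIV 1 UNIV, OF this(1) open_UNIV this(2) im inj]
  have "y 0 = 1" "y t > 0" "(y has_real_derivative (k * y t ^ 5 - 1) / (12 * y t ^ 9)) (at t)" for t
    unfolding y_def using k by (intro ode; simp)+
  then show ?thesis by blast
qed

text \<open>For \<sigma> = -1 positivity of u forces w < 0. The time T is the value of
  \<open>time_of\<close> at w = 0, where u = (1 - exp w) / k vanishes; as w tends to minus infinity,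
  so does time.\<close>

lemma ode_shrinking:
  assumes k: "0 < k" "k < 1"
  defines "T \<equiv> 12 / (5 * k\<^sup>2) * (- k - ln (1 - k))"
  shows "\<exists>y. y 0 = 1 \<and> (y \<longlongrightarrow> 0) (at_left T) \<and>
    (\<forall>t\<in>{..<T}. y t > 0 \<and> (y has_real_derivative (k * y t ^ 5 - 1) / (12 * y t ^ 9)) (at t))"
proof -
  have m: "time_of k (-1) w < time_of k (-1) v" if "w < v" "v \<le> 0" for w v
    using that k by (intro time_of_less) auto
  have T: "time_of k (-1) 0 = T" using k by (simp add: time_of_def T_def)
  have im: "time_of k (-1) ` {..<0} = {..<T}"
  proof (intro equalityI subsetI)
    fix t assume "t \<in> time_of k (-1) ` {..<0}"
    then show "t \<in> {..<T}" using m[of _ 0] T by auto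
  next
    fix t assume t: "t \<in> {..<T}"
    define c where "c = 12 / (5 * k\<^sup>2)"
    have c: "c > 0" using k by (simp add: c_def)
    define d where "d = t / c - (1 - k - ln \<bar>1 - k\<bar>)"
    have h: "time_of k (-1) x - t = c * (x - exp x - d)" for x
      using c by (simp add: time_of_def c_def[symmetric] d_def algebra_simps)
    \<comment> \<open>Any point below d works, since the exponential enters with a negative sign;
      the bound by 0 keeps it left of the endpoint.\<close>
    have "min 0 d - exp (min 0 d) - d \<le> 0" using exp_ge_zero[of "min 0 d"] by linarith
    then have "time_of k (-1) (min 0 d) - t \<le> 0" unfolding h using c by (intro mult_nonneg_nonpos) auto
    then have 1: "time_of k (-1) (min 0 d) \<le> t" by simp
    have 2: "t \<le> time_of k (-1) 0" using T t by simp
    obtain x where x: "min 0 d \<le> x" "x \<le> 0" "time_of k (-1) x = t" using IVT[of "time_of k (-1)", OF 1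
        2] time_of_isCont by fastforce
    have "x \<noteq> 0" using x T t by auto
    then show "t \<in> time_of k (-1) ` {..<0}" using x by force
  qed
  have inj: "inj_on (time_of k (-1)) {..<0}"
    by (rule inj_onI) (metis m lessThan_iff less_imp_le less_irrefl linorder_neqE_linordered_idom)
  define w where "w = inv_into {..<0} (time_of k (-1))"
  define y where "y = (\<lambda>t. root 5 ((1 + (-1) * exp (w t)) / k))"
  note ode = ode_from_inverse[of k "{..<0}" "-1" "{..<T}", OF k(1) open_lessThan _ im inj]
  \<comment> \<open>Monotonicity of \<open>time_of\<close> turns t close to T into w close to 0;
    continuity then carries the limit over to y.\<close>
  have "(w \<longlongrightarrow> 0) (at_left T)"
  proof (rule order_tendstoI)
    fix a :: real assume a: "a < 0"
    then have "time_of k (-1) a < T" using m[of a 0] T by simp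
    moreover have "a < w t" if "t \<in> {time_of k (-1) a<..<T}" for t
    proof -
      have wt: "w t \<in> {..<0}" "time_of k (-1) (w t) = t"
        using inv_into_into[of t "time_of k (-1)" "{..<0}"] f_inv_into_f[of t "time_of k (-1)" "{..<0}"] that
        unfolding w_def im by simp_all
      show ?thesis
      proof (rule ccontr)
        assume "\<not> a < w t"
        then have "time_of k (-1) (w t) \<le> time_of k (-1) a" using m[of "w t" a] a by (cases "w t = a") auto
        then show False using wt that by simp
      qed
    qed
    ultimately show "\<forall>\<^sub>F t in at_left T. a < w t"
      by (blast intro: eventually_mono[OF eventually_at_left_real])
  next
    fix a :: real assume a: "0 < a"
    have "w t < a" if "t < T" for t
      using inv_into_into[of t "time_of k (-1)" "{..<0}"] that a unfolding w_def im by simp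
    then show "\<forall>\<^sub>F t in at_left T. w t < a" by (auto simp: eventually_at_filter)
  qed
  then have "(y \<longlongrightarrow> root 5 ((1 + (-1) * exp 0) / k)) (at_left T)"
    unfolding y_def using k by (intro tendsto_intros) auto
  then have "(y \<longlongrightarrow> 0) (at_left T)" by simp
  moreover have "y 0 = 1"
    unfolding y_def w_def by (rule ode) (use k in auto)
  moreover have "y t > 0" "(y has_real_derivative (k * y t ^ 5 - 1) / (12 * y t ^ 9)) (at t)" if "t \<in>
      {..<T}" for t
    unfolding y_def w_def by (rule ode; use k that in auto)+
  ultimately show ?thesis by blast
qed

theorem theorem5p1:
  fixes A :: real
  assumes "A > 0"
  shows "(A < 1 / (2 * sqrt 6) \<longrightarrow>
            (let T = - (1 / (10 * A ^ 2)) * (2 * sqrt 6 * A + ln (1 - 2 * sqrt 6 * A)) in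
              0 < T \<and>
              (\<exists>y :: real \<Rightarrow> real. y 0 = 1 \<and>
                 (\<forall>t\<in>{..<T}. (y has_real_derivative
                     (2 * A * sqrt 6 * y t ^ 5 - 1) / (12 * y t ^ 9)) (at t)) \<and>
                 maximal_coflow_solution A {..<T} (\<lambda>t. phi_y (y t)))))
       \<and> (A \<ge> 1 / (2 * sqrt 6) \<longrightarrow>
              (\<exists>y :: real \<Rightarrow> real. y 0 = 1 \<and>
                 (\<forall>t. (y has_real_derivative
                     (2 * A * sqrt 6 * y t ^ 5 - 1) / (12 * y t ^ 9)) (at t)) \<and>
                 maximal_coflow_solution A UNIV (\<lambda>t. phi_y (y t))))"
proof (intro conjI impI)
  define k where "k = 2 * sqrt 6 * A"
  have k: "k > 0" "2 * A * sqrt 6 = k" using assms by (simp_all add: k_def)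
  assume "A < 1 / (2 * sqrt 6)"
  then have k1: "k < 1" using assms by (simp add: k_def field_simps)
  define T where "T = - (1 / (10 * A ^ 2)) * (k + ln (1 - k))"
  \<comment> \<open>Strict concavity: ln x = x - 1 holds only at x = 1, and k is positive.\<close>
  have "ln (1 - k) < - k"
    using ln_le_minus_one[of "1 - k"] ln_eq_minus_one[of "1 - k"] k k1 by force
  then have T0: "0 < T" using assms by (simp add: T_def divide_neg_pos)
  \<comment> \<open>Here \<open>k\<^sup>2\<close> is 24 A^2.\<close>
  have "12 / (5 * k\<^sup>2) = 1 / (10 * A ^ 2)" using assms by (simp add: k_def power_mult_distrib)
  then have "T = 12 / (5 * k\<^sup>2) * (- k - ln (1 - k))"
    by (simp only: T_def) (simp add: diff_divide_distrib add_divide_distrib)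
  then obtain y where y: "y 0 = 1" "(y \<longlongrightarrow> 0) (at_left T)" "\<And>t. t \<in> {..<T}
      \<Longrightarrow> y t > 0"
    "\<And>t. t \<in> {..<T} \<Longrightarrow> (y has_real_derivative (2 * A * sqrt 6 * y t ^ 5 - 1) / (12 * y
        t ^ 9)) (at t)"
    using ode_shrinking[OF k(1) k1] unfolding k(2) by metis
  have s: "coflow_solution A {..<T} (\<lambda>t. phi_y (y t))"
    using T0 y by (intro ansatz_solution) (auto simp: is_interval_1)
  have "maximal_coflow_solution A {..<T} (\<lambda>t. phi_y (y t))"
    unfolding maximal_coflow_solution_def
    using s coflow_no_collapse[OF y(3,2) T0 s] coflow_unique[OF _ s] by blast
  then show "let T = - (1 / (10 * A ^ 2)) * (2 * sqrt 6 * A + ln (1 - 2 * sqrt 6 * A)) in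
              0 < T \<and>
              (\<exists>y :: real \<Rightarrow> real. y 0 = 1 \<and>
                 (\<forall>t\<in>{..<T}. (y has_real_derivative
                     (2 * A * sqrt 6 * y t ^ 5 - 1) / (12 * y t ^ 9)) (at t)) \<and>
                 maximal_coflow_solution A {..<T} (\<lambda>t. phi_y (y t)))"
    unfolding k_def[symmetric] T_def[symmetric] Let_def using T0 y by blast
next
  define k where "k = 2 * sqrt 6 * A"
  have k: "2 * A * sqrt 6 = k" by (simp add: k_def)
  assume "A \<ge> 1 / (2 * sqrt 6)"
  then have "k \<ge> 1" by (simp add: k_def field_simps)
  have "\<exists>y. y 0 = 1 \<and> (\<forall>t. y t > 0 \<and> (y has_real_derivative (k * y t ^ 5 - 1) / (12 *
      y t ^ 9)) (at t))"
  proof (cases "k = 1")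
    case True
    \<comment> \<open>At the critical constant the initial value 1 is a zero of the right-hand side,
      so the solution is stationary.\<close>
    then show ?thesis by (intro exI[of _ "\<lambda>_. 1"]) simp
  next
    case False
    then show ?thesis using ode_expanding[of k] \<open>k \<ge> 1\<close> by simp
  qed
  then obtain y where y: "y 0 = 1" "\<And>t. y t > 0"
    "\<And>t. (y has_real_derivative (2 * A * sqrt 6 * y t ^ 5 - 1) / (12 * y t ^ 9)) (at t)"
    unfolding k by metis
  have s: "coflow_solution A UNIV (\<lambda>t. phi_y (y t))"
    using y by (intro ansatz_solution) auto
  then have "maximal_coflow_solution A UNIV (\<lambda>t. phi_y (y t))"
    unfolding maximal_coflow_solution_def using coflow_unique[OF _ s] by blast
  then show "\<exists>y :: real \<Rightarrow> real. y 0 = 1 \<and>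
                 (\<forall>t. (y has_real_derivative
                     (2 * A * sqrt 6 * y t ^ 5 - 1) / (12 * y t ^ 9)) (at t)) \<and>
                 maximal_coflow_solution A UNIV (\<lambda>t. phi_y (y t))"
    using y by blast
qed

end
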